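(* Let $X$ be a set, $F$ a set of functions from $X$ to $[0,1]$, and $\epsilon,\delta>0$. (i) If there exists $\kappa>0$ such that for all $\epsilon'>0$, $\mathrm{fat}_F((1/4-\kappa)\epsilon')$ is finite, then there is a learner $A$ that $(\epsilon,\delta)$-learns in the agnostic sense with respect to $F$ from $$O\left(\frac{1}{\epsilon^2}\left(\mathrm{fat}_F((1/4-\kappa)\epsilon)\,\log^2\frac1\epsilon+\log\frac1\delta\right)\right)$$ examples. (ii) If there exists $\kappa>0$ such that for all $\epsilon'>0$, $\mathrm{fatV}_F((1/4-\kappa)\epsilon')$ is finite, then there is a learner $A$ that $(\epsilon,\delta)$-learns in the agnostic sense with respect to $F$ from $$O\left(\frac{1}{\epsilon^2}\left(\frac1\epsilon\,\mathrm{fatV}_F((1/4-\kappa)\epsilon)\,\log\frac1\epsilon+\log\frac1\delta\right)\right)$$ examples.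
   Context: A learner for $X$ is a mapping from $\bigcup_{n}(X\times[0,1])^n$ to $[0,1]^X$. For $h:X\to[0,1]$ and a probability distribution $P$ on $X\times[0,1]$, $\mathbf{er}_P(h)=\int|h(x)-y|\,dP(x,y)$. For $0<\epsilon,\delta<1$ and $m\in\mathbb N$, a learner $A$ $(\epsilon,\delta)$-learns in the agnostic sense with respect to $F$ from $m$ examples if for all probability distributions $P$ on $X\times[0,1]$, $$P^m\Big\{w\in(X\times[0,1])^m:\ \mathbf{er}_P(A(w))\ge\inf_{f\in F}\mathbf{er}_P(f)+\epsilon\Big\}<\delta .$$ For a scale $\gamma>0$, $F$ $\gamma$-fatly shatters a sequence $(x_1,r_1),\dots,(x_d,r_d)$ in $X\times[0,1]$ if for every $b\in\{0,1\}^d$ there is $f\in F$ with, for all $j$, $f(x_j)\ge r_j+\gamma$ if $b_j=1$ and $f(x_j)\le r_j-\gamma$ if $b_j=0$. $\mathrm{fat}_F(\gamma)$ is the largest length of such a sequence ($\infty$ if unbounded). $\mathrm{fatV}_F(\gamma)$ is defined in the same way but requiring all the thresholds to be equal, $r_1=\dots=r_d=r$ for a single $r\in[0,1]$. Convention: issues of measurability are ignored; the reader may assume that $X$ is countable. *)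

theory Defs
  imports "HOL-Probability.Probability"
begin

definition prob_dist_on :: "'a set \<Rightarrow> ('a \<times> real) measure \<Rightarrow> bool" where
  "prob_dist_on X P \<longleftrightarrow>
     prob_space P \<and> sets P = sets (count_space X \<Otimes>\<^sub>M restrict_space borel {0..1::real})"

definition err :: "('a \<times> real) measure \<Rightarrow> ('a \<Rightarrow> real) \<Rightarrow> real" where
  "err P h = (\<integral>z. \<bar>h (fst z) - snd z\<bar> \<partial>P)"

definition learners :: "'a set \<Rightarrow> (('a \<times> real) list \<Rightarrow> 'a \<Rightarrow> real) set" where
  "learners X = lists (X \<times> {0..1}) \<rightarrow> (X \<rightarrow>\<^sub>E {0..1})"

text \<open>
  The infimum is taken in the extended reals, so that it is infinite for an empty class.
  The failure event is required to be measurable: \<^const>\<open>measure\<close> assigns 0 to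
  non-measurable sets, so without this a badly behaved learner would succeed vacuously.
\<close>

definition failure_event ::
  "('a \<Rightarrow> real) set \<Rightarrow> (('a \<times> real) list \<Rightarrow> 'a \<Rightarrow> real) \<Rightarrow> real \<Rightarrow> nat
     \<Rightarrow> ('a \<times> real) measure \<Rightarrow> (nat \<Rightarrow> 'a \<times> real) set" where
  "failure_event F A \<epsilon> m P =
     {w \<in> space (\<Pi>\<^sub>M i\<in>{..<m}. P).
        ereal (err P (A (map w [0..<m]))) \<ge> (INF f\<in>F. ereal (err P f)) + ereal \<epsilon>}"

definition agnostic_learns ::
  "'a set \<Rightarrow> ('a \<Rightarrow> real) set \<Rightarrow> (('a \<times> real) list \<Rightarrow> 'a \<Rightarrow> real)
     \<Rightarrow> real \<Rightarrow> real \<Rightarrow> nat \<Rightarrow> bool" where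
  "agnostic_learns X F A \<epsilon> \<delta> m \<longleftrightarrow>
     (\<forall>P. prob_dist_on X P \<longrightarrow>
        failure_event F A \<epsilon> m P \<in> sets (\<Pi>\<^sub>M i\<in>{..<m}. P) \<and>
        measure (\<Pi>\<^sub>M i\<in>{..<m}. P) (failure_event F A \<epsilon> m P) < \<delta>)"

definition fatly_shatters ::
  "'a set \<Rightarrow> ('a \<Rightarrow> real) set \<Rightarrow> real \<Rightarrow> ('a \<times> real) list \<Rightarrow> bool" where
  "fatly_shatters X F \<gamma> xrs \<longleftrightarrow>
     set xrs \<subseteq> X \<times> {0..1} \<and>
     (\<forall>b :: bool list. length b = length xrs \<longrightarrow>
        (\<exists>f\<in>F. \<forall>j<length xrs.
           (b ! j \<longrightarrow> f (fst (xrs ! j)) \<ge> snd (xrs ! j) + \<gamma>) \<and>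
           (\<not> b ! j \<longrightarrow> f (fst (xrs ! j)) \<le> snd (xrs ! j) - \<gamma>)))"

definition fat :: "'a set \<Rightarrow> ('a \<Rightarrow> real) set \<Rightarrow> real \<Rightarrow> enat" where
  "fat X F \<gamma> = Sup {enat (length xrs) | xrs. fatly_shatters X F \<gamma> xrs}"

definition fatV :: "'a set \<Rightarrow> ('a \<Rightarrow> real) set \<Rightarrow> real \<Rightarrow> enat" where
  "fatV X F \<gamma> =
     Sup {enat (length xs) | xs r. r \<in> {0..1} \<and> fatly_shatters X F \<gamma> (map (\<lambda>x. (x, r)) xs)}"

end

theory Submission
  imports Defs
begin

text \<open>
  The learner is approximate empirical risk minimization over a countable pointwise dense
  subclass. By symmetrization, replacing every function by the nearest element of an empirical
  \<open>L\<^sub>1\<close>-cover of radius \<open>\<alpha>\<close> on a double sample costs \<open>2 \<alpha>\<close> on a single half, so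
  \<open>\<alpha> = (1/2 - \<kappa>) \<epsilon>\<close> leaves room for the stochastic errors, and it remains to bound the size of an
  \<open>\<alpha>\<close>-separated class by its dimension at a scale slightly below \<open>\<alpha> / 2\<close>.

  For \<open>fatV\<close>, consider at each threshold the majority vote among the functions that agree with
  the sample. A weighted edge-density bound for one-inclusion graphs shows that about \<open>d / \<alpha>\<close>
  rounded labels determine a function, on average, up to less than half the separation, so there
  are at most twice as many functions as label vectors.

  For \<open>fat\<close>, a random subsample of size logarithmic in the class keeps the class separated. On it, repeatedly
  splitting the class at a point and threshold that separate many pairs produces many shattered
  partial threshold maps, and the dimension bounds the number of such maps.
\<close>

section \<open>Weighted one-inclusion graphs\<close>

text \<open>The \<open>1 / 4\<close> comes from two halvings. A cover of radius \<alpha> on the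
  double sample may put its whole error on one half, so \<alpha> stays below
  \<open>\<epsilon> / 2\<close>; and two functions at mean distance \<alpha> have, at some point, a
  threshold between them with margin \<open>\<alpha> / 2\<close> on both sides. The slack \<kappa>
  pays for the stochastic errors in the first halving and for the rounding in the second. For
  \<open>fatV\<close> every single threshold contributes a multiple of \<open>d\<close>, and there
  are about \<open>1 / \<epsilon>\<close> thresholds: this is the extra
  \<open>1 / \<epsilon>\<close> of the second bound. For \<open>fat\<close> each split doubles the
  shattered maps but costs the class a factor polynomial in \<open>1 / \<epsilon>\<close>, which
  gives one logarithm; the other is the logarithm of the base in the bound on the number of maps.
  The claimed sample sizes tend to 0 when \<delta> tends to 1 and either the dimension is 0 or
  \<epsilon> tends to 1. A sample size that is rounded up is too large there, so dimension 0 and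
  \<open>1 / 2 < \<epsilon>\<close> need learners that see no sample at all.\<close>

text \<open>
  The smaller weight of the two ends of an edge is what a majority vote loses on that edge. In the
  induction, the maximum and the minimum of the weights over the two fibres of \<open>x\<close> replace the
  projection of a set family and the family of its doubly covered members.
\<close>

lemma one_inclusion_weight:
  fixes w :: "'j set \<Rightarrow> nat"
  assumes "finite S"
    and "\<And>A. A \<subseteq> S \<Longrightarrow> (\<forall>B\<subseteq>A. \<exists>v\<subseteq>S. w v > 0 \<and> v \<inter> A = B) \<Longrightarrow> card A \<le> d"
  shows "(\<Sum>v\<in>Pow S. \<Sum>j\<in>S - v. min (w v) (w (insert j v))) \<le> d * (\<Sum>v\<in>Pow S. w v)"
  using assms
proof (induction S arbitrary: w d rule: finite_induct)
  case empty
  show ?case by simp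
next
  case (insert x S)
  define lo where "lo v = min (w v) (w (insert x v))" for v
  define hi where "hi v = max (w v) (w (insert x v))" for v
  have split: "(\<Sum>v\<in>Pow (insert x S). \<phi> v) = (\<Sum>v\<in>Pow S. \<phi> v + \<phi> (insert x v))"
    for \<phi> :: "'j set \<Rightarrow> nat"
  proof -
    have "inj_on (insert x) (Pow S)"
      using insert.hyps(2) by (auto simp: inj_on_def)
    moreover have "Pow S \<inter> insert x ` Pow S = {}"
      using insert.hyps(2) by auto
    ultimately show ?thesis
      using insert.hyps(1)
      by (simp add: Pow_insert sum.union_disjoint sum.reindex sum.distrib)
  qed
  have total: "(\<Sum>v\<in>Pow (insert x S). w v) = (\<Sum>v\<in>Pow S. lo v) + (\<Sum>v\<in>Pow S. hi v)"
    unfolding split lo_def hi_def sum.distrib[symmetric] by (rule sum.cong) auto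
  \<comment> \<open>The four numbers are the weights on a square of the cube spanned by the
    directions \<open>j\<close> and \<open>x\<close>. Sorting each fibre of \<open>x\<close> into
    maximum and minimum can only increase the sum of the smaller ends of the two edges in direction
    \<open>j\<close>.\<close>
  have exchange: "min a b + min c e \<le> min (max a c) (max b e) + min (min a c) (min b e)"
    for a b c e :: nat
    by linarith
  have edges: "(\<Sum>v\<in>Pow (insert x S). \<Sum>j\<in>insert x S - v. min (w v) (w (insert j v)))
      \<le> (\<Sum>v\<in>Pow S. lo v + ((\<Sum>j\<in>S - v. min (hi v) (hi (insert j v)))
                              + (\<Sum>j\<in>S - v. min (lo v) (lo (insert j v)))))"
    unfolding split
  proof (rule sum_mono)
    fix v assume "v \<in> Pow S"
    with insert.hyps have x: "x \<notin> v" "insert x S - v = insert x (S - v)"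
        "insert x S - insert x v = S - v" "x \<notin> S - v" "finite (S - v)"
      by auto
    have "(\<Sum>j\<in>S - v. min (w v) (w (insert j v)))
        + (\<Sum>j\<in>S - v. min (w (insert x v)) (w (insert j (insert x v))))
      \<le> (\<Sum>j\<in>S - v. min (hi v) (hi (insert j v)) + min (lo v) (lo (insert j v)))"
      unfolding sum.distrib[symmetric] lo_def hi_def
    proof (rule sum_mono)
      fix j
      have eq: "insert x (insert j v) = insert j (insert x v)" by (rule insert_commute)
      show "min (w v) (w (insert j v)) + min (w (insert x v)) (w (insert j (insert x v)))
        \<le> min (max (w v) (w (insert x v))) (max (w (insert j v)) (w (insert x (insert j v))))
          + min (min (w v) (w (insert x v))) (min (w (insert j v)) (w (insert x (insert j v))))"
        unfolding eq by (rule exchange)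
    qed
    then show "(\<Sum>j\<in>insert x S - v. min (w v) (w (insert j v)))
        + (\<Sum>j\<in>insert x S - insert x v. min (w (insert x v)) (w (insert j (insert x v))))
      \<le> lo v + ((\<Sum>j\<in>S - v. min (hi v) (hi (insert j v)))
             + (\<Sum>j\<in>S - v. min (lo v) (lo (insert j v))))"
      unfolding x(2,3) using x(4,5) by (simp add: sum.distrib lo_def)
  qed
  have hi: "(\<Sum>v\<in>Pow S. \<Sum>j\<in>S - v. min (hi v) (hi (insert j v))) \<le> d * (\<Sum>v\<in>Pow S. hi v)"
  proof (rule insert.IH)
    fix A assume A: "A \<subseteq> S" "\<forall>B\<subseteq>A. \<exists>v\<subseteq>S. hi v > 0 \<and> v \<inter> A = B"
    show "card A \<le> d"
    proof (rule insert.prems)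
      show "A \<subseteq> insert x S" using A by auto
      show "\<forall>B\<subseteq>A. \<exists>v\<subseteq>insert x S. 0 < w v \<and> v \<inter> A = B"
      proof (intro allI impI)
        fix B assume "B \<subseteq> A"
        then obtain v where v: "v \<subseteq> S" "hi v > 0" "v \<inter> A = B" using A by blast
        have "insert x v \<inter> A = B" using v A insert.hyps by auto
        then show "\<exists>v\<subseteq>insert x S. 0 < w v \<and> v \<inter> A = B"
        proof (cases "w v > 0")
          case True
          then show ?thesis using v by (intro exI[of _ v]) auto
        next
          case False
          then have "w (insert x v) > 0" using v by (simp add: hi_def)
          with \<open>insert x v \<inter> A = B\<close> v show ?thesis by (intro exI[of _ "insert x v"]) auto
        qed
      qed
    qed
  qed
  \<comment> \<open>Where \<open>lo\<close> is positive both fibres are inhabited, so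
    \<open>x\<close> can be added to any set shattered there. The drop to \<open>d - 1\<close> saves
    one copy of the \<open>lo\<close> total, which pays for the edges in direction
    \<open>x\<close>.\<close>
  have shatter_lo: "card A + 1 \<le> d"
    if A: "A \<subseteq> S" "\<forall>B\<subseteq>A. \<exists>v\<subseteq>S. lo v > 0 \<and> v \<inter> A = B" for A
  proof -
    have "card (insert x A) \<le> d"
    proof (rule insert.prems)
      show "insert x A \<subseteq> insert x S" using A by auto
      show "\<forall>B\<subseteq>insert x A. \<exists>v\<subseteq>insert x S. 0 < w v \<and> v \<inter> insert x A = B"
      proof (intro allI impI)
        fix B assume B: "B \<subseteq> insert x A"
        then have "B - {x} \<subseteq> A" by auto
        with A(2) obtain v where v: "v \<subseteq> S" "lo v > 0" "v \<inter> A = B - {x}" by meson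
        have "x \<notin> v" using v insert.hyps by auto
        show "\<exists>v\<subseteq>insert x S. 0 < w v \<and> v \<inter> insert x A = B"
        proof (cases "x \<in> B")
          case True
          then show ?thesis using v by (intro exI[of _ "insert x v"]) (auto simp: lo_def)
        next
          case False
          then show ?thesis using v \<open>x \<notin> v\<close> by (intro exI[of _ v]) (auto simp: lo_def)
        qed
      qed
    qed
    moreover have "card (insert x A) = card A + 1"
      using A insert.hyps by (subst card_insert_disjoint) (auto intro: finite_subset)
    ultimately show ?thesis by simp
  qed
  have lo: "(\<Sum>v\<in>Pow S. \<Sum>j\<in>S - v. min (lo v) (lo (insert j v))) \<le> (d - 1) * (\<Sum>v\<in>Pow S. lo v)"
  proof (rule insert.IH)
    fix A assume "A \<subseteq> S" "\<forall>B\<subseteq>A. \<exists>v\<subseteq>S. 0 < lo v \<and> v \<inter> A = B"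
    from shatter_lo[OF this] show "card A \<le> d - 1" by simp
  qed
  \<comment> \<open>Natural subtraction makes \<open>d - 1\<close> equal to 0 when
    \<open>d = 0\<close>, so nothing is saved there; the \<open>lo\<close> total has to vanish
    instead.\<close>
  have d0: "(\<Sum>v\<in>Pow S. lo v) = 0" if "d = 0"
  proof (rule ccontr)
    assume "(\<Sum>v\<in>Pow S. lo v) \<noteq> 0"
    then obtain v where "v \<in> Pow S" "lo v \<noteq> 0" by (rule sum.not_neutral_contains_not_neutral)
    then have "card ({}::'j set) + 1 \<le> d" by (intro shatter_lo) (auto intro: exI[of _ v])
    with that show False by simp
  qed
  have "(\<Sum>v\<in>Pow (insert x S). \<Sum>j\<in>insert x S - v. min (w v) (w (insert j v)))
      \<le> (\<Sum>v\<in>Pow S. lo v) + (d * (\<Sum>v\<in>Pow S. hi v) + (d - 1) * (\<Sum>v\<in>Pow S. lo v))"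
    using edges hi lo by (simp add: sum.distrib)
  also have "\<dots> = d * (\<Sum>v\<in>Pow (insert x S). w v)"
    unfolding total using d0 by (cases d) (auto simp: algebra_simps)
  finally show ?case .
qed

section \<open>Errors of leave-one-out majority votes\<close>

lemma sum_card_fibres:
  assumes "finite A" "finite T" "lab ` A \<subseteq> T"
  shows "(\<Sum>c\<in>T. card {x \<in> A. lab x = c}) = card A"
  using sum.group[OF assms, of "\<lambda>_. 1::nat"] by simp

text \<open>Merging label classes can only increase a sum of minima, because the minimum is
  superadditive. This allows the passage to a predictor that sees less than the labels tell.\<close>

lemma sum_min_card_refine:
  assumes G: "finite G"
    and ref: "\<And>f f'. f \<in> G \<Longrightarrow> f' \<in> G \<Longrightarrow> lab f = lab f' \<Longrightarrow> lab' f = lab' f'"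
  shows "(\<Sum>c\<in>lab ` G. min (card {f\<in>G. lab f = c \<and> P f}) (card {f\<in>G. lab f = c \<and> Q f}))
    \<le> (\<Sum>c\<in>lab' ` G. min (card {f\<in>G. lab' f = c \<and> P f}) (card {f\<in>G. lab' f = c \<and> Q f}))"
proof -
  define \<phi> where "\<phi> c = lab' (SOME f. f \<in> G \<and> lab f = c)" for c
  have \<phi>: "\<phi> (lab f) = lab' f" if "f \<in> G" for f
  proof -
    have "(SOME f'. f' \<in> G \<and> lab f' = lab f) \<in> G \<and> lab (SOME f'. f' \<in> G \<and> lab f' = lab f) = lab f"
      by (rule someI[of _ f]) (use that in simp)
    then show ?thesis unfolding \<phi>_def using ref that by metis
  qed
  have fib: "(\<Sum>c\<in>{c \<in> lab ` G. \<phi> c = c'}. card {f\<in>G. lab f = c \<and> R f}) = card {f\<in>G. lab' f = c' \<and> R f}"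
    for R c'
  proof -
    have "(\<Sum>c\<in>{c \<in> lab ` G. \<phi> c = c'}. card {f\<in>G. lab f = c \<and> R f})
        = (\<Sum>c\<in>{c \<in> lab ` G. \<phi> c = c'}. card {f\<in>{f\<in>G. lab' f = c' \<and> R f}. lab f = c})"
      by (intro sum.cong arg_cong[where f = card]) (auto simp: \<phi>[symmetric])
    also have "\<dots> = card {f\<in>G. lab' f = c' \<and> R f}"
      using G by (intro sum_card_fibres) (auto simp: \<phi>)
    finally show ?thesis .
  qed
  have "(\<Sum>c\<in>lab ` G. min (card {f\<in>G. lab f = c \<and> P f}) (card {f\<in>G. lab f = c \<and> Q f}))
    = (\<Sum>c'\<in>lab' ` G. \<Sum>c\<in>{c \<in> lab ` G. \<phi> c = c'}.
          min (card {f\<in>G. lab f = c \<and> P f}) (card {f\<in>G. lab f = c \<and> Q f}))"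
    using G by (intro sum.group[symmetric]) (auto simp: \<phi>)
  also have "\<dots> \<le> (\<Sum>c\<in>lab' ` G. min (card {f\<in>G. lab' f = c \<and> P f}) (card {f\<in>G. lab' f = c \<and> Q f}))"
    unfolding fib[symmetric] by (intro sum_mono min.boundedI) auto
  finally show ?thesis .
qed

text \<open>\<open>T f j\<close> and \<open>N f j\<close> stand for \<open>f\<close> being clearly
  above or clearly below at position \<open>j\<close>; possibly neither holds. The left side counts
  the errors of a majority vote at \<open>j\<close> among the functions that share the label of the
  other positions. Grouping by the set of decided positions turns each group into a weighted cube,
  where such a vote errs on the smaller end of an edge.\<close>

lemma leave_one_out:
  fixes J :: "'j set" and G :: "'f set" and T N :: "'f \<Rightarrow> 'j \<Rightarrow> bool"
  assumes J: "finite J" and G: "finite G"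
    and disj: "\<And>f j. f \<in> G \<Longrightarrow> j \<in> J \<Longrightarrow> \<not> (T f j \<and> N f j)"
    and vc: "\<And>A. A \<subseteq> J \<Longrightarrow> (\<forall>B\<subseteq>A. \<exists>f\<in>G. (\<forall>j\<in>B. T f j) \<and> (\<forall>j\<in>A - B. N f j)) \<Longrightarrow> card A \<le> d"
    and lab: "\<And>j f f' i. j \<in> J \<Longrightarrow> f \<in> G \<Longrightarrow> f' \<in> G \<Longrightarrow> lab j f = lab j f' \<Longrightarrow>
      i \<in> J - {j} \<Longrightarrow> T f i = T f' i \<and> N f i = N f' i"
  shows "(\<Sum>j\<in>J. \<Sum>c\<in>lab j ` G.
            min (card {f\<in>G. lab j f = c \<and> T f j}) (card {f\<in>G. lab j f = c \<and> N f j})) \<le> d * card G"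
proof -
  define supp where "supp f = {j \<in> J. T f j \<or> N f j}" for f
  define pat where "pat f = {j \<in> J. T f j}" for f
  define w where "w S v = card {f \<in> G. supp f = S \<and> pat f = v}" for S v
  \<comment> \<open>The label of the other positions does not tell whether \<open>j\<close> is
    decided. Inserting \<open>j\<close> into the support hides this; in the class
    \<open>(S, v)\<close>, the functions decided at \<open>j\<close> have support \<open>S\<close>
    and pattern \<open>v\<close> or \<open>insert j v\<close>.\<close>
  define lab' where "lab' j f = (insert j (supp f), pat f - {j})" for j f
  have per_j: "(\<Sum>c\<in>lab j ` G. min (card {f\<in>G. lab j f = c \<and> T f j}) (card {f\<in>G. lab j f = c \<and> N f j}))
      \<le> (\<Sum>S\<in>Pow J. \<Sum>v\<in>Pow S. if j \<in> S - v then min (w S v) (w S (insert j v)) else 0)"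
    if j: "j \<in> J" for j
  proof -
    have "(\<Sum>c\<in>lab j ` G. min (card {f\<in>G. lab j f = c \<and> T f j}) (card {f\<in>G. lab j f = c \<and> N f j}))
      \<le> (\<Sum>c\<in>lab' j ` G. min (card {f\<in>G. lab' j f = c \<and> T f j}) (card {f\<in>G. lab' j f = c \<and> N f j}))"
    proof (rule sum_min_card_refine[OF G])
      fix f f' assume "f \<in> G" "f' \<in> G" "lab j f = lab j f'"
      with lab[OF j this] show "lab' j f = lab' j f'"
        unfolding lab'_def supp_def pat_def by blast
    qed
    also have "\<dots> \<le> (\<Sum>(S, v)\<in>lab' j ` G. if j \<in> S - v then min (w S v) (w S (insert j v)) else 0)"
    proof (rule sum_mono)
      fix p assume "p \<in> lab' j ` G"
      moreover obtain S v where p: "p = (S, v)" by force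
      ultimately have Sv: "j \<in> S" "j \<notin> v" by (auto simp: lab'_def)
      have "{f\<in>G. lab' j f = (S, v) \<and> T f j} \<subseteq> {f \<in> G. supp f = S \<and> pat f = insert j v}"
        using j by (auto simp: lab'_def supp_def pat_def)
      moreover have "{f\<in>G. lab' j f = (S, v) \<and> N f j} \<subseteq> {f \<in> G. supp f = S \<and> pat f = v}"
        using j disj by (auto simp: lab'_def supp_def pat_def)
      ultimately have "card {f\<in>G. lab' j f = (S, v) \<and> T f j} \<le> w S (insert j v)"
          "card {f\<in>G. lab' j f = (S, v) \<and> N f j} \<le> w S v"
        unfolding w_def using G by (auto intro!: card_mono)
      then show "min (card {f\<in>G. lab' j f = p \<and> T f j}) (card {f\<in>G. lab' j f = p \<and> N f j})
          \<le> (case p of (S, v) \<Rightarrow> if j \<in> S - v then min (w S v) (w S (insert j v)) else 0)"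
        using Sv unfolding p by (simp add: min.coboundedI1 min.coboundedI2)
    qed
    also have "\<dots> \<le> (\<Sum>(S, v)\<in>(SIGMA S:Pow J. Pow S).
        if j \<in> S - v then min (w S v) (w S (insert j v)) else 0)"
    proof (rule sum_mono2)
      show "finite (SIGMA S:Pow J. Pow S)"
        using J by (intro finite_SigmaI) (auto intro: finite_subset)
      show "lab' j ` G \<subseteq> (SIGMA S:Pow J. Pow S)"
        using j by (auto simp: lab'_def supp_def pat_def)
    qed auto
    also have "\<dots> = (\<Sum>S\<in>Pow J. \<Sum>v\<in>Pow S. if j \<in> S - v then min (w S v) (w S (insert j v)) else 0)"
      using J by (subst sum.Sigma) (auto intro: finite_subset)
    finally show ?thesis .
  qed
  have "(\<Sum>j\<in>J. \<Sum>c\<in>lab j ` G.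
            min (card {f\<in>G. lab j f = c \<and> T f j}) (card {f\<in>G. lab j f = c \<and> N f j}))
     \<le> (\<Sum>j\<in>J. \<Sum>S\<in>Pow J. \<Sum>v\<in>Pow S. if j \<in> S - v then min (w S v) (w S (insert j v)) else 0)"
    by (intro sum_mono per_j)
  also have "\<dots> = (\<Sum>S\<in>Pow J. \<Sum>j\<in>J. \<Sum>v\<in>Pow S. if j \<in> S - v then min (w S v) (w S (insert j v)) else 0)"
    by (rule sum.swap)
  also have "\<dots> = (\<Sum>S\<in>Pow J. \<Sum>v\<in>Pow S. \<Sum>j\<in>J. if j \<in> S - v then min (w S v) (w S (insert j v)) else 0)"
    by (intro sum.cong[OF refl]) (rule sum.swap)
  also have "\<dots> = (\<Sum>S\<in>Pow J. \<Sum>v\<in>Pow S. \<Sum>j\<in>S - v. min (w S v) (w S (insert j v)))"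
  proof (rule sum.cong[OF refl], rule sum.cong[OF refl])
    fix S v assume "S \<in> Pow J" "v \<in> Pow S"
    then have "J \<inter> (S - v) = S - v" by auto
    then show "(\<Sum>j\<in>J. if j \<in> S - v then min (w S v) (w S (insert j v)) else 0)
        = (\<Sum>j\<in>S - v. min (w S v) (w S (insert j v)))"
      using J sum.inter_restrict[of J "\<lambda>j. min (w S v) (w S (insert j v))" "S - v"] by simp
  qed
  also have "\<dots> \<le> (\<Sum>S\<in>Pow J. d * (\<Sum>v\<in>Pow S. w S v))"
  proof (intro sum_mono one_inclusion_weight)
    fix S assume S: "S \<in> Pow J"
    then show "finite S" using J by (auto intro: finite_subset)
    fix A assume A: "A \<subseteq> S" "\<forall>B\<subseteq>A. \<exists>v\<subseteq>S. 0 < w S v \<and> v \<inter> A = B"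
    show "card A \<le> d"
    proof (rule vc)
      show "A \<subseteq> J" using A S by auto
      show "\<forall>B\<subseteq>A. \<exists>f\<in>G. (\<forall>j\<in>B. T f j) \<and> (\<forall>j\<in>A - B. N f j)"
      proof (intro allI impI)
        fix B assume "B \<subseteq> A"
        then obtain v where v: "0 < w S v" "v \<inter> A = B" using A by blast
        then have "{f \<in> G. supp f = S \<and> pat f = v} \<noteq> {}"
          unfolding w_def by (metis card.empty less_irrefl)
        then obtain f where f: "f \<in> G" "supp f = S" "pat f = v" by blast
        then show "\<exists>f\<in>G. (\<forall>j\<in>B. T f j) \<and> (\<forall>j\<in>A - B. N f j)"
          using v A S unfolding supp_def pat_def by (intro bexI[of _ f]) auto
      qed
    qed
  qed
  also have "\<dots> = d * card G"
  proof -
    have "(\<Sum>S\<in>Pow J. \<Sum>v\<in>Pow S. w S v)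
        = (\<Sum>(S, v)\<in>(SIGMA S:Pow J. Pow S). card {f \<in> G. (supp f, pat f) = (S, v)})"
      using J by (subst sum.Sigma) (auto simp: w_def case_prod_unfold intro: finite_subset)
    also have "\<dots> = (\<Sum>p\<in>(SIGMA S:Pow J. Pow S). card {f \<in> G. (supp f, pat f) = p})"
      by (rule sum.cong) auto
    also have "\<dots> = card G"
      using J G
      by (intro sum_card_fibres finite_SigmaI) (auto simp: supp_def pat_def intro: finite_subset)
    finally show ?thesis by (simp add: sum_distrib_left[symmetric])
  qed
  finally show ?thesis .
qed

lemma sum_PiE_insert:
  fixes \<phi> :: "('j \<Rightarrow> 'i) \<Rightarrow> 'c::comm_monoid_add"
  assumes "j \<notin> J"
  shows "(\<Sum>t\<in>PiE (insert j J) (\<lambda>_. I). \<phi> t) = (\<Sum>t\<in>PiE J (\<lambda>_. I). \<Sum>i\<in>I. \<phi> (t(j := i)))"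
proof -
  have "(\<Sum>t\<in>PiE (insert j J) (\<lambda>_. I). \<phi> t) = (\<Sum>(i, t)\<in>I \<times> PiE J (\<lambda>_. I). \<phi> (t(j := i)))"
    unfolding PiE_insert_eq using inj_combinator[OF assms, of "\<lambda>_. I"]
    by (subst sum.reindex) (auto simp: case_prod_unfold)
  also have "\<dots> = (\<Sum>i\<in>I. \<Sum>t\<in>PiE J (\<lambda>_. I). \<phi> (t(j := i)))"
    by (simp add: sum.cartesian_product)
  also have "\<dots> = (\<Sum>t\<in>PiE J (\<lambda>_. I). \<Sum>i\<in>I. \<phi> (t(j := i)))"
    by (rule sum.swap)
  finally show ?thesis .
qed

text \<open>
  Real-valued functions enter the combinatorial part through their roundings to multiples of a
  small step, so that a threshold is a natural number and \<open>g\<close> is the margin in units of the step.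
\<close>

definition margin_shatters :: "nat \<Rightarrow> ('i \<Rightarrow> nat) \<Rightarrow> 'i set \<Rightarrow> ('i \<Rightarrow> nat) set \<Rightarrow> bool" where
  "margin_shatters g s A G \<longleftrightarrow>
     (\<forall>B\<subseteq>A. \<exists>f\<in>G. (\<forall>i\<in>B. s i + g \<le> f i) \<and> (\<forall>i\<in>A - B. f i + g < s i))"

text \<open>After \<open>g\<close> is taken off on each side of a threshold,
  \<open>2 * g + 1\<close> leaves on average at least one threshold per index that separates the two
  functions with margin.\<close>

definition margin_separated :: "nat \<Rightarrow> 'i set \<Rightarrow> ('i \<Rightarrow> nat) set \<Rightarrow> bool" where
  "margin_separated g I G \<longleftrightarrow>
     (\<forall>f\<in>G. \<forall>f'\<in>G. f \<noteq> f' \<longrightarrow> (2 * g + 1) * card I \<le> (\<Sum>i\<in>I. nat \<bar>int (f i) - int (f' i)\<bar>))"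

text \<open>Beyond the first \<open>2 * g\<close> units, every unit of distance is a threshold with
  margin on both sides: if \<open>u\<close> is the larger value, these thresholds fill
  \<open>{u' + g<..u - g}\<close>.\<close>

lemma abs_diff_le_thresholds:
  fixes u u' b g :: nat
  assumes "u \<le> b" "u' \<le> b"
  shows "nat \<bar>int u - int u'\<bar>
    \<le> 2 * g + card {k\<in>{..b}. k + g \<le> u \<and> u' + g < k} + card {k\<in>{..b}. k + g \<le> u' \<and> u + g < k}"
proof -
  have *: "card {k\<in>{..b}. k + g \<le> u \<and> u' + g < k} = u - u' - 2 * g" if "u \<le> b" for u u'
  proof -
    have "{k\<in>{..b}. k + g \<le> u \<and> u' + g < k} = {u' + g<..u - g}" using that by auto
    then show ?thesis by simp
  qed
  show ?thesis unfolding *[OF assms(1)] *[OF assms(2)] by linarith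
qed

text \<open>Double counting: at fixed \<open>i\<close> and \<open>k\<close>, the pairs separated in
  one orientation lie in the product of an upper and a lower part of \<open>c\<close>. The factor 2
  accounts for the two orientations.\<close>

lemma sum_threshold_pairs:
  fixes D :: "(('i \<Rightarrow> nat) \<times> ('i \<Rightarrow> nat)) set"
  assumes fin: "finite I" "finite c" and D: "D \<subseteq> c \<times> c"
  shows "(\<Sum>p\<in>D. \<Sum>i\<in>I. card {k\<in>{..b}. k + g \<le> fst p i \<and> snd p i + g < k}
        + card {k\<in>{..b}. k + g \<le> snd p i \<and> fst p i + g < k})
    \<le> 2 * (\<Sum>i\<in>I. \<Sum>k\<le>b. card {f\<in>c. k + g \<le> f i} * card {f\<in>c. f i + g < k})"
proof -
  have finD: "finite D" using fin D by (meson finite_SigmaI finite_subset)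
  have cnt: "(\<Sum>p\<in>D. \<Sum>i\<in>I. card {k\<in>{..b}. P p i k})
      \<le> (\<Sum>i\<in>I. \<Sum>k\<le>b. card {f\<in>c. k + g \<le> f i} * card {f\<in>c. f i + g < k})"
    if P: "\<And>i k. card {p\<in>D. P p i k} \<le> card {f\<in>c. k + g \<le> f i} * card {f\<in>c. f i + g < k}" for P
  proof -
    have "(\<Sum>p\<in>D. \<Sum>i\<in>I. card {k\<in>{..b}. P p i k}) = (\<Sum>i\<in>I. \<Sum>p\<in>D. card {k\<in>{..b}. P p i k})"
      by (rule sum.swap)
    also have "\<dots> = (\<Sum>i\<in>I. \<Sum>k\<le>b. card {p\<in>D. P p i k})"
      by (intro sum.cong refl sum_multicount_gen[symmetric, THEN sym] ballI) (auto simp: finD)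
    also have "\<dots> \<le> (\<Sum>i\<in>I. \<Sum>k\<le>b. card {f\<in>c. k + g \<le> f i} * card {f\<in>c. f i + g < k})"
      by (intro sum_mono P)
    finally show ?thesis .
  qed
  have le: "card {p\<in>D. Q (fst p) \<and> R (snd p)} \<le> card {f\<in>c. Q f} * card {f\<in>c. R f}" for Q R
    unfolding card_cartesian_product[symmetric]
    by (rule card_mono) (use fin D in auto)
  have le': "card {p\<in>D. Q (snd p) \<and> R (fst p)} \<le> card {f\<in>c. Q f} * card {f\<in>c. R f}" for Q R
    using le[of R Q] by (simp add: conj_commute mult.commute)
  have "(\<Sum>p\<in>D. \<Sum>i\<in>I. card {k\<in>{..b}. k + g \<le> fst p i \<and> snd p i + g < k})
      + (\<Sum>p\<in>D. \<Sum>i\<in>I. card {k\<in>{..b}. k + g \<le> snd p i \<and> fst p i + g < k})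
    \<le> (\<Sum>i\<in>I. \<Sum>k\<le>b. card {f\<in>c. k + g \<le> f i} * card {f\<in>c. f i + g < k})
      + (\<Sum>i\<in>I. \<Sum>k\<le>b. card {f\<in>c. k + g \<le> f i} * card {f\<in>c. f i + g < k})"
    by (intro add_mono cnt le le')
  then show ?thesis by (simp add: sum.distrib)
qed

text \<open>Each of the \<open>card c * (card c - 1)\<close> ordered pairs of distinct functions is
  separated at no fewer than \<open>card I\<close> combinations of index and threshold. So the
  products of upper and lower parts are large in total; bounding the larger factor by
  \<open>card c\<close> and cancelling leaves the minima. Read as a prediction problem, this bounds
  the errors of majority votes on a class from below.\<close>

lemma class_spread:
  fixes G :: "('i \<Rightarrow> nat) set"
  assumes fin: "finite I" "finite c" and c: "c \<subseteq> G"
    and bd: "\<And>f i. f \<in> G \<Longrightarrow> i \<in> I \<Longrightarrow> f i \<le> b"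
    and sep: "margin_separated g I G"
  shows "(card c - 1) * card I
    \<le> 2 * (\<Sum>i\<in>I. \<Sum>k\<le>b. min (card {f\<in>c. k + g \<le> f i}) (card {f\<in>c. f i + g < k}))"
proof (cases "c = {}")
  case False
  define D where "D = {p\<in>c \<times> c. fst p \<noteq> snd p}"
  define hi where "hi i k = card {f\<in>c. k + g \<le> f i}" for i k
  define lo where "lo i k = card {f\<in>c. f i + g < k}" for i k
  have finD: "finite D" using fin by (auto simp: D_def)
  have "c \<times> c - D = (\<lambda>f. (f, f)) ` c" by (auto simp: D_def)
  then have "card (c \<times> c - D) = card c"
    by (simp add: card_image inj_on_def)
  moreover have "D \<subseteq> c \<times> c" by (auto simp: D_def)
  ultimately have "card D + card c = card c * card c"
    using fin card_mono[of "c \<times> c" D] by (simp add: card_Diff_subset finD card_cartesian_product)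
  then have cardD: "card D = card c * (card c - 1)"
    by (simp add: algebra_simps diff_mult_distrib2)
  have "of_nat (card D) * ((2 * g + 1) * card I) \<le> (\<Sum>p\<in>D. \<Sum>i\<in>I. nat \<bar>int (fst p i) - int (snd p i)\<bar>)"
  proof (rule sum_bounded_below)
    fix p assume "p \<in> D"
    then have "fst p \<in> G" "snd p \<in> G" "fst p \<noteq> snd p" using c by (auto simp: D_def)
    then show "(2 * g + 1) * card I \<le> (\<Sum>i\<in>I. nat \<bar>int (fst p i) - int (snd p i)\<bar>)"
      using sep unfolding margin_separated_def by metis
  qed
  also have "\<dots> \<le> (\<Sum>p\<in>D. \<Sum>i\<in>I. 2 * g + card {k\<in>{..b}. k + g \<le> fst p i \<and> snd p i + g < k}
        + card {k\<in>{..b}. k + g \<le> snd p i \<and> fst p i + g < k})"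
    using c bd by (intro sum_mono abs_diff_le_thresholds) (auto simp: D_def)
  also have "\<dots> \<le> 2 * g * card I * card D
      + 2 * (\<Sum>i\<in>I. \<Sum>k\<le>b. hi i k * lo i k)"
  proof -
    have "(\<Sum>p\<in>D. \<Sum>i\<in>I. card {k\<in>{..b}. k + g \<le> fst p i \<and> snd p i + g < k}
        + card {k\<in>{..b}. k + g \<le> snd p i \<and> fst p i + g < k})
      \<le> 2 * (\<Sum>i\<in>I. \<Sum>k\<le>b. hi i k * lo i k)"
      unfolding hi_def lo_def by (rule sum_threshold_pairs) (use fin in \<open>auto simp: D_def\<close>)
    then show ?thesis by (simp add: sum.distrib)
  qed
  finally have "card I * card D \<le> 2 * (\<Sum>i\<in>I. \<Sum>k\<le>b. hi i k * lo i k)"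
    by (simp add: algebra_simps)
  also have "\<dots> \<le> 2 * (\<Sum>i\<in>I. \<Sum>k\<le>b. card c * min (hi i k) (lo i k))"
  proof (intro mult_left_mono sum_mono)
    fix i k
    have "hi i k \<le> card c" "lo i k \<le> card c"
      unfolding hi_def lo_def using fin by (auto intro!: card_mono)
    then show "hi i k * lo i k \<le> card c * min (hi i k) (lo i k)"
      by (cases "hi i k \<le> lo i k") (auto simp: min_def mult.commute intro!: mult_right_mono)
  qed auto
  finally have "card c * ((card c - 1) * card I)
      \<le> card c * (2 * (\<Sum>i\<in>I. \<Sum>k\<le>b. min (hi i k) (lo i k)))"
    unfolding cardD by (simp add: sum_distrib_left mult_ac)
  moreover have "card c > 0" using False fin by (simp add: card_gt_0_iff)
  ultimately show ?thesis unfolding hi_def lo_def by (simp only: nat_mult_le_cancel_disj)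
qed simp

text \<open>For every tuple \<open>t\<close> of \<open>n + 1\<close> indices,
  \<open>leave_one_out\<close> bounds the vote errors from above at each of the \<open>b + 1\<close>
  thresholds. Once all entries of \<open>t\<close> but one are fixed, \<open>class_spread\<close>
  bounds them from below, where at most \<open>(b + 1) ^ n\<close> classes lose one function each.
  Summing over all tuples makes the two counts comparable.\<close>

lemma packing_constant_threshold:
  fixes G :: "('i \<Rightarrow> nat) set"
  assumes I: "finite I" "I \<noteq> {}" and G: "finite G"
    and bd: "\<forall>f\<in>G. \<forall>i\<in>I. f i \<le> b"
    and sep: "margin_separated g I G"
    and vc: "\<And>A k. A \<subseteq> I \<Longrightarrow> margin_shatters g (\<lambda>_. k) A G \<Longrightarrow> card A \<le> d"
  shows "Suc n * (card G - (b + 1) ^ n) \<le> 2 * (b + 1) * d * card G"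
proof -
  define lab where "lab t j f = restrict (f \<circ> t) ({..n} - {j})" for t :: "nat \<Rightarrow> 'i" and j :: nat and f :: "'i \<Rightarrow> nat"
  define \<Psi> where "\<Psi> t j k = (\<Sum>c\<in>lab t j ` G.
            min (card {f\<in>G. lab t j f = c \<and> k + g \<le> f (t j)})
                (card {f\<in>G. lab t j f = c \<and> f (t j) + g < k}))" for t :: "nat \<Rightarrow> 'i" and j k
  have upper: "(\<Sum>j\<le>n. \<Psi> t j k) \<le> d * card G" if t: "t \<in> PiE {..n} (\<lambda>_. I)" for t k
    unfolding \<Psi>_def
  proof (rule leave_one_out)
    fix A assume A: "A \<subseteq> {..n}"
      and sh: "\<forall>B\<subseteq>A. \<exists>f\<in>G. (\<forall>j\<in>B. k + g \<le> f (t j)) \<and> (\<forall>j\<in>A - B. f (t j) + g < k)"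
    \<comment> \<open>A tuple may repeat an index, but a repeated index cannot be shattered: one
      function would have to lie both above and below \<open>k\<close> there.\<close>
    have inj: "inj_on t A"
    proof (rule inj_onI, rule ccontr)
      fix x y assume xy: "x \<in> A" "y \<in> A" "t x = t y" "x \<noteq> y"
      with sh[rule_format, of "{x}"] obtain f where "k + g \<le> f (t x)" "\<forall>j\<in>A - {x}. f (t j) + g < k"
        by auto
      with xy show False by force
    qed
    have "card (t ` A) \<le> d"
    proof (rule vc)
      show "t ` A \<subseteq> I" using A t by auto
      show "margin_shatters g (\<lambda>_. k) (t ` A) G"
        unfolding margin_shatters_def
      proof (intro allI impI)
        fix B assume B: "B \<subseteq> t ` A"
        obtain f where "f \<in> G" "\<forall>j\<in>{j\<in>A. t j \<in> B}. k + g \<le> f (t j)"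
            "\<forall>j\<in>A - {j\<in>A. t j \<in> B}. f (t j) + g < k"
          using sh[rule_format, of "{j\<in>A. t j \<in> B}"] by auto
        then show "\<exists>f\<in>G. (\<forall>i\<in>B. k + g \<le> f i) \<and> (\<forall>i\<in>t ` A - B. f i + g < k)"
          using B by (intro bexI[of _ f]) auto
      qed
    qed
    then show "card A \<le> d" using inj by (simp add: card_image)
  next
    fix j f f' i assume "lab t j f = lab t j f'" "i \<in> {..n} - {j}"
    then have "f (t i) = f' (t i)"
      unfolding lab_def by (metis comp_apply restrict_apply')
    then show "(k + g \<le> f (t i)) = (k + g \<le> f' (t i)) \<and> (f (t i) + g < k) = (f' (t i) + g < k)"
      by simp
  qed (use G in auto)
  have lower: "(card G - (b + 1) ^ n) * card I \<le> 2 * (\<Sum>i\<in>I. \<Sum>k\<le>b. \<Psi> (t(j := i)) j k)"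
    if t: "t \<in> PiE ({..n} - {j}) (\<lambda>_. I)" and j: "j \<le> n" for t j
  proof -
    \<comment> \<open>The label at \<open>j\<close> ignores \<open>t j\<close>, so this entry can
      range over \<open>I\<close> while the classes stay fixed.\<close>
    have labj: "lab (t(j := i)) j = lab t j" for i
      unfolding lab_def by (auto simp: restrict_def fun_eq_iff)
    define cl where "cl c = {f\<in>G. lab t j f = c}" for c
    have "card (lab t j ` G) \<le> card (PiE ({..n} - {j}) (\<lambda>_. {..b}))"
      using t bd by (intro card_mono finite_PiE image_subsetI) (auto simp: lab_def PiE_iff)
    also have "\<dots> = (b + 1) ^ n" using j by (simp add: card_PiE)
    finally have "card G - (b + 1) ^ n \<le> card G - card (lab t j ` G)" by simp
    also have "\<dots> = (\<Sum>c\<in>lab t j ` G. card (cl c)) - (\<Sum>c\<in>lab t j ` G. 1)"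
      unfolding cl_def using sum_card_fibres[OF G, of "lab t j ` G" "lab t j"] G by simp
    also have "\<dots> = (\<Sum>c\<in>lab t j ` G. card (cl c) - 1)"
      using G by (intro sum_subtractf_nat[symmetric]) (auto simp: cl_def Suc_le_eq card_gt_0_iff)
    finally have "(card G - (b + 1) ^ n) * card I \<le> (\<Sum>c\<in>lab t j ` G. (card (cl c) - 1) * card I)"
      by (simp add: sum_distrib_right[symmetric])
    also have "\<dots> \<le> (\<Sum>c\<in>lab t j ` G. 2 * (\<Sum>i\<in>I. \<Sum>k\<le>b.
        min (card {f\<in>cl c. k + g \<le> f i}) (card {f\<in>cl c. f i + g < k})))"
      using I G sep bd by (intro sum_mono class_spread[of I _ G]) (auto simp: cl_def)
    also have "\<dots> = 2 * (\<Sum>i\<in>I. \<Sum>k\<le>b. \<Psi> (t(j := i)) j k)"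
    proof -
      have "(\<Sum>c\<in>lab t j ` G. \<Sum>i\<in>I. \<Sum>k\<le>b. \<phi> c i k) = (\<Sum>i\<in>I. \<Sum>k\<le>b. \<Sum>c\<in>lab t j ` G. \<phi> c i k)"
        for \<phi> :: "(nat \<Rightarrow> nat) \<Rightarrow> 'i \<Rightarrow> nat \<Rightarrow> nat"
      proof -
        have "(\<Sum>c\<in>lab t j ` G. \<Sum>i\<in>I. \<Sum>k\<le>b. \<phi> c i k) = (\<Sum>i\<in>I. \<Sum>c\<in>lab t j ` G. \<Sum>k\<le>b. \<phi> c i k)"
          by (rule sum.swap)
        also have "\<dots> = (\<Sum>i\<in>I. \<Sum>k\<le>b. \<Sum>c\<in>lab t j ` G. \<phi> c i k)"
          by (intro sum.cong[OF refl]) (rule sum.swap)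
        finally show ?thesis .
      qed
      then show ?thesis
        unfolding \<Psi>_def labj cl_def by (simp add: sum_distrib_left[symmetric] conj_assoc)
    qed
    finally show ?thesis .
  qed
  have "Suc n * (card G - (b + 1) ^ n) * card I ^ Suc n
      = (\<Sum>j\<le>n. \<Sum>t\<in>PiE ({..n} - {j}) (\<lambda>_. I). (card G - (b + 1) ^ n) * card I)"
    by (simp add: card_PiE algebra_simps)
  also have "\<dots> \<le> (\<Sum>j\<le>n. \<Sum>t\<in>PiE ({..n} - {j}) (\<lambda>_. I). 2 * (\<Sum>i\<in>I. \<Sum>k\<le>b. \<Psi> (t(j := i)) j k))"
    by (intro sum_mono lower) auto
  also have "\<dots> = 2 * (\<Sum>j\<le>n. \<Sum>t\<in>PiE {..n} (\<lambda>_. I). \<Sum>k\<le>b. \<Psi> t j k)"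
  proof -
    have "(\<Sum>t\<in>PiE {..n} (\<lambda>_. I). \<Sum>k\<le>b. \<Psi> t j k)
        = (\<Sum>t\<in>PiE ({..n} - {j}) (\<lambda>_. I). \<Sum>i\<in>I. \<Sum>k\<le>b. \<Psi> (t(j := i)) j k)" if "j \<in> {..n}" for j
      using sum_PiE_insert[of j "{..n} - {j}"] that by (simp add: insert_absorb)
    then show ?thesis by (simp add: sum_distrib_left)
  qed
  also have "\<dots> = 2 * (\<Sum>t\<in>PiE {..n} (\<lambda>_. I). \<Sum>k\<le>b. \<Sum>j\<le>n. \<Psi> t j k)"
  proof -
    have "(\<Sum>j\<le>n. \<Sum>t\<in>PiE {..n} (\<lambda>_. I). \<Sum>k\<le>b. \<Psi> t j k)
      = (\<Sum>t\<in>PiE {..n} (\<lambda>_. I). \<Sum>j\<le>n. \<Sum>k\<le>b. \<Psi> t j k)" by (rule sum.swap)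
    also have "\<dots> = (\<Sum>t\<in>PiE {..n} (\<lambda>_. I). \<Sum>k\<le>b. \<Sum>j\<le>n. \<Psi> t j k)"
      by (intro sum.cong[OF refl]) (rule sum.swap)
    finally show ?thesis by simp
  qed
  also have "\<dots> \<le> 2 * (\<Sum>t\<in>PiE {..n} (\<lambda>_. I). \<Sum>k\<le>b. d * card G)"
    by (intro mult_left_mono sum_mono upper) auto
  also have "\<dots> = 2 * (b + 1) * d * card G * card I ^ Suc n"
    by (simp add: card_PiE algebra_simps)
  finally show ?thesis
    using I by (simp only: mult_le_cancel2) (simp add: card_gt_0_iff)
qed

section \<open>Shattered threshold maps\<close>

text \<open>A partial map holds a shattered set together with its thresholds, so different
  thresholds on one set count separately. The empty map belongs to the set exactly if
  \<open>F\<close> is nonempty, which starts the induction in the lower bound.\<close>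

definition shattered_maps :: "nat \<Rightarrow> nat \<Rightarrow> 'i set \<Rightarrow> ('i \<Rightarrow> nat) set \<Rightarrow> ('i \<rightharpoonup> nat) set" where
  "shattered_maps g b I F =
     {s. dom s \<subseteq> I \<and> ran s \<subseteq> {..b} \<and> margin_shatters g (\<lambda>i. the (s i)) (dom s) F}"

text \<open>Encoding partial maps by a product set gives finiteness and lets a sum over maps factor
  into a product over \<open>I\<close>.\<close>

lemma bounded_maps_eq:
  "{s. dom s \<subseteq> I \<and> ran s \<subseteq> {..b}}
    = (\<lambda>p i. if i \<in> I then p i else None) ` PiE I (\<lambda>_. insert None (Some ` {..b::nat}))"
    (is "?L = ?h ` ?R")
proof
  show "?L \<subseteq> ?h ` ?R"
  proof
    fix s assume s: "s \<in> ?L"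
    have "s = ?h (restrict s I)" using s by (auto simp: fun_eq_iff dom_def)
    moreover have "restrict s I \<in> ?R"
    proof (rule restrict_PiE_iff[THEN iffD2], intro ballI)
      fix i assume "i \<in> I"
      show "s i \<in> insert None (Some ` {..b})"
        using s by (cases "s i") (auto simp: ran_def)
    qed
    ultimately show "s \<in> ?h ` ?R" by blast
  qed
  show "?h ` ?R \<subseteq> ?L"
  proof (intro image_subsetI)
    fix p assume p: "p \<in> ?R"
    have "y \<le> b" if "?h p i = Some y" for i y
    proof -
      have "i \<in> I" "p i = Some y" using that by (auto split: if_splits)
      then show ?thesis using PiE_mem[OF p, of i] by auto
    qed
    then have "ran (?h p) \<subseteq> {..b}" unfolding ran_def by blast
    moreover have "dom (?h p) \<subseteq> I" by (auto split: if_splits)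
    ultimately show "?h p \<in> ?L" by blast
  qed
qed

lemma finite_shattered_maps:
  assumes "finite I"
  shows "finite (shattered_maps g b I F)"
proof (rule finite_subset)
  show "shattered_maps g b I F \<subseteq> {s. dom s \<subseteq> I \<and> ran s \<subseteq> {..b}}"
    by (auto simp: shattered_maps_def)
  show "finite {s. dom s \<subseteq> I \<and> ran s \<subseteq> {..b}}"
    unfolding bounded_maps_eq using assms by (intro finite_imageI finite_PiE) auto
qed

text \<open>A generating function bound in the manner of the Sauer-Shelah lemma: with weights
  \<open>x ^ card (dom s)\<close> all bounded maps together weigh at most
  \<open>(1 + (b + 1) * x) ^ card I\<close>, while every shattered map weighs at least
  \<open>x ^ d\<close>.\<close>

lemma card_shattered_maps_le:
  assumes I: "finite I" and d: "0 < d" "d \<le> card I * (b + 1)"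
    and fat: "\<And>s. s \<in> shattered_maps g b I F \<Longrightarrow> card (dom s) \<le> d"
  shows "real (card (shattered_maps g b I F)) \<le> (exp 1 * (card I * (b + 1)) / d) ^ d"
proof -
  \<comment> \<open>This value turns the exponent \<open>card I * ((b + 1) * x)\<close> into
    \<open>d\<close>.\<close>
  define x where "x = real d / (card I * (b + 1))"
  have pos: "0 < real (card I * (b + 1))" using d by linarith
  have x: "0 < x" "x \<le> 1"
    unfolding x_def using d pos by (auto simp: divide_le_eq simp flip: of_nat_mult)
  let ?R = "PiE I (\<lambda>_. insert None (Some ` {..b}))"
  let ?h = "\<lambda>p i. if i \<in> I then p i else None"
  have fin: "finite ?R" using I by (intro finite_PiE) auto
  have "card (shattered_maps g b I F) * x ^ d = (\<Sum>s\<in>shattered_maps g b I F. x ^ d)"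
    by simp
  also have "\<dots> \<le> (\<Sum>s\<in>shattered_maps g b I F. x ^ card (dom s))"
    using x fat by (intro sum_mono power_decreasing) auto
  also have "\<dots> \<le> (\<Sum>s\<in>?h ` ?R. x ^ card (dom s))"
  proof (rule sum_mono2)
    show "shattered_maps g b I F \<subseteq> ?h ` ?R"
      unfolding bounded_maps_eq[symmetric] by (auto simp: shattered_maps_def)
  qed (use fin x in auto)
  also have "\<dots> \<le> (\<Sum>p\<in>?R. x ^ card (dom (?h p)))"
    using sum_image_le[OF fin, of "\<lambda>s. x ^ card (dom s)" ?h] x by (simp add: comp_def)
  also have "\<dots> = (\<Sum>p\<in>?R. \<Prod>i\<in>I. if p i = None then 1 else x)"
  proof (rule sum.cong)
    fix p assume "p \<in> ?R"
    have "dom (?h p) = {i\<in>I. p i \<noteq> None}" by (auto simp: dom_def split: if_splits)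
    then show "x ^ card (dom (?h p)) = (\<Prod>i\<in>I. if p i = None then 1 else x)"
      using I by (simp add: prod.If_cases Int_def Collect_conj_eq[symmetric])
  qed auto
  also have "\<dots> = (\<Prod>i\<in>I. \<Sum>q\<in>insert None (Some ` {..b}). if q = None then 1 else x)"
    using I by (intro prod_sum_PiE[symmetric]) auto
  also have "\<dots> = (1 + (b + 1) * x) ^ card I"
    by (simp add: sum.reindex)
  also have "\<dots> \<le> exp ((b + 1) * x) ^ card I"
    using x by (intro power_mono exp_ge_add_one_self) auto
  also have "\<dots> = exp (card I * ((b + 1) * x))"
    by (rule exp_of_nat_mult[symmetric])
  also have "card I * ((b + 1) * x) = d"
    unfolding x_def using pos by (simp add: field_simps)
  finally have "card (shattered_maps g b I F) * x ^ d \<le> exp 1 ^ d"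
    by (simp add: exp_of_nat_mult[symmetric])
  then have "card (shattered_maps g b I F) \<le> (exp 1 / x) ^ d"
    using x by (simp add: power_divide le_divide_eq)
  then show ?thesis unfolding x_def using d pos by simp
qed

lemma shattered_maps_mono:
  assumes "F \<subseteq> F'"
  shows "shattered_maps g b I F \<subseteq> shattered_maps g b I F'"
proof -
  have "margin_shatters g s A F'" if "margin_shatters g s A F" for s A
    unfolding margin_shatters_def
  proof (intro allI impI)
    fix B assume "B \<subseteq> A"
    from that[unfolded margin_shatters_def, rule_format, OF this] assms
    show "\<exists>f\<in>F'. (\<forall>i\<in>B. s i + g \<le> f i) \<and> (\<forall>i\<in>A - B. f i + g < s i)" by auto
  qed
  then show ?thesis unfolding shattered_maps_def by auto
qed

text \<open>
  A map shattered by both halves cannot be defined at \<open>i\<close>, and extending it by \<open>i \<mapsto> k\<close> gives a map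
  shattered by \<open>F\<close> but by neither half.
\<close>

lemma card_shattered_maps_split:
  assumes I: "finite I" and ik: "i \<in> I" "k \<le> b"
  shows "card (shattered_maps g b I {f\<in>F. k + g \<le> f i})
       + card (shattered_maps g b I {f\<in>F. f i + g < k}) \<le> card (shattered_maps g b I F)"
proof -
  define H where "H = shattered_maps g b I {f\<in>F. k + g \<le> f i}"
  define L where "L = shattered_maps g b I {f\<in>F. f i + g < k}"
  have notin: "i \<notin> dom s" if s: "s \<in> H \<inter> L" for s
  proof
    assume "i \<in> dom s"
    then obtain l where l: "s i = Some l" "{} \<subseteq> dom s" "{i} \<subseteq> dom s" by auto
    from s have sh: "margin_shatters g (\<lambda>i. the (s i)) (dom s) {f\<in>F. k + g \<le> f i}"
        "margin_shatters g (\<lambda>i. the (s i)) (dom s) {f\<in>F. f i + g < k}"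
      by (auto simp: H_def L_def shattered_maps_def)
    \<comment> \<open>The upper half forces the threshold \<open>l\<close> at \<open>i\<close> above
      \<open>k + 2 * g\<close>, while the lower half forces \<open>l + 2 * g\<close> below
      \<open>k\<close>.\<close>
    have "\<exists>f\<in>{f\<in>F. k + g \<le> f i}. f i + g < l"
      using sh(1)[unfolded margin_shatters_def, rule_format, OF l(2)] l(1,3) by force
    moreover have "\<exists>f\<in>{f\<in>F. f i + g < k}. l + g \<le> f i"
      using sh(2)[unfolded margin_shatters_def, rule_format, OF l(3)] l(1) by force
    ultimately show False by auto
  qed
  have ext: "s(i \<mapsto> k) \<in> shattered_maps g b I F" if s: "s \<in> H \<inter> L" for s
  proof -
    have i: "i \<notin> dom s" by (rule notin[OF s])
    have sh: "margin_shatters g (\<lambda>i. the (s i)) (dom s) {f\<in>F. k + g \<le> f i}"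
        "margin_shatters g (\<lambda>i. the (s i)) (dom s) {f\<in>F. f i + g < k}"
      and s': "dom s \<subseteq> I" "ran s \<subseteq> {..b}"
      using s by (auto simp: H_def L_def shattered_maps_def)
    have "margin_shatters g (\<lambda>j. the ((s(i \<mapsto> k)) j)) (insert i (dom s)) F"
      unfolding margin_shatters_def
    proof (intro allI impI)
      fix B assume B: "B \<subseteq> insert i (dom s)"
      then have B': "B - {i} \<subseteq> dom s" by auto
      show "\<exists>f\<in>F. (\<forall>j\<in>B. the ((s(i \<mapsto> k)) j) + g \<le> f j)
          \<and> (\<forall>j\<in>insert i (dom s) - B. f j + g < the ((s(i \<mapsto> k)) j))"
      proof (cases "i \<in> B")
        case True
        obtain f where "f \<in> F" "k + g \<le> f i" "\<forall>j\<in>B - {i}. the (s j) + g \<le> f j"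
            "\<forall>j\<in>dom s - (B - {i}). f j + g < the (s j)"
          using sh(1)[unfolded margin_shatters_def, rule_format, OF B'] by auto
        then show ?thesis using True i by (intro bexI[of _ f]) auto
      next
        case False
        obtain f where "f \<in> F" "f i + g < k" "\<forall>j\<in>B - {i}. the (s j) + g \<le> f j"
            "\<forall>j\<in>dom s - (B - {i}). f j + g < the (s j)"
          using sh(2)[unfolded margin_shatters_def, rule_format, OF B'] by auto
        then show ?thesis using False i by (intro bexI[of _ f]) auto
      qed
    qed
    then show ?thesis
      using s' ik i by (auto simp: shattered_maps_def)
  qed
  have fin: "finite H" "finite L" "finite (shattered_maps g b I F)"
    unfolding H_def L_def using I by (auto intro: finite_shattered_maps)
  have inj: "inj_on (\<lambda>s. s(i \<mapsto> k)) (H \<inter> L)"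
  proof (rule inj_onI)
    fix s s' assume s: "s \<in> H \<inter> L" "s' \<in> H \<inter> L" and eq: "s(i \<mapsto> k) = s'(i \<mapsto> k)"
    have "s i = None" "s' i = None" using notin s by (meson domIff)+
    with eq show "s = s'" by (metis fun_upd_triv fun_upd_upd)
  qed
  have disj: "(\<lambda>s. s(i \<mapsto> k)) ` (H \<inter> L) \<inter> (H \<union> L) = {}"
  proof -
    have False if s: "s(i \<mapsto> k) \<in> H" for s
    proof -
      have "margin_shatters g (\<lambda>j. the ((s(i \<mapsto> k)) j)) (dom (s(i \<mapsto> k))) {f\<in>F. k + g \<le> f i}"
        using s unfolding H_def shattered_maps_def by blast
      from this[unfolded margin_shatters_def, rule_format, of "{}"] show False by auto
    qed
    moreover have False if s: "s(i \<mapsto> k) \<in> L" for s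
    proof -
      have "margin_shatters g (\<lambda>j. the ((s(i \<mapsto> k)) j)) (dom (s(i \<mapsto> k))) {f\<in>F. f i + g < k}"
        using s unfolding L_def shattered_maps_def by blast
      from this[unfolded margin_shatters_def, rule_format, of "{i}"] show False by auto
    qed
    ultimately show ?thesis by blast
  qed
  have "card H + card L = card (H \<union> L) + card ((\<lambda>s. s(i \<mapsto> k)) ` (H \<inter> L))"
    using card_Un_Int[OF fin(1,2)] by (simp only: card_image[OF inj])
  also have "\<dots> = card ((H \<union> L) \<union> (\<lambda>s. s(i \<mapsto> k)) ` (H \<inter> L))"
    using fin disj by (intro card_Un_disjoint[symmetric]) auto
  also have "\<dots> \<le> card (shattered_maps g b I F)"
  proof (rule card_mono[OF fin(3)])
    have "H \<subseteq> shattered_maps g b I F" "L \<subseteq> shattered_maps g b I F"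
      unfolding H_def L_def by (auto intro!: shattered_maps_mono)
    with ext show "(H \<union> L) \<union> (\<lambda>s. s(i \<mapsto> k)) ` (H \<inter> L) \<subseteq> shattered_maps g b I F" by auto
  qed
  finally show ?thesis unfolding H_def L_def .
qed

text \<open>Averaging over indices and thresholds. The pairs of distinct functions make up at least
  half of \<open>card F * card F\<close>, each is separated at a share \<open>1 / K\<close> of the
  indices, and the two orientations and \<open>b + 1\<close> thresholds share the total. So some
  product of an upper and a lower part is at least \<open>card F * card F\<close> over
  \<open>4 * K * (b + 1)\<close>; as each part is at most \<open>card F\<close>, both are
  large.\<close>

lemma separating_threshold:
  fixes F :: "('i \<Rightarrow> nat) set"
  assumes fin: "finite I" "I \<noteq> {}" "finite F" "2 \<le> card F"
    and bd: "\<And>f i. f \<in> F \<Longrightarrow> i \<in> I \<Longrightarrow> f i \<le> b"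
    and sep: "\<And>f f'. f \<in> F \<Longrightarrow> f' \<in> F \<Longrightarrow> f \<noteq> f' \<Longrightarrow>
      card I \<le> K * card {i\<in>I. 2 * g + 1 \<le> nat \<bar>int (f i) - int (f' i)\<bar>}"
  obtains i k where "i \<in> I" "k \<le> b"
    "card F \<le> 4 * K * (b + 1) * card {f\<in>F. k + g \<le> f i}"
    "card F \<le> 4 * K * (b + 1) * card {f\<in>F. f i + g < k}"
proof -
  define D where "D = {p\<in>F \<times> F. fst p \<noteq> snd p}"
  define hi where "hi i k = card {f\<in>F. k + g \<le> f i}" for i k
  define lo where "lo i k = card {f\<in>F. f i + g < k}" for i k
  have finD: "finite D" "D \<subseteq> F \<times> F" using fin by (auto simp: D_def)
  have "F \<times> F - D = (\<lambda>f. (f, f)) ` F" by (auto simp: D_def)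
  then have "card (F \<times> F - D) = card F"
    by (simp add: card_image inj_on_def)
  then have "card D + card F = card F * card F"
    using fin finD card_mono[of "F \<times> F" D] by (simp add: card_Diff_subset card_cartesian_product)
  moreover have "2 * card F \<le> card F * card F" using fin by (intro mult_right_mono) auto
  ultimately have cardD: "card F * card F \<le> 2 * card D" "0 < card D" using fin by linarith+
  have "card D * card I = (\<Sum>p\<in>D. card I)" by simp
  also have "\<dots> \<le> (\<Sum>p\<in>D. K * (\<Sum>i\<in>I. card {k\<in>{..b}. k + g \<le> fst p i \<and> snd p i + g < k}
        + card {k\<in>{..b}. k + g \<le> snd p i \<and> fst p i + g < k}))"
  proof (rule sum_mono)
    fix p assume p: "p \<in> D"
    then have pF: "fst p \<in> F" "snd p \<in> F" "fst p \<noteq> snd p" by (auto simp: D_def)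
    have "card {i\<in>I. 2 * g + 1 \<le> nat \<bar>int (fst p i) - int (snd p i)\<bar>}
      = (\<Sum>i\<in>I. if 2 * g + 1 \<le> nat \<bar>int (fst p i) - int (snd p i)\<bar> then 1 else 0)"
      using fin by (simp add: sum.If_cases Int_def)
    also have "\<dots> \<le> (\<Sum>i\<in>I. card {k\<in>{..b}. k + g \<le> fst p i \<and> snd p i + g < k}
        + card {k\<in>{..b}. k + g \<le> snd p i \<and> fst p i + g < k})"
    proof (rule sum_mono)
      fix i assume i: "i \<in> I"
      show "(if 2 * g + 1 \<le> nat \<bar>int (fst p i) - int (snd p i)\<bar> then 1 else 0)
        \<le> card {k\<in>{..b}. k + g \<le> fst p i \<and> snd p i + g < k}
          + card {k\<in>{..b}. k + g \<le> snd p i \<and> fst p i + g < k}"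
        using abs_diff_le_thresholds[OF bd bd, OF pF(1) i pF(2) i, of g] by (auto split: if_split)
    qed
    finally show "card I \<le> K * (\<Sum>i\<in>I. card {k\<in>{..b}. k + g \<le> fst p i \<and> snd p i + g < k}
        + card {k\<in>{..b}. k + g \<le> snd p i \<and> fst p i + g < k})"
      using sep[OF pF] by (meson le_trans mult_le_mono2)
  qed
  also have "\<dots> \<le> K * (2 * (\<Sum>i\<in>I. \<Sum>k\<le>b. hi i k * lo i k))"
    unfolding sum_distrib_left[symmetric] hi_def lo_def
    by (intro mult_left_mono sum_threshold_pairs fin finD) auto
  finally have main: "card D * card I \<le> 2 * K * (\<Sum>i\<in>I. \<Sum>k\<le>b. hi i k * lo i k)"
    by (simp add: mult_ac)
  have "\<exists>i\<in>I. \<exists>k\<le>b. card D \<le> 2 * K * (b + 1) * (hi i k * lo i k)"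
  proof (rule ccontr)
    assume "\<not> ?thesis"
    then have neg: "2 * K * (b + 1) * (hi i k * lo i k) < card D" if "i \<in> I" "k \<le> b" for i k
      using that by force
    have "(b + 1) * (card D * card I) \<le> (b + 1) * (2 * K * (\<Sum>i\<in>I. \<Sum>k\<le>b. hi i k * lo i k))"
      using main by (rule mult_le_mono2)
    also have "\<dots> = (\<Sum>i\<in>I. \<Sum>k\<le>b. 2 * K * (b + 1) * (hi i k * lo i k))"
      by (simp add: sum_distrib_left algebra_simps)
    also have "\<dots> < (\<Sum>i\<in>I. \<Sum>k\<le>b. card D)"
      using fin neg by (intro sum_strict_mono) auto
    also have "\<dots> = (b + 1) * (card D * card I)" by (simp add: algebra_simps)
    finally show False by simp
  qed
  then obtain i k where ik: "i \<in> I" "k \<le> b" "card D \<le> 2 * K * (b + 1) * (hi i k * lo i k)" by blast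
  have sq: "card F * card F \<le> 4 * K * (b + 1) * (hi i k * lo i k)"
  proof -
    have "card F * card F \<le> 2 * (2 * K * (b + 1) * (hi i k * lo i k))"
      using cardD(1) mult_le_mono2[OF ik(3), of 2] by (rule le_trans)
    also have "\<dots> = 4 * K * (b + 1) * (hi i k * lo i k)" by simp
    finally show ?thesis .
  qed
  have le: "hi i k \<le> card F" "lo i k \<le> card F"
    unfolding hi_def lo_def using fin by (auto intro!: card_mono)
  have cancel: "x \<le> M * h" if "x * x \<le> M * (h * l)" "l \<le> x" "0 < x" for x M h l :: nat
  proof -
    have "x * x \<le> (M * h) * x"
      using that(1) mult_le_mono2[OF that(2), of "M * h"] by (simp only: mult.assoc)
    with that(3) show ?thesis by simp
  qed
  have F0: "0 < card F" using fin by linarith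
  show ?thesis
  proof (rule that[OF ik(1,2)])
    show "card F \<le> 4 * K * (b + 1) * card {f\<in>F. k + g \<le> f i}"
      using cancel[OF sq le(2) F0] unfolding hi_def .
    show "card F \<le> 4 * K * (b + 1) * card {f\<in>F. f i + g < k}"
      using cancel[OF sq[unfolded mult.commute[of "hi i k"]] le(1) F0] unfolding lo_def .
  qed
qed

text \<open>Splitting at a separating threshold leaves a share of at least 1 over
  \<open>4 * K * (b + 1)\<close> of the functions in each half, and the halves inherit the
  separation. By \<open>card_shattered_maps_split\<close> the counts of the halves add up, so each
  level doubles the guaranteed count.\<close>

lemma card_shattered_maps_ge:
  fixes F :: "('i \<Rightarrow> nat) set"
  assumes fin: "finite I" "I \<noteq> {}" and K: "0 < K"
    and F: "finite F" "(4 * K * (b + 1)) ^ t \<le> card F"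
    and bd: "\<And>f i. f \<in> F \<Longrightarrow> i \<in> I \<Longrightarrow> f i \<le> b"
    and sep: "\<And>f f'. f \<in> F \<Longrightarrow> f' \<in> F \<Longrightarrow> f \<noteq> f' \<Longrightarrow>
      card I \<le> K * card {i\<in>I. 2 * g + 1 \<le> nat \<bar>int (f i) - int (f' i)\<bar>}"
  shows "2 ^ t \<le> card (shattered_maps g b I F)"
  using F bd sep
proof (induction t arbitrary: F)
  case 0
  then have "F \<noteq> {}" by auto
  then have "Map.empty \<in> shattered_maps g b I F"
    by (auto simp: shattered_maps_def margin_shatters_def)
  then show ?case
    using finite_shattered_maps[OF fin(1), of g b F] by (auto simp: Suc_le_eq card_gt_0_iff)
next
  case (Suc t)
  define R where "R = 4 * K * (b + 1)"
  have R: "4 \<le> R" unfolding R_def using K by (cases K) auto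
  then have R0: "0 < R" by simp
  have "R ^ 1 \<le> R ^ Suc t" using R by (intro power_increasing) auto
  also have "\<dots> \<le> card F" using Suc.prems(2) unfolding R_def .
  finally have "2 \<le> card F" using R by simp
  then obtain i k where ik: "i \<in> I" "k \<le> b"
      "card F \<le> R * card {f\<in>F. k + g \<le> f i}" "card F \<le> R * card {f\<in>F. f i + g < k}"
    unfolding R_def
    by (rule separating_threshold[OF fin Suc.prems(1), where b = b and K = K and g = g])
       (use Suc.prems(3,4) in auto)
  have "R * R ^ t \<le> R * card {f\<in>F. k + g \<le> f i}" "R * R ^ t \<le> R * card {f\<in>F. f i + g < k}"
    using ik(3,4) Suc.prems(2)[folded R_def, unfolded power_Suc] by (blast intro: le_trans)+
  then have "R ^ t \<le> card {f\<in>F. k + g \<le> f i}" "R ^ t \<le> card {f\<in>F. f i + g < k}"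
    by (simp_all only: nat_mult_le_cancel1[OF R0])
  note big = this[unfolded R_def]
  have IH: "2 ^ t \<le> card (shattered_maps g b I F')"
    if "F' \<subseteq> F" "(4 * K * (b + 1)) ^ t \<le> card F'" for F'
  proof (rule Suc.IH[OF _ that(2)])
    show "finite F'" using that(1) Suc.prems(1) by (rule finite_subset)
    show "f i \<le> b" if "f \<in> F'" "i \<in> I" for f i
      using \<open>F' \<subseteq> F\<close> that Suc.prems(3) by blast
    show "card I \<le> K * card {i \<in> I. 2 * g + 1 \<le> nat \<bar>int (f i) - int (f' i)\<bar>}"
      if "f \<in> F'" "f' \<in> F'" "f \<noteq> f'" for f f'
      using \<open>F' \<subseteq> F\<close> that by (intro Suc.prems(4)) auto
  qed
  have "2 ^ t \<le> card (shattered_maps g b I {f\<in>F. k + g \<le> f i})"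
    by (rule IH[OF _ big(1)]) auto
  moreover have "2 ^ t \<le> card (shattered_maps g b I {f\<in>F. f i + g < k})"
    by (rule IH[OF _ big(2)]) auto
  ultimately show ?case
    using card_shattered_maps_split[OF fin(1) ik(1,2), of g F] by simp
qed

text \<open>The probabilistic method, by counting tuples. A pair is separated at
  \<open>n / b\<close> positions or more in expectation; an exponential moment bounds the share of
  tuples with fewer than \<open>n / (4 * b)\<close> by \<open>exp (- n / (4 * b))\<close>, and
  \<open>card G\<close> squared times this is below 1 by the assumption on \<open>n\<close>.\<close>

lemma separating_subsample:
  fixes G :: "'f set" and P :: "'f \<Rightarrow> 'f \<Rightarrow> 'i \<Rightarrow> bool"
  assumes I: "finite I" "I \<noteq> {}" and G: "finite G" "G \<noteq> {}" and b: "0 < b"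
    and P: "\<And>f f'. f \<in> G \<Longrightarrow> f' \<in> G \<Longrightarrow> f \<noteq> f' \<Longrightarrow> card I \<le> b * card {i\<in>I. P f f' i}"
    and n: "8 * b * ln (card G) < real n"
  obtains t where "t \<in> PiE {..<n} (\<lambda>_. I)"
    "\<And>f f'. f \<in> G \<Longrightarrow> f' \<in> G \<Longrightarrow> f \<noteq> f' \<Longrightarrow> n \<le> 4 * b * card {j\<in>{..<n}. P f f' (t j)}"
proof -
  let ?T = "PiE {..<n} (\<lambda>_. I)"
  define bad where "bad f f' = {t\<in>?T. 4 * b * card {j\<in>{..<n}. P f f' (t j)} < n}" for f f'
  have finT: "finite ?T" using I by (intro finite_PiE) auto
  have cI: "0 < card I" using I by (simp add: card_gt_0_iff)
  have bad: "real (card (bad f f')) \<le> real (card I) ^ n * exp (- real n / (4 * b))"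
    if ff: "f \<in> G" "f' \<in> G" "f \<noteq> f'" for f f'
  proof -
    define p where "p = real (card {i\<in>I. P f f' i})"
    have p: "card I / b \<le> p" using P[OF ff] b unfolding p_def
      by (simp add: divide_le_eq mult.commute flip: of_nat_mult)
    \<comment> \<open>Through this estimate each draw contributes at most a factor
      \<open>1 - 1 / (2 * b)\<close>. The resulting moment bound \<open>exp (- n / (2 * b))\<close>
      outweighs the Markov factor \<open>exp (n / (4 * b))\<close>.\<close>
    have e: "exp (- 1) \<le> (1 / 2 :: real)"
      using exp_ge_add_one_self[of 1] by (simp add: exp_minus field_simps)
    have "card (bad f f') * exp (- real n / (4 * b)) = (\<Sum>t\<in>bad f f'. exp (- real n / (4 * b)))"
      by simp
    also have "\<dots> \<le> (\<Sum>t\<in>bad f f'. exp (- real (card {j\<in>{..<n}. P f f' (t j)})))"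
    proof (rule sum_mono)
      fix t assume "t \<in> bad f f'"
      then have "4 * b * card {j\<in>{..<n}. P f f' (t j)} < n" by (simp add: bad_def)
      then have "real (4 * b * card {j\<in>{..<n}. P f f' (t j)}) < real n" by (simp only: of_nat_less_iff)
      then have "real (card {j\<in>{..<n}. P f f' (t j)}) * (4 * real b) < n" by (simp add: mult_ac)
      then have "real (card {j\<in>{..<n}. P f f' (t j)}) \<le> n / (4 * real b)"
        using b by (subst le_divide_eq) simp
      then show "exp (- real n / (4 * b)) \<le> exp (- real (card {j\<in>{..<n}. P f f' (t j)}))"
        by simp
    qed
    also have "\<dots> \<le> (\<Sum>t\<in>?T. exp (- real (card {j\<in>{..<n}. P f f' (t j)})))"
      using finT by (intro sum_mono2) (auto simp: bad_def)
    also have "\<dots> = (\<Sum>t\<in>?T. \<Prod>j<n. if P f f' (t j) then exp (- 1) else 1)"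
      by (intro sum.cong) (simp_all add: prod.If_cases Int_def exp_of_nat_mult[symmetric])
    also have "\<dots> = (\<Sum>i\<in>I. if P f f' i then exp (- 1) else 1) ^ n"
      using I by (subst prod_sum_PiE[symmetric]) auto
    also have "\<dots> \<le> (card I * (1 - 1 / (2 * b))) ^ n"
    proof (rule power_mono)
      have "(\<Sum>i\<in>I. if P f f' i then exp (- 1) else (1::real))
          \<le> (\<Sum>i\<in>I. 1 - 1 / 2 * (if P f f' i then 1 else 0))"
        using e by (intro sum_mono) auto
      also have "\<dots> = card I - 1 / 2 * p"
        unfolding p_def sum_subtractf sum_distrib_left[symmetric]
        using I by (simp add: sum.If_cases Int_def)
      also have "\<dots> \<le> card I * (1 - 1 / (2 * b))"
        using p b by (simp add: field_simps)
      finally show "(\<Sum>i\<in>I. if P f f' i then exp (- 1) else (1::real)) \<le> card I * (1 - 1 / (2 * b))" .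
    qed (auto intro: sum_nonneg)
    also have "\<dots> \<le> (card I * exp (- (1 / (2 * b)))) ^ n"
      using exp_ge_add_one_self[of "- (1 / (2 * real b))"] b
      by (intro power_mono mult_left_mono mult_nonneg_nonneg) (auto simp: field_simps)
    also have "\<dots> = card I ^ n * exp (- real n / (2 * b))"
      by (simp add: power_mult_distrib exp_of_nat_mult[symmetric])
    also have "exp (- real n / (2 * b)) = exp (- real n / (4 * b)) * exp (- real n / (4 * b))"
      by (simp add: exp_add[symmetric] field_simps)
    finally show ?thesis by (simp add: mult.assoc[symmetric])
  qed
  define Bad where "Bad = (\<Union>(f, f')\<in>{p\<in>G \<times> G. fst p \<noteq> snd p}. bad f f')"
  have "card Bad \<le> (\<Sum>p\<in>{p\<in>G \<times> G. fst p \<noteq> snd p}. card (bad (fst p) (snd p)))"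
    unfolding Bad_def case_prod_unfold using G by (intro card_UN_le) auto
  then have "real (card Bad) \<le> (\<Sum>p\<in>{p\<in>G \<times> G. fst p \<noteq> snd p}. real (card (bad (fst p) (snd p))))"
    by (simp flip: of_nat_sum)
  also have "\<dots> \<le> (\<Sum>p\<in>{p\<in>G \<times> G. fst p \<noteq> snd p}. real (card I) ^ n * exp (- real n / (4 * b)))"
    by (intro sum_mono bad) auto
  also have "\<dots> \<le> (\<Sum>p\<in>G \<times> G. real (card I) ^ n * exp (- real n / (4 * b)))"
    using G by (intro sum_mono2) auto
  also have "\<dots> = real (card G) * real (card G) * exp (- real n / (4 * b)) * real (card I) ^ n"
    by (simp add: card_cartesian_product)
  also have "\<dots> < 1 * real (card I) ^ n"
  proof (rule mult_strict_right_mono)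
    have "0 < card G" using G by (simp add: card_gt_0_iff)
    then have "real (card G) * real (card G) * exp (- real n / (4 * b))
        = exp (2 * ln (card G) - real n / (4 * b))"
      by (simp add: exp_diff exp_minus field_simps exp_double power2_eq_square)
    also have "\<dots> < 1" using n b by (simp add: field_simps)
    finally show "real (card G) * real (card G) * exp (- real n / (4 * b)) < 1" .
  qed (use cI in simp)
  finally have "card Bad < card ?T" by (simp add: card_PiE flip: of_nat_power)
  moreover have "Bad \<subseteq> ?T" by (auto simp: Bad_def bad_def)
  ultimately obtain t where t: "t \<in> ?T" "t \<notin> Bad" by (metis less_irrefl subsetI subset_antisym)
  show ?thesis
  proof (rule that[OF t(1)])
    fix f f' assume "f \<in> G" "f' \<in> G" "f \<noteq> f'"
    with t show "n \<le> 4 * b * card {j\<in>{..<n}. P f f' (t j)}"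
      unfolding Bad_def bad_def by (force simp: not_less)
  qed
qed

section \<open>Packing numbers\<close>

text \<open>Subtracting \<open>2 * g\<close> per index leaves at least \<open>card I\<close>, which
  only indices with a larger distance can supply, at most \<open>b\<close> each. Separation in the
  mean thus becomes a share \<open>1 / b\<close> of separating indices.\<close>

lemma margin_separated_count:
  fixes G :: "('i \<Rightarrow> nat) set" and b g :: nat
  assumes I: "finite I"
    and bd: "\<forall>f\<in>G. \<forall>i\<in>I. f i \<le> b"
    and sep: "margin_separated g I G"
    and f: "f \<in> G" "f' \<in> G" "f \<noteq> f'"
  shows "card I \<le> b * card {i\<in>I. 2 * g + 1 \<le> nat \<bar>int (f i) - int (f' i)\<bar>}"
proof -
  let ?S = "{i\<in>I. 2 * g + 1 \<le> nat \<bar>int (f i) - int (f' i)\<bar>}"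
  have "(2 * g + 1) * card I \<le> (\<Sum>i\<in>I. nat \<bar>int (f i) - int (f' i)\<bar>)"
    using sep f unfolding margin_separated_def by metis
  also have "\<dots> \<le> (\<Sum>i\<in>I. 2 * g + (if i \<in> ?S then b else 0))"
  proof (rule sum_mono)
    fix i assume i: "i \<in> I"
    then have "f i \<le> b" "f' i \<le> b" using bd f by auto
    then show "nat \<bar>int (f i) - int (f' i)\<bar> \<le> 2 * g + (if i \<in> ?S then b else 0)"
      using i by auto
  qed
  also have "\<dots> = 2 * g * card I + b * card ?S"
    using I by (simp add: sum.distrib sum.If_cases Int_def conj_commute mult.commute)
  finally show ?thesis by simp
qed

lemma margin_separated_bound_pos:
  fixes G :: "('i \<Rightarrow> nat) set" and b g :: nat
  assumes I: "finite I" "I \<noteq> {}" and G: "2 \<le> card G"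
    and bd: "\<forall>f\<in>G. \<forall>i\<in>I. f i \<le> b"
    and sep: "margin_separated g I G"
  shows "0 < b"
proof (rule ccontr)
  assume "\<not> 0 < b"
  obtain f f' where "f \<in> G" "f' \<in> G" "f \<noteq> f'"
    using G by (metis card_le_Suc0_iff_eq card.infinite not_less_eq_eq numeral_2_eq_2 zero_le)
  from margin_separated_count[OF I(1) bd sep this] \<open>\<not> 0 < b\<close>
  have "card I = 0" by simp
  with I show False by simp
qed

text \<open>With \<open>Suc n\<close> at twice the coefficient \<open>2 * (b + 1) * d\<close>,
  subtracting \<open>(b + 1) ^ n\<close> must at least halve \<open>card G\<close>, so
  \<open>card G\<close> is at most \<open>2 * (b + 1) ^ n\<close>. The factor 2 is absorbed into one
  more power of \<open>b + 1\<close>.\<close>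

lemma packing_constant_threshold_ln:
  fixes G :: "('i \<Rightarrow> nat) set" and b d g :: nat
  assumes I: "finite I" "I \<noteq> {}" and G: "finite G" "2 \<le> card G"
    and bd: "\<forall>f\<in>G. \<forall>i\<in>I. f i \<le> b"
    and sep: "margin_separated g I G"
    and vc: "\<And>A k. A \<subseteq> I \<Longrightarrow> margin_shatters g (\<lambda>_. k) A G \<Longrightarrow> card A \<le> d"
    and d: "0 < d"
  shows "ln (card G) \<le> 4 * (b + 1) * d * ln (b + 1)"
proof -
  have b: "0 < b" by (rule margin_separated_bound_pos[OF I G(2) bd sep])
  define n where "n = 4 * (b + 1) * d - 1"
  have n: "Suc n = 4 * (b + 1) * d" unfolding n_def using d by (cases d) auto
  have "Suc n * (card G - (b + 1) ^ n) \<le> 2 * (b + 1) * d * card G"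
    by (rule packing_constant_threshold[OF I G(1) bd sep]) (rule vc)
  then have "(2 * (b + 1) * d) * (2 * (card G - (b + 1) ^ n)) \<le> (2 * (b + 1) * d) * card G"
    unfolding n by (simp only: mult.assoc[symmetric])
  moreover have "0 < 2 * (b + 1) * d" using d by simp
  ultimately have "2 * (card G - (b + 1) ^ n) \<le> card G" by (simp only: nat_mult_le_cancel1)
  then have "card G \<le> 2 * (b + 1) ^ n" by linarith
  also have "\<dots> \<le> (b + 1) * (b + 1) ^ n" using b by (intro mult_right_mono) auto
  also have "\<dots> = (b + 1) ^ (4 * (b + 1) * d)" by (simp only: n[symmetric] power_Suc)
  finally have "real (card G) \<le> real (b + 1) ^ (4 * (b + 1) * d)"
    by (simp only: of_nat_le_iff flip: of_nat_power)
  then have "ln (card G) \<le> ln (real (b + 1) ^ (4 * (b + 1) * d))"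
    using G by (subst ln_le_cancel_iff) auto
  also have "\<dots> = 4 * (b + 1) * d * ln (b + 1)"
    by (subst ln_realpow) auto
  finally show ?thesis .
qed

text \<open>Resolves an inequality with \<open>u\<close> on both sides: the tangent of the logarithm
  at \<open>4 * c\<close> has slope \<open>1 / (4 * c)\<close>, so the logarithmic term uses up only
  half of \<open>u\<close>.\<close>

lemma log_square_bound:
  fixes u c :: real
  assumes "0 \<le> u" "1 \<le> c" "u \<le> c * (3 + 2 * c + 2 * ln (1 + u))"
  shows "u \<le> 21 * c\<^sup>2"
proof -
  have "ln (1 + u) = ln ((1 + u) / (4 * c)) + ln (4 * c)"
    using assms by (subst ln_div) auto
  also have "\<dots> \<le> ((1 + u) / (4 * c) - 1) + (4 * c - 1)"
    using assms by (intro add_mono ln_le_minus_one) auto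
  finally have "2 * c * ln (1 + u) \<le> 2 * c * ((1 + u) / (4 * c) - 1 + (4 * c - 1))"
    using assms by (intro mult_left_mono) auto
  also have "\<dots> = (1 + u) / 2 - 4 * c + 8 * c\<^sup>2"
    using assms by (simp add: field_simps power2_eq_square)
  finally have "2 * c * ln (1 + u) \<le> (1 + u) / 2 - 4 * c + 8 * c\<^sup>2" .
  moreover have "c * (3 + 2 * c + 2 * ln (1 + u)) = 3 * c + 2 * c\<^sup>2 + 2 * c * ln (1 + u)"
    by (simp add: algebra_simps power2_eq_square)
  ultimately have "u \<le> 20 * c\<^sup>2 - 2 * c + 1"
    using assms(3) by (simp add: field_simps)
  moreover have "1 \<le> c\<^sup>2" using assms(2) by (simp add: one_le_power)
  ultimately show ?thesis using assms(2) by linarith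
qed

text \<open>On a separating subsample of size about \<open>8 * b * ln (card G)\<close> there are at
  least \<open>2 ^ q\<close> shattered maps, with \<open>q\<close> about
  \<open>ln (card G) / ln R\<close>, and at most the \<open>d\<close>-th power of a quantity linear
  in the subsample size. As this size is itself logarithmic in \<open>card G\<close>, the comparison
  is an inequality for \<open>u = ln (card G) / d\<close> that \<open>log_square_bound\<close>
  resolves.\<close>

lemma packing_free_threshold_ln:
  fixes G :: "('i \<Rightarrow> nat) set" and b d g :: nat
  assumes I: "finite I" "I \<noteq> {}" and G: "finite G" "2 \<le> card G"
    and bd: "\<forall>f\<in>G. \<forall>i\<in>I. f i \<le> b"
    and sep: "margin_separated g I G"
    and vc: "\<And>A s. A \<subseteq> I \<Longrightarrow> margin_shatters g s A G \<Longrightarrow> card A \<le> d"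
    and d: "0 < d"
  shows "ln (card G) \<le> 21 * d * (ln (16 * b * (b + 1)))\<^sup>2"
proof -
  have b: "0 < b" by (rule margin_separated_bound_pos[OF I G(2) bd sep])
  define y where "y = ln (card G)"
  define u where "u = y / d"
  \<comment> \<open>The factor lost per split in \<open>card_shattered_maps_ge\<close> for
    \<open>K = 4 * b\<close>, the share guaranteed by \<open>separating_subsample\<close>.\<close>
  define R where "R = 4 * (4 * b) * (b + 1)"
  define c where "c = ln (real R)"
  \<comment> \<open>The 1 makes \<open>n\<close> exceed \<open>8 * b * y\<close>; the
    \<open>d\<close> secures \<open>d \<le> n * (b + 1)\<close> for
    \<open>card_shattered_maps_le\<close>.\<close>
  define n where "n = nat \<lfloor>8 * b * y\<rfloor> + 1 + d"
  have y: "0 \<le> y" unfolding y_def using G by simp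
  have u: "0 \<le> u" unfolding u_def using y by simp
  have R32: "32 \<le> R" unfolding R_def using b by (cases b) auto
  have c1: "1 \<le> c"
  proof -
    have "exp 1 \<le> real R" using exp_le R32 by linarith
    then have "ln (exp 1) \<le> ln (real R)" using R32 by (subst ln_le_cancel_iff) auto
    then show ?thesis unfolding c_def by simp
  qed
  have n: "8 * b * y < n" "real n \<le> 8 * b * y + 1 + d"
    unfolding n_def using y by (auto simp: floor_le_iff) linarith+
  have G0: "G \<noteq> {}" using G by auto
  obtain t where t: "t \<in> PiE {..<n} (\<lambda>_. I)"
    and tsep: "\<And>f f'. f \<in> G \<Longrightarrow> f' \<in> G \<Longrightarrow> f \<noteq> f' \<Longrightarrow>
       n \<le> 4 * b * card {j\<in>{..<n}. 2 * g + 1 \<le> nat \<bar>int (f (t j)) - int (f' (t j))\<bar>}"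
    by (rule separating_subsample[OF I G(1) G0 b, of "\<lambda>f f' i. 2 * g + 1 \<le> nat \<bar>int (f i) - int (f' i)\<bar>" n])
       (use margin_separated_count[OF I(1) bd sep] n(1) y_def in auto)
  define F where "F = (\<lambda>f j. f (t j)) ` G"
  have n0: "0 < n" unfolding n_def by simp
  have "inj_on (\<lambda>f j. f (t j)) G"
  proof (rule inj_onI, rule ccontr)
    fix f f' assume f: "f \<in> G" "f' \<in> G" "(\<lambda>j. f (t j)) = (\<lambda>j. f' (t j))" "f \<noteq> f'"
    then have "f (t j) = f' (t j)" for j by metis
    with tsep[OF f(1,2,4)] n0 show False by simp
  qed
  then have cardF: "card F = card G" unfolding F_def by (rule card_image)
  define q where "q = nat \<lfloor>y / c\<rfloor>"
  have q: "y / c - 1 < q" "real q \<le> y / c"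
    unfolding q_def using y c1 by auto
  have "real q * c \<le> y" using q(2) c1 by (simp add: le_divide_eq)
  then have "exp (real q * c) \<le> exp y" by simp
  then have "real R ^ q \<le> real (card G)"
    using R32 G unfolding c_def y_def by (simp add: exp_of_nat_mult)
  then have Rq: "R ^ q \<le> card F"
    unfolding cardF by (simp only: of_nat_le_iff flip: of_nat_power)
  have "2 ^ q \<le> card (shattered_maps g b {..<n} F)"
  proof (rule card_shattered_maps_ge[of _ "4 * b"])
    show "(4 * (4 * b) * (b + 1)) ^ q \<le> card F" using Rq unfolding R_def .
    show "finite F" unfolding F_def using G by simp
    show "f i \<le> b" if "f \<in> F" "i \<in> {..<n}" for f i
      using that t bd unfolding F_def by auto
    show "card {..<n} \<le> 4 * b * card {i \<in> {..<n}. 2 * g + 1 \<le> nat \<bar>int (f i) - int (f' i)\<bar>}"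
      if ff: "f \<in> F" "f' \<in> F" "f \<noteq> f'" for f f'
    proof -
      obtain h h' where "h \<in> G" "h' \<in> G" "f = (\<lambda>j. h (t j))" "f' = (\<lambda>j. h' (t j))"
        using ff(1,2) unfolding F_def by blast
      with tsep[of h h'] ff(3) show ?thesis by auto
    qed
  qed (use n0 b in auto)
  then have "2 ^ q \<le> real (card (shattered_maps g b {..<n} F))"
    by (metis of_nat_le_iff of_nat_numeral of_nat_power)
  also have "\<dots> \<le> (exp 1 * (card {..<n} * (b + 1)) / d) ^ d"
  proof (rule card_shattered_maps_le)
    show "d \<le> card {..<n} * (b + 1)" unfolding n_def by simp
    fix s assume "s \<in> shattered_maps g b {..<n} F"
    then have s: "dom s \<subseteq> {..<n}" "margin_shatters g (\<lambda>i. the (s i)) (dom s) F"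
      by (auto simp: shattered_maps_def)
    have sh: "\<exists>f\<in>G. (\<forall>j\<in>B. the (s j) + g \<le> f (t j)) \<and> (\<forall>j\<in>dom s - B. f (t j) + g < the (s j))"
      if "B \<subseteq> dom s" for B
      using s(2)[unfolded margin_shatters_def, rule_format, OF that] unfolding F_def by auto
    \<comment> \<open>If \<open>t j = t j'\<close>, a function above at \<open>j\<close> and below
      at \<open>j'\<close> puts the threshold of \<open>j\<close> strictly below that of
      \<open>j'\<close>, and the roles can be exchanged.\<close>
    have inj: "inj_on t (dom s)"
    proof (rule inj_onI, rule ccontr)
      fix j j' assume j: "j \<in> dom s" "j' \<in> dom s" "t j = t j'" "j \<noteq> j'"
      obtain f where "the (s j) + g \<le> f (t j)" "f (t j') + g < the (s j')"
        using sh[of "{j}"] j by blast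
      moreover obtain f' where "the (s j') + g \<le> f' (t j')" "f' (t j) + g < the (s j)"
        using sh[of "{j'}"] j by blast
      ultimately show False using j(3) by simp
    qed
    have "card (t ` dom s) \<le> d"
    proof (rule vc)
      show "t ` dom s \<subseteq> I" using s(1) t by auto
      show "margin_shatters g (\<lambda>i. the (s (inv_into (dom s) t i))) (t ` dom s) G"
        unfolding margin_shatters_def
      proof (intro allI impI)
        fix B assume B: "B \<subseteq> t ` dom s"
        obtain f where f: "f \<in> G" "\<forall>j\<in>{j\<in>dom s. t j \<in> B}. the (s j) + g \<le> f (t j)"
            "\<forall>j\<in>dom s - {j\<in>dom s. t j \<in> B}. f (t j) + g < the (s j)"
          using sh[of "{j\<in>dom s. t j \<in> B}"] by auto
        show "\<exists>f\<in>G. (\<forall>i\<in>B. the (s (inv_into (dom s) t i)) + g \<le> f i)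
            \<and> (\<forall>i\<in>t ` dom s - B. f i + g < the (s (inv_into (dom s) t i)))"
        proof (intro bexI[OF _ f(1)] conjI ballI)
          fix i assume i: "i \<in> B"
          then obtain j where "j \<in> dom s" "i = t j" using B by blast
          then show "the (s (inv_into (dom s) t i)) + g \<le> f i"
            using i f(2) by (simp add: inv_into_f_f[OF inj])
        next
          fix i assume i: "i \<in> t ` dom s - B"
          then obtain j where "j \<in> dom s" "i = t j" by auto
          then show "f i + g < the (s (inv_into (dom s) t i))"
            using i f(3) by (simp add: inv_into_f_f[OF inj])
        qed
      qed
    qed
    then show "card (dom s) \<le> d" by (simp add: card_image[OF inj])
  qed (use d in auto)
  finally have main: "2 ^ q \<le> (exp 1 * (n * (b + 1) / d)) ^ d" by simp
  define z where "z = real n * (real b + 1) / real d"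
  have pos: "0 < z" unfolding z_def using n0 d by simp
  have "z \<le> R * (1 + u)"
  proof -
    have "n / d \<le> 8 * b * u + 2"
      using n(2) d unfolding u_def by (simp add: field_simps)
    also have "\<dots> \<le> 16 * b * (1 + u)"
    proof -
      have "1 \<le> real b" "0 \<le> b * u" using b u by auto
      then show ?thesis by (simp add: algebra_simps)
    qed
    finally have "(b + 1) * (n / d) \<le> (b + 1) * (16 * b * (1 + u))"
      by (intro mult_left_mono) auto
    moreover have "R * (1 + u) = (b + 1) * (16 * b * (1 + u))"
      unfolding R_def by (simp add: algebra_simps)
    moreover have "z = (b + 1) * (n / d)" unfolding z_def by (simp add: algebra_simps)
    ultimately show ?thesis by (simp only:)
  qed
  moreover have "0 < R * (1 + u)" using R32 u by simp
  ultimately have "ln z \<le> ln (R * (1 + u))"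
    using ln_le_cancel_iff[OF pos] by blast
  also have "\<dots> = c + ln (1 + u)"
    unfolding c_def using R32 u by (subst ln_mult) auto
  finally have lnz: "ln z \<le> c + ln (1 + u)" .
  have z2: "2 ^ q \<le> (exp 1 * z) ^ d" using main unfolding z_def by (simp add: algebra_simps)
  have "q * ln 2 = ln (2 ^ q)" by (simp add: ln_realpow)
  also have "\<dots> \<le> ln ((exp 1 * z) ^ d)"
    using z2 pos by (subst ln_le_cancel_iff) auto
  also have "\<dots> = d * ln (exp 1 * z)"
    using pos by (subst ln_realpow) auto
  also have "ln (exp 1 * z) = 1 + ln z"
    using pos by (subst ln_mult) auto
  also have "d * (1 + ln z) \<le> d * (1 + (c + ln (1 + u)))"
    using lnz by (intro mult_left_mono) auto
  finally have qle: "q * ln 2 \<le> d * (1 + (c + ln (1 + u)))" .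
  have "q * (1 / 2) \<le> q * ln 2"
    using ln2_ge_two_thirds by (intro mult_left_mono) auto
  with qle have "q \<le> 2 * (d * (1 + (c + ln (1 + u))))" by linarith
  then have "y / c \<le> 1 + 2 * (d * (1 + (c + ln (1 + u))))" using q(1) by linarith
  also have "\<dots> \<le> d * (3 + 2 * c + 2 * ln (1 + u))"
    using d by (simp add: algebra_simps)
  finally have "y \<le> d * (c * (3 + 2 * c + 2 * ln (1 + u)))"
    using c1 by (simp add: divide_le_eq mult_ac)
  then have "u \<le> c * (3 + 2 * c + 2 * ln (1 + u))"
    unfolding u_def using d by (simp add: divide_le_eq mult_ac)
  from log_square_bound[OF u c1 this] have "u \<le> 21 * c\<^sup>2" .
  then show ?thesis
    unfolding u_def y_def c_def R_def using d by (simp add: divide_le_eq mult_ac)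
qed

section \<open>Deviation inequalities\<close>

lemma indep_vars_PiM_same:
  assumes P: "prob_space P" and I: "finite I" "I \<noteq> {}"
  shows "prob_space.indep_vars (PiM I (\<lambda>_. P)) (\<lambda>_. P) (\<lambda>i \<omega>. \<omega> i) I"
proof -
  interpret prob_space "PiM I (\<lambda>_. P)" using P by (intro prob_space_PiM)
  have "distr (PiM I (\<lambda>_. P)) (PiM I (\<lambda>_. P)) (\<lambda>x. \<lambda>i\<in>I. x i)
      = distr (PiM I (\<lambda>_. P)) (PiM I (\<lambda>_. P)) (\<lambda>x. x)"
    by (rule distr_cong) (auto simp: space_PiM)
  also have "\<dots> = PiM I (\<lambda>_. P)" by (simp add: distr_id2)
  also have "\<dots> = PiM I (\<lambda>i. distr (PiM I (\<lambda>_. P)) P (\<lambda>\<omega>. \<omega> i))"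
    using P by (intro PiM_cong refl distr_PiM_component[of I "\<lambda>_. P", symmetric])
  finally show ?thesis
    using I by (subst indep_vars_iff_distr_eq_PiM') (auto intro: measurable_component_singleton)
qed

lemma PiM_Hoeffding:
  fixes l :: "'z \<Rightarrow> real" and s :: real
  assumes P: "prob_space P" and I: "finite I" "I \<noteq> {}"
    and l[measurable]: "l \<in> borel_measurable P" and bd: "\<And>z. z \<in> space P \<Longrightarrow> l z \<in> {0..1}"
    and s: "0 \<le> s"
  shows "measure (PiM I (\<lambda>_. P)) {w\<in>space (PiM I (\<lambda>_. P)).
      card I * integral\<^sup>L P l + card I * s \<le> (\<Sum>i\<in>I. l (w i))} \<le> exp (- (2 * card I * s\<^sup>2))" (is ?A)
    and "measure (PiM I (\<lambda>_. P)) {w\<in>space (PiM I (\<lambda>_. P)).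
      (\<Sum>i\<in>I. l (w i)) \<le> card I * integral\<^sup>L P l - card I * s} \<le> exp (- (2 * card I * s\<^sup>2))" (is ?B)
proof -
  let ?M = "PiM I (\<lambda>_. P)"
  interpret prob_space ?M using P by (intro prob_space_PiM)
  have exp: "(\<integral>w. l (w i) \<partial>?M) = integral\<^sup>L P l" if "i \<in> I" for i
  proof -
    have "(\<integral>w. l (w i) \<partial>?M) = integral\<^sup>L (distr ?M P (\<lambda>w. w i)) l"
      using that by (subst integral_distr) (auto intro: measurable_component_singleton)
    also have "distr ?M P (\<lambda>w. w i) = P"
      using that P by (intro distr_PiM_component[of I "\<lambda>_. P"])
    finally show ?thesis .
  qed
  interpret H: Hoeffding_ineq ?M I "\<lambda>i w. l (w i)" "\<lambda>_. 0" "\<lambda>_. 1" "card I * integral\<^sup>L P l"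
  proof unfold_locales
    show "finite I" by fact
    show "indep_vars (\<lambda>_. borel) (\<lambda>i w. l (w i)) I"
      by (rule indep_vars_compose2[OF indep_vars_PiM_same[OF P I]]) simp
    show "AE w in ?M. l (w i) \<in> {0..1}" if "i \<in> I" for i
      using that bd by (intro AE_I2) (auto simp: space_PiM PiE_iff)
    show "card I * integral\<^sup>L P l \<equiv> \<Sum>i\<in>I. expectation (\<lambda>w. l (w i))"
      by (rule eq_reflection) (simp add: exp)
  qed
  have c: "0 < real (card I)" using I by (simp add: card_gt_0_iff)
  have e: "2 * (card I * s)\<^sup>2 / card I = 2 * card I * s\<^sup>2"
    using c by (simp add: power2_eq_square field_simps)
  show ?A using H.Hoeffding_ineq_ge[of "card I * s"] s c by (simp add: e)
  show ?B using H.Hoeffding_ineq_le[of "card I * s"] s c by (simp add: e)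
qed

section \<open>Random signs and swaps of a double sample\<close>

lemma exp_add_exp_minus_le:
  fixes x :: real
  assumes "\<bar>x\<bar> \<le> 1"
  shows "exp x + exp (- x) \<le> 2 * exp (x\<^sup>2)"
proof -
  have *: "exp x + exp (- x) \<le> 2 * exp (x\<^sup>2)" if "0 \<le> x" "x \<le> 1" for x :: real
  proof -
    have "exp (- x) \<le> 1 / (1 + x)"
      using exp_ge_add_one_self[of x] that by (simp add: exp_minus field_simps)
    also have "\<dots> \<le> 1 - x + x\<^sup>2"
    proof -
      have "(1 - x + x\<^sup>2) * (1 + x) = 1 + x ^ 3" by (simp add: algebra_simps power2_eq_square power3_eq_cube)
      moreover have "0 \<le> x ^ 3" using that by simp
      ultimately show ?thesis using that by (simp add: divide_le_eq)
    qed
    finally have "exp x + exp (- x) \<le> 2 * (1 + x\<^sup>2)" using exp_bound[of x] that by simp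
    also have "\<dots> \<le> 2 * exp (x\<^sup>2)" by (intro mult_left_mono exp_ge_add_one_self) simp
    finally show ?thesis .
  qed
  show ?thesis using *[of "\<bar>x\<bar>"] assms by (cases "0 \<le> x") (auto simp: add.commute)
qed

lemma sum_Pow_prod:
  fixes f h :: "'j \<Rightarrow> real"
  assumes "finite J"
  shows "(\<Sum>\<sigma>\<in>Pow J. \<Prod>i\<in>J. if i \<in> \<sigma> then f i else h i) = (\<Prod>i\<in>J. f i + h i)"
  using assms
proof (induction J rule: finite_induct)
  case (insert x J)
  have inj: "inj_on (insert x) (Pow J)" using insert.hyps(2) by (auto simp: inj_on_def)
  have disj: "Pow J \<inter> insert x ` Pow J = {}" using insert.hyps(2) by auto
  have 1: "(\<Prod>i\<in>J. if i \<in> insert x \<sigma> then f i else h i) = (\<Prod>i\<in>J. if i \<in> \<sigma> then f i else h i)" for \<sigma>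
    using insert.hyps(2) by (intro prod.cong) auto
  have 2: "(\<Prod>i\<in>insert x J. if i \<in> \<sigma> then f i else h i) = h x * (\<Prod>i\<in>J. if i \<in> \<sigma> then f i else h i)"
    if "\<sigma> \<in> Pow J" for \<sigma>
    using that insert.hyps by (subst prod.insert) auto
  have 3: "(\<Prod>i\<in>insert x J. if i \<in> insert x \<sigma> then f i else h i)
      = f x * (\<Prod>i\<in>J. if i \<in> \<sigma> then f i else h i)" for \<sigma>
    by (subst prod.insert[OF insert.hyps]) (simp add: 1[unfolded insert_iff])
  have "(\<Sum>\<sigma>\<in>Pow (insert x J). \<Prod>i\<in>insert x J. if i \<in> \<sigma> then f i else h i)
    = (\<Sum>\<sigma>\<in>Pow J. \<Prod>i\<in>insert x J. if i \<in> \<sigma> then f i else h i)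
      + (\<Sum>\<sigma>\<in>Pow J. \<Prod>i\<in>insert x J. if i \<in> insert x \<sigma> then f i else h i)"
    unfolding Pow_insert using insert.hyps disj
    by (subst sum.union_disjoint) (auto simp: sum.reindex[OF inj])
  also have "\<dots> = (\<Sum>\<sigma>\<in>Pow J. h x * (\<Prod>i\<in>J. if i \<in> \<sigma> then f i else h i))
      + (\<Sum>\<sigma>\<in>Pow J. f x * (\<Prod>i\<in>J. if i \<in> \<sigma> then f i else h i))"
    unfolding 3 by (simp only: 2 cong: sum.cong)
  finally have "(\<Sum>\<sigma>\<in>Pow (insert x J). \<Prod>i\<in>insert x J. if i \<in> \<sigma> then f i else h i)
    = (\<Sum>\<sigma>\<in>Pow J. h x * (\<Prod>i\<in>J. if i \<in> \<sigma> then f i else h i))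
      + (\<Sum>\<sigma>\<in>Pow J. f x * (\<Prod>i\<in>J. if i \<in> \<sigma> then f i else h i))" .
  then show ?case
    using insert by (simp add: sum_distrib_left[symmetric] algebra_simps)
qed simp

text \<open>Hoeffding's inequality for random signs, as a count of sign patterns. With parameter
  \<open>r / 2\<close>, the exponential moment costs \<open>card J * r\<^sup>2 / 4\<close> in the
  exponent, against a gain of \<open>card J * r\<^sup>2 / 2\<close> from the deviation.\<close>

lemma card_sign_deviation:
  fixes a :: "'j \<Rightarrow> real" and r :: real
  assumes J: "finite J" and a: "\<And>i. i \<in> J \<Longrightarrow> \<bar>a i\<bar> \<le> 1" and r: "0 \<le> r" "r \<le> 1"
  shows "real (card {\<sigma>\<in>Pow J. card J * r \<le> (\<Sum>i\<in>J. if i \<in> \<sigma> then - a i else a i)})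
    \<le> 2 ^ card J * exp (- (card J * r\<^sup>2 / 4))"
proof -
  let ?S = "\<lambda>\<sigma>. \<Sum>i\<in>J. if i \<in> \<sigma> then - a i else a i"
  let ?D = "{\<sigma>\<in>Pow J. card J * r \<le> ?S \<sigma>}"
  have ra: "\<bar>r / 2 * a i\<bar> \<le> 1" if "i \<in> J" for i
    using mult_mono[of "r / 2" 1 "\<bar>a i\<bar>" 1] a[OF that] r by (simp add: abs_mult)
  have sq: "(r / 2 * a i)\<^sup>2 \<le> r\<^sup>2 / 4" if "i \<in> J" for i
  proof -
    have "(a i)\<^sup>2 \<le> 1" using a[OF that] by (simp add: abs_square_le_1)
    then have "r\<^sup>2 / 4 * (a i)\<^sup>2 \<le> r\<^sup>2 / 4 * 1" by (intro mult_left_mono) auto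
    then show ?thesis by (simp add: power_mult_distrib power_divide)
  qed
  have "card ?D * exp (card J * r\<^sup>2 / 2) = (\<Sum>\<sigma>\<in>?D. exp (card J * r\<^sup>2 / 2))" by simp
  also have "\<dots> \<le> (\<Sum>\<sigma>\<in>?D. exp (r / 2 * ?S \<sigma>))"
  proof (rule sum_mono)
    fix \<sigma> assume "\<sigma> \<in> ?D"
    then have "r / 2 * (card J * r) \<le> r / 2 * ?S \<sigma>" using r by (intro mult_left_mono) auto
    then show "exp (card J * r\<^sup>2 / 2) \<le> exp (r / 2 * ?S \<sigma>)" by (simp add: power2_eq_square mult_ac)
  qed
  also have "\<dots> \<le> (\<Sum>\<sigma>\<in>Pow J. exp (r / 2 * ?S \<sigma>))"
    using J by (intro sum_mono2) auto
  also have "\<dots> = (\<Sum>\<sigma>\<in>Pow J. \<Prod>i\<in>J. if i \<in> \<sigma> then exp (- (r / 2 * a i)) else exp (r / 2 * a i))"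
    using J by (intro sum.cong refl) (simp add: sum_distrib_left exp_sum if_distrib[of exp] cong: if_cong,
        intro prod.cong, auto)
  also have "\<dots> = (\<Prod>i\<in>J. exp (- (r / 2 * a i)) + exp (r / 2 * a i))"
    using J by (rule sum_Pow_prod)
  also have "\<dots> \<le> (\<Prod>i\<in>J. 2 * exp (r\<^sup>2 / 4))"
  proof (rule prod_mono, intro conjI)
    fix i assume i: "i \<in> J"
    have "exp (- (r / 2 * a i)) + exp (r / 2 * a i) \<le> 2 * exp ((r / 2 * a i)\<^sup>2)"
      using exp_add_exp_minus_le[OF ra[OF i]] by simp
    also have "\<dots> \<le> 2 * exp (r\<^sup>2 / 4)" using sq[OF i] by simp
    finally show "exp (- (r / 2 * a i)) + exp (r / 2 * a i) \<le> 2 * exp (r\<^sup>2 / 4)" .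
  qed (auto intro: add_nonneg_nonneg)
  also have "\<dots> = 2 ^ card J * exp (card J * r\<^sup>2 / 4)"
    by (simp add: power_mult_distrib exp_of_nat_mult[symmetric])
  finally have "card ?D * exp (card J * r\<^sup>2 / 2) * exp (- (card J * r\<^sup>2 / 2))
      \<le> 2 ^ card J * exp (card J * r\<^sup>2 / 4) * exp (- (card J * r\<^sup>2 / 2))"
    by (intro mult_right_mono) auto
  then show ?thesis by (simp add: mult.assoc exp_add[symmetric])
qed

text \<open>For \<sigma> within the first half this is an involution, which serves as its own
  inverse in \<open>swap_index_bij\<close>.\<close>

definition swap_index :: "nat \<Rightarrow> nat set \<Rightarrow> nat \<Rightarrow> nat" where
  "swap_index m \<sigma> i = (if i < m then (if i \<in> \<sigma> then i + m else i) else (if i - m \<in> \<sigma> then i - m else i))"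

lemma swap_index_bij: "\<sigma> \<subseteq> {..<m} \<Longrightarrow> bij_betw (swap_index m \<sigma>) {..<2 * m} {..<2 * m}"
  by (rule bij_betw_byWitness[where f' = "swap_index m \<sigma>"]) (auto simp: swap_index_def)

text \<open>Every swap preserves the product measure, so \<open>2 ^ m\<close> times the measure of
  \<open>E\<close> is the integral of the number of swaps that bring \<open>w\<close> into
  \<open>E\<close>. A bound on this number for each fixed double sample is therefore enough.\<close>

lemma swap_average:
  fixes P :: "'z measure"
  assumes P: "prob_space P" and E: "E \<in> sets (PiM {..<2 * m} (\<lambda>_. P))"
    and K: "\<And>w. w \<in> space (PiM {..<2 * m} (\<lambda>_. P)) \<Longrightarrow>
      real (card {\<sigma>\<in>Pow {..<m}. (\<lambda>i\<in>{..<2 * m}. w (swap_index m \<sigma> i)) \<in> E}) \<le> K"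
  shows "2 ^ m * measure (PiM {..<2 * m} (\<lambda>_. P)) E \<le> K"
proof -
  let ?Q = "PiM {..<2 * m} (\<lambda>_. P)"
  let ?T = "\<lambda>\<sigma> w. \<lambda>i\<in>{..<2 * m}. w (swap_index m \<sigma> i)"
  interpret prob_space ?Q using P by (intro prob_space_PiM)
  have T: "?T \<sigma> \<in> measurable ?Q ?Q" and inv: "distr ?Q ?Q (?T \<sigma>) = ?Q" if "\<sigma> \<in> Pow {..<m}" for \<sigma>
  proof -
    have b: "bij_betw (swap_index m \<sigma>) {..<2 * m} {..<2 * m}" using that by (intro swap_index_bij) auto
    then show "?T \<sigma> \<in> measurable ?Q ?Q"
      by (intro measurable_restrict measurable_component_singleton) (auto dest: bij_betwE)
    show "distr ?Q ?Q (?T \<sigma>) = ?Q"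
      using b P by (intro distr_PiM_reindex[of "{..<2 * m}" "\<lambda>_. P"]) (auto simp: bij_betw_def)
  qed
  have swapped: "measure ?Q E = measure ?Q {w\<in>space ?Q. ?T \<sigma> w \<in> E}" if "\<sigma> \<in> Pow {..<m}" for \<sigma>
  proof -
    have "measure ?Q E = measure (distr ?Q ?Q (?T \<sigma>)) E" by (simp only: inv[OF that])
    also have "\<dots> = measure ?Q (?T \<sigma> -` E \<inter> space ?Q)" by (rule measure_distr[OF T[OF that] E])
    also have "?T \<sigma> -` E \<inter> space ?Q = {w\<in>space ?Q. ?T \<sigma> w \<in> E}" by auto
    finally show ?thesis .
  qed
  have meas: "{w\<in>space ?Q. ?T \<sigma> w \<in> E} \<in> sets ?Q" if "\<sigma> \<in> Pow {..<m}" for \<sigma>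
    using measurable_sets[OF T[OF that] E] by (simp add: vimage_def Int_def conj_commute)
  have "2 ^ m * measure ?Q E = (\<Sum>\<sigma>\<in>Pow {..<m}. measure ?Q {w\<in>space ?Q. ?T \<sigma> w \<in> E})"
    by (simp add: swapped[symmetric] card_Pow)
  also have "\<dots> = (\<Sum>\<sigma>\<in>Pow {..<m}. \<integral>w. indicator {w\<in>space ?Q. ?T \<sigma> w \<in> E} w \<partial>?Q)"
    using meas by (intro sum.cong) auto
  also have "\<dots> = (\<integral>w. (\<Sum>\<sigma>\<in>Pow {..<m}. indicator {w\<in>space ?Q. ?T \<sigma> w \<in> E} w) \<partial>?Q)"
    using meas by (intro Bochner_Integration.integral_sum[symmetric]) (auto simp: emeasure_eq_measure)
  also have "\<dots> \<le> (\<integral>w. K \<partial>?Q)"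
  proof (rule integral_mono)
    show "integrable ?Q (\<lambda>w. \<Sum>\<sigma>\<in>Pow {..<m}. indicator {w\<in>space ?Q. ?T \<sigma> w \<in> E} w :: real)"
      using meas by (intro Bochner_Integration.integrable_sum) (auto simp: emeasure_eq_measure)
    fix w assume w: "w \<in> space ?Q"
    have "(\<Sum>\<sigma>\<in>Pow {..<m}. indicator {w\<in>space ?Q. ?T \<sigma> w \<in> E} w :: real)
        = card {\<sigma>\<in>Pow {..<m}. ?T \<sigma> w \<in> E}"
      using w by (simp add: indicator_def sum.If_cases Int_def)
    also have "\<dots> \<le> K" by (rule K[OF w])
    finally show "(\<Sum>\<sigma>\<in>Pow {..<m}. indicator {w\<in>space ?Q. ?T \<sigma> w \<in> E} w) \<le> K" .
  qed simp
  also have "\<dots> = K" using prob_space by simp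
  finally show ?thesis .
qed

section \<open>Ghost samples and uniform deviation\<close>

lemma borel_measurable_pred_le_real [measurable (raw)]:
  fixes f g :: "'w \<Rightarrow> real"
  shows "f \<in> borel_measurable M \<Longrightarrow> g \<in> borel_measurable M \<Longrightarrow> Measurable.pred M (\<lambda>w. f w \<le> g w)"
  unfolding Measurable.pred_def by (rule borel_measurable_le)

lemma borel_measurable_PiM_sum:
  fixes l :: "'z \<Rightarrow> real"
  assumes "l \<in> borel_measurable P" "J \<subseteq> I"
  shows "(\<lambda>w. \<Sum>i\<in>J. l (w i)) \<in> borel_measurable (PiM I (\<lambda>_. P))"
proof (rule borel_measurable_sum)
  fix i assume "i \<in> J"
  then have "(\<lambda>w. w i) \<in> measurable (PiM I (\<lambda>_. P)) P"
    using assms(2) by (intro measurable_component_singleton) auto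
  then show "(\<lambda>w. l (w i)) \<in> borel_measurable (PiM I (\<lambda>_. P))"
    using assms(1) by (rule measurable_compose)
qed

text \<open>If index \<open>k\<close> is bad on the first half, then with probability at least
  \<open>1 / 2\<close> the average over the second half stays above the mean of \<open>l k\<close>
  less \<open>s\<close>, and the two halves differ by \<tau> on average. The least bad index depends
  on the first half only, so it splits the event into countably many disjoint pieces
  \<open>B k\<close>, each independent of the second half.\<close>

lemma symmetrization:
  fixes l :: "nat \<Rightarrow> 'z \<Rightarrow> real" and s \<tau> :: real and m :: nat
  assumes P: "prob_space P" and m: "0 < m"
    and l[measurable]: "\<And>k. l k \<in> borel_measurable P"
    and bd: "\<And>k z. z \<in> space P \<Longrightarrow> l k z \<in> {0..1}"
    and s: "0 \<le> s" "exp (- (2 * m * s\<^sup>2)) \<le> 1 / 2"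
  shows "measure (PiM {..<m} (\<lambda>_. P)) {w\<in>space (PiM {..<m} (\<lambda>_. P)).
            \<exists>k. (\<Sum>i<m. l k (w i)) + m * (\<tau> + s) < m * integral\<^sup>L P (l k)}
    \<le> 2 * measure (PiM {..<2 * m} (\<lambda>_. P)) {w\<in>space (PiM {..<2 * m} (\<lambda>_. P)).
            \<exists>k. (\<Sum>i<m. l k (w i)) + m * \<tau> \<le> (\<Sum>i\<in>{m..<2 * m}. l k (w i))}"
proof -
  let ?M1 = "PiM {..<m} (\<lambda>_. P)" and ?M2 = "PiM {m..<2 * m} (\<lambda>_. P)" and ?Q = "PiM {..<2 * m} (\<lambda>_. P)"
  let ?mg = "merge {..<m} {m..<2 * m}"
  interpret M1: prob_space ?M1 using P by (intro prob_space_PiM)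
  interpret M2: prob_space ?M2 using P by (intro prob_space_PiM)
  interpret PP: pair_prob_space ?M1 ?M2 by unfold_locales
  interpret S: product_sigma_finite "\<lambda>_::nat. P"
    using P by (simp add: product_sigma_finite_def prob_space_imp_sigma_finite)
  have un: "{..<m} \<union> {m..<2 * m} = {..<2 * m}" by (rule ivl_disj_un_one) simp
  have mg: "?mg \<in> measurable (?M1 \<Otimes>\<^sub>M ?M2) ?Q"
    using measurable_merge[of "{..<m}" "{m..<2 * m}" "\<lambda>_. P"] unfolding un .
  have dist: "distr (?M1 \<Otimes>\<^sub>M ?M2) ?Q ?mg = ?Q"
    using S.distr_merge[of "{..<m}" "{m..<2 * m}"] unfolding un by (simp add: ivl_disj_int)
  define E where "E = {w\<in>space ?Q. \<exists>k. (\<Sum>i<m. l k (w i)) + m * \<tau> \<le> (\<Sum>i\<in>{m..<2 * m}. l k (w i))}"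
  define bad where "bad k w \<longleftrightarrow> (\<Sum>i<m. l k (w i)) + m * (\<tau> + s) < m * integral\<^sup>L P (l k)" for k w
  define B where "B k = {w\<in>space ?M1. bad k w \<and> (\<forall>j<k. \<not> bad j w)}" for k
  define C where "C k = {w\<in>space ?M2. m * integral\<^sup>L P (l k) - m * s < (\<Sum>i\<in>{m..<2 * m}. l k (w i))}" for k
  define e where "e k w = (\<Sum>i<m. l k (w i))" for k w
  define e' where "e' k w = (\<Sum>i\<in>{m..<2 * m}. l k (w i))" for k w
  have [measurable]: "e k \<in> borel_measurable ?Q" "e' k \<in> borel_measurable ?Q" for k
    unfolding e_def e'_def by (auto intro!: borel_measurable_PiM_sum l)
  have E[measurable]: "E \<in> sets ?Q" unfolding E_def e_def[symmetric] e'_def[symmetric] by measurable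
  have [measurable]: "Measurable.pred ?M1 (bad k)" for k
  proof -
    have [measurable]: "e k \<in> borel_measurable ?M1"
      unfolding e_def by (auto intro!: borel_measurable_PiM_sum l)
    show ?thesis unfolding bad_def e_def[symmetric] by measurable
  qed
  have B: "B k \<in> sets ?M1" for k unfolding B_def by measurable
  have [measurable]: "e' k \<in> borel_measurable ?M2" for k
    unfolding e'_def by (auto intro!: borel_measurable_PiM_sum l)
  have C: "C k \<in> sets ?M2" for k unfolding C_def e'_def[symmetric] by measurable
  have half: "1 / 2 \<le> measure ?M2 (C k)" for k
  proof -
    let ?D = "{w\<in>space ?M2. (\<Sum>i\<in>{m..<2 * m}. l k (w i)) \<le> m * integral\<^sup>L P (l k) - m * s}"
    have "measure ?M2 ?D \<le> exp (- (2 * m * s\<^sup>2))"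
      using PiM_Hoeffding(2)[OF P, of "{m..<2 * m}" "l k" s] m bd s by auto
    moreover have "C k = space ?M2 - ?D" by (auto simp: C_def)
    then have "measure ?M2 (C k) = measure ?M2 (space ?M2 - ?D)" by simp
    moreover have D:  "?D \<in> sets ?M2" unfolding e'_def[symmetric] by measurable
    ultimately show ?thesis using s(2) M2.prob_compl[OF D] by linarith
  qed
  have "disjoint_family B"
    unfolding disjoint_family_on_def
  proof (intro ballI impI)
    fix i j :: nat assume "i \<noteq> j"
    then consider "i < j" | "j < i" by linarith
    then show "B i \<inter> B j = {}" by cases (auto simp: B_def)
  qed
  then have sumB: "(\<lambda>k. measure ?M1 (B k)) sums measure ?M1 (\<Union>k. B k)"
    using B by (intro M1.finite_measure_UNION) auto
  have sumBC: "(\<lambda>k. measure (?M1 \<Otimes>\<^sub>M ?M2) (B k \<times> C k)) sums measure (?M1 \<Otimes>\<^sub>M ?M2) (\<Union>k. B k \<times> C k)"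
  proof (rule PP.finite_measure_UNION)
    show "range (\<lambda>k. B k \<times> C k) \<subseteq> sets (?M1 \<Otimes>\<^sub>M ?M2)"
      using B C by (intro image_subsetI pair_measureI)
    show "disjoint_family (\<lambda>k. B k \<times> C k)"
      using \<open>disjoint_family B\<close> unfolding disjoint_family_on_def by blast
  qed
  have times: "measure (?M1 \<Otimes>\<^sub>M ?M2) (B k \<times> C k) = measure ?M1 (B k) * measure ?M2 (C k)" for k
    using M2.emeasure_pair_measure_Times[OF B C] by (simp add: measure_def enn2real_mult)
  have union: "(\<Union>k. B k) = {w\<in>space ?M1. \<exists>k. bad k w}"
  proof -
    have "\<exists>k. bad k w \<and> (\<forall>j<k. \<not> bad j w)" if "bad k w" for k w
      using LeastI[of "\<lambda>k. bad k w", OF that]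
      by (intro exI[of _ "LEAST k. bad k w"]) (auto dest: not_less_Least)
    note first = this
    show ?thesis
    proof (intro equalityI subsetI)
      fix w assume "w \<in> {w\<in>space ?M1. \<exists>k. bad k w}"
      then obtain k where "w \<in> space ?M1" "bad k w" by auto
      with first[OF this(2)] show "w \<in> (\<Union>k. B k)" by (auto simp: B_def)
    qed (auto simp: B_def)
  qed
  have sub: "(\<Union>k. B k \<times> C k) \<subseteq> ?mg -` E \<inter> space (?M1 \<Otimes>\<^sub>M ?M2)"
  proof clarify
    fix k w w' assume w: "w \<in> B k" "w' \<in> C k"
    then have sp: "(w, w') \<in> space (?M1 \<Otimes>\<^sub>M ?M2)"
      by (auto simp: B_def C_def space_pair_measure)
    have "(\<Sum>i<m. l k (w i)) + m * \<tau> \<le> (\<Sum>i\<in>{m..<2 * m}. l k (w' i))"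
      using w by (auto simp: B_def C_def bad_def algebra_simps)
    moreover have "(\<Sum>i<m. l k (?mg (w, w') i)) = (\<Sum>i<m. l k (w i))"
      by (rule sum.cong) (simp_all add: merge_def)
    moreover have "(\<Sum>i\<in>{m..<2 * m}. l k (?mg (w, w') i)) = (\<Sum>i\<in>{m..<2 * m}. l k (w' i))"
      by (rule sum.cong) (simp_all add: merge_def)
    moreover have "?mg (w, w') \<in> space ?Q"
      using mg sp by (rule measurable_space)
    ultimately have "?mg (w, w') \<in> E" unfolding E_def mem_Collect_eq by metis
    with sp show "(w, w') \<in> ?mg -` E \<inter> space (?M1 \<Otimes>\<^sub>M ?M2)" by simp
  qed
  have "1 / 2 * measure ?M1 (\<Union>k. B k) \<le> measure (?M1 \<Otimes>\<^sub>M ?M2) (\<Union>k. B k \<times> C k)"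
  proof (rule sums_le[OF _ sums_mult[OF sumB] sumBC])
    fix k
    show "1 / 2 * measure ?M1 (B k) \<le> measure (?M1 \<Otimes>\<^sub>M ?M2) (B k \<times> C k)"
      unfolding times using mult_right_mono[OF half, of "measure ?M1 (B k)" k] by (simp add: mult.commute)
  qed
  also have "\<dots> \<le> measure (?M1 \<Otimes>\<^sub>M ?M2) (?mg -` E \<inter> space (?M1 \<Otimes>\<^sub>M ?M2))"
    by (rule PP.finite_measure_mono[OF sub measurable_sets[OF mg E]])
  also have "\<dots> = measure (distr (?M1 \<Otimes>\<^sub>M ?M2) ?Q ?mg) E"
    by (rule measure_distr[OF mg E, symmetric])
  also have "\<dots> = measure ?Q E" unfolding dist ..
  finally show ?thesis unfolding union bad_def E_def by simp
qed

text \<open>One \<open>s\<close> pays for the ghost sample, the other for the random signs. With the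
  double sample fixed, only the members of its cover need a deviation bound, so \<open>M\<close>
  enters through a union bound.\<close>

lemma uniform_deviation:
  fixes l :: "nat \<Rightarrow> 'z \<Rightarrow> real" and s \<alpha> :: real and m M :: nat
  assumes P: "prob_space P" and m: "0 < m"
    and l[measurable]: "\<And>k. l k \<in> borel_measurable P"
    and bd: "\<And>k z. z \<in> space P \<Longrightarrow> l k z \<in> {0..1}"
    and s: "0 \<le> s" "s \<le> 1" "exp (- (2 * m * s\<^sup>2)) \<le> 1 / 2"
    and cover: "\<And>w. w \<in> space (PiM {..<2 * m} (\<lambda>_. P)) \<Longrightarrow>
      \<exists>G. finite G \<and> card G \<le> M \<and> (\<forall>k. \<exists>g\<in>G. (\<Sum>i<2 * m. \<bar>l k (w i) - l g (w i)\<bar>) \<le> 2 * m * \<alpha>)"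
  shows "measure (PiM {..<m} (\<lambda>_. P)) {w\<in>space (PiM {..<m} (\<lambda>_. P)).
            \<exists>k. (\<Sum>i<m. l k (w i)) + m * (2 * \<alpha> + 2 * s) < m * integral\<^sup>L P (l k)}
    \<le> 2 * M * exp (- (m * s\<^sup>2 / 4))"
proof -
  let ?Q = "PiM {..<2 * m} (\<lambda>_. P)"
  define E where "E = {w\<in>space ?Q. \<exists>k. (\<Sum>i<m. l k (w i)) + m * (2 * \<alpha> + s) \<le> (\<Sum>i\<in>{m..<2 * m}. l k (w i))}"
  define e where "e k w = (\<Sum>i<m. l k (w i))" for k w
  define e' where "e' k w = (\<Sum>i\<in>{m..<2 * m}. l k (w i))" for k w
  have [measurable]: "e k \<in> borel_measurable ?Q" "e' k \<in> borel_measurable ?Q" for k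
    unfolding e_def e'_def by (auto intro!: borel_measurable_PiM_sum l)
  have E: "E \<in> sets ?Q" unfolding E_def e_def[symmetric] e'_def[symmetric] by measurable
  have shift: "(\<Sum>i\<in>{m..<2 * m}. f i) = (\<Sum>i<m. f (i + m))" for f :: "nat \<Rightarrow> real"
    by (rule sum.reindex_bij_witness[where j = "\<lambda>i. i - m" and i = "\<lambda>i. i + m"]) auto
  have split: "(\<Sum>i<2 * m. f i) = (\<Sum>i<m. f i) + (\<Sum>i\<in>{m..<2 * m}. f i)" for f :: "nat \<Rightarrow> real"
  proof -
    have "{..<2 * m} = {..<m} \<union> {m..<2 * m}" by (rule ivl_disj_un_one[symmetric]) simp
    then show ?thesis by (simp add: sum.union_disjoint ivl_disj_int)
  qed
  have "2 ^ m * measure ?Q E \<le> M * (2 ^ m * exp (- (m * s\<^sup>2 / 4)))"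
  proof (rule swap_average[OF P E])
    fix w assume w: "w \<in> space ?Q"
    from cover[OF w] obtain G where G: "finite G" "card G \<le> M"
      and near: "\<And>k. \<exists>g\<in>G. (\<Sum>i<2 * m. \<bar>l k (w i) - l g (w i)\<bar>) \<le> 2 * m * \<alpha>" by blast
    define a where "a g i = l g (w (i + m)) - l g (w i)" for g i
    define dev where "dev g = {\<sigma>\<in>Pow {..<m}. card {..<m} * s \<le> (\<Sum>i<m. if i \<in> \<sigma> then - a g i else a g i)}" for g
    have a: "\<bar>a g i\<bar> \<le> 1" if "i \<in> {..<m}" for g i
    proof -
      have "w i \<in> space P" "w (i + m) \<in> space P" using w that by (auto simp: space_PiM PiE_iff)
      from bd[OF this(1), of g] bd[OF this(2), of g] show ?thesis unfolding a_def by auto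
    qed
    let ?B = "{\<sigma>\<in>Pow {..<m}. (\<lambda>i\<in>{..<2 * m}. w (swap_index m \<sigma> i)) \<in> E}"
    have "?B \<subseteq> (\<Union>g\<in>G. dev g)"
    proof
      fix \<sigma> assume "\<sigma> \<in> ?B"
      then have \<sigma>: "\<sigma> \<subseteq> {..<m}" and inE: "(\<lambda>i\<in>{..<2 * m}. w (swap_index m \<sigma> i)) \<in> E" by auto
      define w' where "w' i = w (swap_index m \<sigma> i)" for i
      have "(\<Sum>i<m. l k ((\<lambda>i\<in>{..<2 * m}. w (swap_index m \<sigma> i)) i)) = (\<Sum>i<m. l k (w' i))"
          "(\<Sum>i\<in>{m..<2 * m}. l k ((\<lambda>i\<in>{..<2 * m}. w (swap_index m \<sigma> i)) i)) = (\<Sum>i\<in>{m..<2 * m}. l k (w' i))" for k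
        unfolding w'_def by (auto intro!: sum.cong)
      with inE obtain k where k: "(\<Sum>i<m. l k (w' i)) + m * (2 * \<alpha> + s) \<le> (\<Sum>i\<in>{m..<2 * m}. l k (w' i))"
        unfolding E_def by auto
      obtain g where g: "g \<in> G" "(\<Sum>i<2 * m. \<bar>l k (w i) - l g (w i)\<bar>) \<le> 2 * m * \<alpha>" using near by blast
      \<comment> \<open>The distance over the whole double sample is invariant under swaps, so a
        cover chosen before the swap still works after it. How the error is spread over the halves
        is unknown, hence \<open>2 * \<alpha>\<close>.\<close>
      have "(\<Sum>i<2 * m. \<bar>l k (w' i) - l g (w' i)\<bar>) \<le> 2 * m * \<alpha>"
        using sum.reindex_bij_betw[OF swap_index_bij[OF \<sigma>], of "\<lambda>i. \<bar>l k (w i) - l g (w i)\<bar>"] g(2)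
        unfolding w'_def by simp
      then have "(\<Sum>i<m. \<bar>l k (w' i) - l g (w' i)\<bar>) + (\<Sum>i\<in>{m..<2 * m}. \<bar>l k (w' i) - l g (w' i)\<bar>) \<le> 2 * m * \<alpha>"
        unfolding split .
      moreover have "(\<Sum>i<m. l g (w' i)) - (\<Sum>i<m. l k (w' i)) \<le> (\<Sum>i<m. \<bar>l k (w' i) - l g (w' i)\<bar>)"
        unfolding sum_subtractf[symmetric] by (intro sum_mono) auto
      moreover have "(\<Sum>i\<in>{m..<2 * m}. l k (w' i)) - (\<Sum>i\<in>{m..<2 * m}. l g (w' i))
          \<le> (\<Sum>i\<in>{m..<2 * m}. \<bar>l k (w' i) - l g (w' i)\<bar>)"
        unfolding sum_subtractf[symmetric] by (intro sum_mono) auto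
      ultimately have "m * s \<le> (\<Sum>i\<in>{m..<2 * m}. l g (w' i)) - (\<Sum>i<m. l g (w' i))"
        using k by (simp add: algebra_simps)
      also have "\<dots> = (\<Sum>i<m. l g (w' (i + m)) - l g (w' i))"
        unfolding shift by (simp add: sum_subtractf)
      also have "\<dots> = (\<Sum>i<m. if i \<in> \<sigma> then - a g i else a g i)"
        by (intro sum.cong) (auto simp: w'_def a_def swap_index_def)
      finally show "\<sigma> \<in> (\<Union>g\<in>G. dev g)" using g(1) \<sigma> by (auto simp: dev_def)
    qed
    moreover have "finite (\<Union>g\<in>G. dev g)" using G by (auto simp: dev_def)
    ultimately have "card ?B \<le> card (\<Union>g\<in>G. dev g)" by (rule card_mono[rotated])
    also have "\<dots> \<le> (\<Sum>g\<in>G. card (dev g))" by (rule card_UN_le[OF G(1)])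
    finally have "real (card ?B) \<le> (\<Sum>g\<in>G. real (card (dev g)))" by (simp flip: of_nat_sum)
    also have "\<dots> \<le> (\<Sum>g\<in>G. 2 ^ m * exp (- (m * s\<^sup>2 / 4)))"
    proof (rule sum_mono)
      fix g
      show "real (card (dev g)) \<le> 2 ^ m * exp (- (m * s\<^sup>2 / 4))"
        using card_sign_deviation[of "{..<m}" "a g" s] a s unfolding dev_def by simp
    qed
    also have "\<dots> \<le> M * (2 ^ m * exp (- (m * s\<^sup>2 / 4)))"
      using G by (simp add: mult_right_mono)
    finally show "real (card ?B) \<le> M * (2 ^ m * exp (- (m * s\<^sup>2 / 4)))" .
  qed
  then have "measure ?Q E \<le> M * exp (- (m * s\<^sup>2 / 4))" by simp
  moreover have "measure (PiM {..<m} (\<lambda>_. P)) {w\<in>space (PiM {..<m} (\<lambda>_. P)).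
            \<exists>k. (\<Sum>i<m. l k (w i)) + m * ((2 * \<alpha> + s) + s) < m * integral\<^sup>L P (l k)} \<le> 2 * measure ?Q E"
    unfolding E_def by (rule symmetrization[OF P m l bd s(1,3)])
  moreover have "2 * \<alpha> + 2 * s = (2 * \<alpha> + s) + s" by simp
  ultimately show ?thesis by (simp only:)
qed

text \<open>Among infinitely many functions the empirical loss need not attain its infimum, so
  \<open>K\<close> takes the least index that comes within \<open>m * s\<close> of all others; as a
  least index it is measurable. The \<open>4 * s\<close> consists of \<open>2 * s\<close> for the
  uniform deviation, \<open>s\<close> for this slack and \<open>s\<close> for the deviation of the
  competitor \<open>k0\<close>.\<close>

lemma empirical_minimizer:
  fixes l :: "nat \<Rightarrow> 'z \<Rightarrow> real" and s \<alpha> :: real and m M :: nat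
  assumes P: "prob_space P" and m: "0 < m"
    and l[measurable]: "\<And>k. l k \<in> borel_measurable P"
    and bd: "\<And>k z. z \<in> space P \<Longrightarrow> l k z \<in> {0..1}"
    and s: "0 < s" "s \<le> 1" "exp (- (2 * m * s\<^sup>2)) \<le> 1 / 2"
    and cover: "\<And>w. w \<in> space (PiM {..<2 * m} (\<lambda>_. P)) \<Longrightarrow>
      \<exists>G. finite G \<and> card G \<le> M \<and> (\<forall>k. \<exists>g\<in>G. (\<Sum>i<2 * m. \<bar>l k (w i) - l g (w i)\<bar>) \<le> 2 * m * \<alpha>)"
  defines "K \<equiv> \<lambda>w. LEAST k. \<forall>j. (\<Sum>i<m. l k (w i)) \<le> (\<Sum>i<m. l j (w i)) + m * s"
  shows "K \<in> measurable (PiM {..<m} (\<lambda>_. P)) (count_space UNIV)"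
    and "measure (PiM {..<m} (\<lambda>_. P)) {w\<in>space (PiM {..<m} (\<lambda>_. P)).
            integral\<^sup>L P (l k0) + 2 * \<alpha> + 4 * s \<le> integral\<^sup>L P (l (K w))}
    \<le> (2 * M + 1) * exp (- (m * s\<^sup>2 / 4))"
proof -
  let ?M = "PiM {..<m} (\<lambda>_. P)"
  interpret prob_space ?M using P by (intro prob_space_PiM)
  define e where "e k w = (\<Sum>i<m. l k (w i))" for k w
  have [measurable]: "e k \<in> borel_measurable ?M" for k
    unfolding e_def by (intro borel_measurable_PiM_sum l order_refl)
  show K[measurable]: "K \<in> measurable ?M (count_space UNIV)"
    unfolding K_def e_def[symmetric] by measurable
  let ?A = "{w\<in>space ?M. \<exists>k. (\<Sum>i<m. l k (w i)) + m * (2 * \<alpha> + 2 * s) < m * integral\<^sup>L P (l k)}"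
  let ?B = "{w\<in>space ?M. m * integral\<^sup>L P (l k0) + m * s \<le> (\<Sum>i<m. l k0 (w i))}"
  have meas: "?A \<in> sets ?M" "?B \<in> sets ?M" unfolding e_def[symmetric] by measurable
  have A: "measure ?M ?A \<le> 2 * M * exp (- (m * s\<^sup>2 / 4))"
    using s by (intro uniform_deviation[OF P m l bd _ _ _ cover]) auto
  have "measure ?M ?B \<le> exp (- (2 * m * s\<^sup>2))"
    using PiM_Hoeffding(1)[OF P, of "{..<m}" "l k0" s] m bd s by (auto simp: lessThan_empty_iff)
  also have "\<dots> \<le> exp (- (m * s\<^sup>2 / 4))" by simp
  finally have B: "measure ?M ?B \<le> exp (- (m * s\<^sup>2 / 4))" .
  have sub: "{w\<in>space ?M. integral\<^sup>L P (l k0) + 2 * \<alpha> + 4 * s \<le> integral\<^sup>L P (l (K w))} \<subseteq> ?A \<union> ?B"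
  proof (intro subsetI, rule ccontr)
    fix w assume w: "w \<in> {w\<in>space ?M. integral\<^sup>L P (l k0) + 2 * \<alpha> + 4 * s \<le> integral\<^sup>L P (l (K w))}"
      and n: "w \<notin> ?A \<union> ?B"
    have e0: "0 \<le> e k w" for k
      unfolding e_def using w bd by (intro sum_nonneg) (auto simp: space_PiM PiE_iff)
    have "\<exists>k. \<forall>j. e k w \<le> e j w + m * s"
    proof -
      have bdd: "bdd_below (range (\<lambda>k. e k w))" using e0 by (intro bdd_belowI) auto
      have "0 < m * s" using m s by simp
      then have "Inf (range (\<lambda>k. e k w)) < Inf (range (\<lambda>k. e k w)) + m * s" by simp
      then obtain k where "e k w < Inf (range (\<lambda>k. e k w)) + m * s"
        using cInf_lessD[of "range (\<lambda>k. e k w)"] by blast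
      moreover have "Inf (range (\<lambda>k. e k w)) \<le> e j w" for j using bdd by (intro cInf_lower) auto
      ultimately show ?thesis by (intro exI[of _ k]) (smt (verit))
    qed
    then have "\<forall>j. e (K w) w \<le> e j w + m * s"
      unfolding K_def e_def by (rule LeastI_ex)
    then have "e (K w) w \<le> e k0 w + m * s" by blast
    moreover have "m * integral\<^sup>L P (l (K w)) \<le> e (K w) w + m * (2 * \<alpha> + 2 * s)"
      using w n unfolding e_def by (auto simp: not_less)
    moreover have "e k0 w < m * integral\<^sup>L P (l k0) + m * s"
      using w n unfolding e_def by (auto simp: not_le)
    ultimately have "m * integral\<^sup>L P (l (K w)) < m * (integral\<^sup>L P (l k0) + 2 * \<alpha> + 4 * s)"
      by (simp add: algebra_simps)
    then have "integral\<^sup>L P (l (K w)) < integral\<^sup>L P (l k0) + 2 * \<alpha> + 4 * s"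
      using m by (simp add: mult_less_cancel_left)
    with w show False by auto
  qed
  have "measure ?M {w\<in>space ?M. integral\<^sup>L P (l k0) + 2 * \<alpha> + 4 * s \<le> integral\<^sup>L P (l (K w))}
      \<le> measure ?M (?A \<union> ?B)"
    using meas by (intro finite_measure_mono[OF sub]) auto
  also have "\<dots> \<le> measure ?M ?A + measure ?M ?B"
    using meas by (intro measure_Un_le)
  also have "\<dots> \<le> (2 * M + 1) * exp (- (m * s\<^sup>2 / 4))"
    using A B by (simp add: algebra_simps)
  finally show "measure ?M {w\<in>space ?M. integral\<^sup>L P (l k0) + 2 * \<alpha> + 4 * s \<le> integral\<^sup>L P (l (K w))}
      \<le> (2 * M + 1) * exp (- (m * s\<^sup>2 / 4))" .
qed

section \<open>From shattering to covering numbers\<close>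

lemma length_le_fat:
  assumes "fatly_shatters X F \<gamma> xrs" "fat X F \<gamma> < \<infinity>"
  shows "length xrs \<le> the_enat (fat X F \<gamma>)"
proof -
  have "enat (length xrs) \<le> fat X F \<gamma>"
    unfolding fat_def using assms(1) by (intro Sup_upper) auto
  then show ?thesis using assms(2) by (cases "fat X F \<gamma>") auto
qed

lemma length_le_fatV:
  assumes "fatly_shatters X F \<gamma> (map (\<lambda>x. (x, r)) xs)" "r \<in> {0..1}" "fatV X F \<gamma> < \<infinity>"
  shows "length xs \<le> the_enat (fatV X F \<gamma>)"
proof -
  have "enat (length xs) \<le> fatV X F \<gamma>"
    unfolding fatV_def using assms(1,2) by (intro Sup_upper) auto
  then show ?thesis using assms(3) by (cases "fatV X F \<gamma>") auto
qed

text \<open>Indexed by sample positions instead of points, so that samples with repetitions need no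
  special treatment.\<close>

definition rounding :: "real \<Rightarrow> (nat \<Rightarrow> 'a) \<Rightarrow> ('a \<Rightarrow> real) \<Rightarrow> nat \<Rightarrow> nat" where
  "rounding \<eta> x f i = nat \<lfloor>f (x i) / \<eta>\<rfloor>"

lemma rounding_bounds:
  fixes \<eta> :: real and f :: "'a \<Rightarrow> real"
  assumes "0 < \<eta>" "0 \<le> f (x i)"
  shows "rounding \<eta> x f i * \<eta> \<le> f (x i)" "f (x i) < (rounding \<eta> x f i + 1) * \<eta>"
proof -
  have "0 \<le> f (x i) / \<eta>" using assms by simp
  then have "real (rounding \<eta> x f i) = of_int \<lfloor>f (x i) / \<eta>\<rfloor>" by (simp add: rounding_def)
  then have "real (rounding \<eta> x f i) \<le> f (x i) / \<eta>" "f (x i) / \<eta> < real (rounding \<eta> x f i) + 1"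
    by linarith+
  then show "rounding \<eta> x f i * \<eta> \<le> f (x i)" "f (x i) < (rounding \<eta> x f i + 1) * \<eta>"
    using assms(1) by (simp_all add: le_divide_eq divide_less_eq add.commute)
qed

text \<open>The strict inequality on the lower side of \<open>margin_shatters\<close> is worth one
  more unit, which absorbs the rounding down. Hence no margin is lost, and \<gamma> may be as large
  as \<open>g * \<eta>\<close>.\<close>

lemma margin_shatters_rounding:
  fixes \<eta> \<gamma> :: real and g :: nat
  assumes F: "F \<subseteq> X \<rightarrow>\<^sub>E {0..1}" and H: "H \<subseteq> F" and \<eta>: "0 < \<eta>" and g: "\<gamma> \<le> g * \<eta>"
    and x: "x \<in> set is \<rightarrow> X" and dist: "distinct is"
    and sh: "margin_shatters g s (set is) (rounding \<eta> x ` H)"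
  shows "fatly_shatters X F \<gamma> (map (\<lambda>i. (x i, s i * \<eta>)) is)"
    and "i \<in> set is \<Longrightarrow> s i * \<eta> \<in> {0..1}"
proof -
  have val: "f (x i) \<in> {0..1}" if "f \<in> H" "i \<in> set is" for f i
    using that F H x by (auto simp: PiE_iff Pi_iff)
  show thr: "s i * \<eta> \<in> {0..1}" if i: "i \<in> set is" for i
  proof -
    obtain f where f: "f \<in> H" "s i + g \<le> rounding \<eta> x f i"
      using sh[unfolded margin_shatters_def, rule_format, of "{i}"] i by auto
    have "s i * \<eta> \<le> rounding \<eta> x f i * \<eta>" using f(2) \<eta> by (intro mult_right_mono) auto
    also have "\<dots> \<le> f (x i)" using val[OF f(1) i] \<eta> by (intro rounding_bounds) auto
    finally show ?thesis using val[OF f(1) i] \<eta> by auto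
  qed
  show "fatly_shatters X F \<gamma> (map (\<lambda>i. (x i, s i * \<eta>)) is)"
    unfolding fatly_shatters_def
  proof (intro conjI allI impI)
    show "set (map (\<lambda>i. (x i, s i * \<eta>)) is) \<subseteq> X \<times> {0..1}"
      using thr x by (auto simp: Pi_iff)
    fix b :: "bool list" assume len: "length b = length (map (\<lambda>i. (x i, s i * \<eta>)) is)"
    define B where "B = {is ! j | j. j < length is \<and> b ! j}"
    have "B \<subseteq> set is" by (auto simp: B_def)
    then obtain f where f: "f \<in> H" "\<forall>i\<in>B. s i + g \<le> rounding \<eta> x f i"
        "\<forall>i\<in>set is - B. rounding \<eta> x f i + g < s i"
      using sh[unfolded margin_shatters_def, rule_format, of B] by auto
    have "(b ! j \<longrightarrow> s (is ! j) * \<eta> + \<gamma> \<le> f (x (is ! j))) \<and>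
          (\<not> b ! j \<longrightarrow> f (x (is ! j)) \<le> s (is ! j) * \<eta> - \<gamma>)" if j: "j < length is" for j
    proof (intro conjI impI)
      have i: "is ! j \<in> set is" using j by simp
      note bounds = rounding_bounds[of \<eta> f x "is ! j"]
      have v: "0 \<le> f (x (is ! j))" using val[OF f(1) i] by auto
      {
        assume "b ! j"
        then have "s (is ! j) + g \<le> rounding \<eta> x f (is ! j)" using f(2) j by (auto simp: B_def)
        then have "real (s (is ! j) + g) * \<eta> \<le> rounding \<eta> x f (is ! j) * \<eta>"
          using \<eta> by (intro mult_right_mono) auto
        then show "s (is ! j) * \<eta> + \<gamma> \<le> f (x (is ! j))"
          using bounds(1)[OF \<eta> v] g by (simp add: algebra_simps)
      next
        assume "\<not> b ! j"
        then have "is ! j \<notin> B" using j dist by (auto simp: B_def nth_eq_iff_index_eq)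
        then have "rounding \<eta> x f (is ! j) + g < s (is ! j)" using f(3) i by auto
        then have "(real (rounding \<eta> x f (is ! j)) + 1 + g) * \<eta> \<le> s (is ! j) * \<eta>"
          using \<eta> by (intro mult_right_mono) auto
        then show "f (x (is ! j)) \<le> s (is ! j) * \<eta> - \<gamma>"
          using bounds(2)[OF \<eta> v] g by (simp add: algebra_simps)
      }
    qed
    then show "\<exists>f\<in>F. \<forall>j<length (map (\<lambda>i. (x i, s i * \<eta>)) is).
           (b ! j \<longrightarrow> snd (map (\<lambda>i. (x i, s i * \<eta>)) is ! j) + \<gamma>
              \<le> f (fst (map (\<lambda>i. (x i, s i * \<eta>)) is ! j))) \<and>
           (\<not> b ! j \<longrightarrow> f (fst (map (\<lambda>i. (x i, s i * \<eta>)) is ! j))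
              \<le> snd (map (\<lambda>i. (x i, s i * \<eta>)) is ! j) - \<gamma>)"
      using f(1) H by (intro bexI[of _ f]) auto
  qed
qed

text \<open>Strict, so that a maximal separated set covers with mean distance at most
  \<alpha>.\<close>

definition l1_separated :: "nat \<Rightarrow> (nat \<Rightarrow> 'a) \<Rightarrow> real \<Rightarrow> ('a \<Rightarrow> real) set \<Rightarrow> bool" where
  "l1_separated N x \<alpha> H \<longleftrightarrow>
     (\<forall>f\<in>H. \<forall>f'\<in>H. f \<noteq> f' \<longrightarrow> N * \<alpha> < (\<Sum>i<N. \<bar>f (x i) - f' (x i)\<bar>))"

text \<open>Rounding changes a distance by at most \<eta> per index, which accounts for the step
  from \<open>2 * g + 2\<close> to \<open>2 * g + 1\<close>.\<close>

lemma margin_separated_rounding: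
  fixes \<eta> \<alpha> :: real and g :: nat
  assumes F: "F \<subseteq> X \<rightarrow>\<^sub>E {0..1}" and H: "H \<subseteq> F" and \<eta>: "0 < \<eta>" and x: "x \<in> {..<N} \<rightarrow> X"
    and N: "0 < N" and g: "(2 * real g + 2) * \<eta> \<le> \<alpha>" and sep: "l1_separated N x \<alpha> H"
  shows "margin_separated g {..<N} (rounding \<eta> x ` H)" "inj_on (rounding \<eta> x) H"
proof -
  have val: "f (x i) \<in> {0..1}" if "f \<in> H" "i < N" for f i
    using that F H x by (auto simp: PiE_iff Pi_iff)
  have big: "(2 * g + 1) * N \<le> (\<Sum>i<N. nat \<bar>int (rounding \<eta> x f i) - int (rounding \<eta> x f' i)\<bar>)"
    if f: "f \<in> H" "f' \<in> H" "f \<noteq> f'" for f f'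
  proof -
    let ?S = "\<Sum>i<N. nat \<bar>int (rounding \<eta> x f i) - int (rounding \<eta> x f' i)\<bar>"
    have "N * ((2 * real g + 2) * \<eta>) \<le> N * \<alpha>" using g by (intro mult_left_mono) auto
    also have "\<dots> < (\<Sum>i<N. \<bar>f (x i) - f' (x i)\<bar>)" using sep f unfolding l1_separated_def by blast
    also have "\<dots> \<le> (\<Sum>i<N. \<eta> * (real (nat \<bar>int (rounding \<eta> x f i) - int (rounding \<eta> x f' i)\<bar>) + 1))"
    proof (rule sum_mono)
      fix i assume "i \<in> {..<N}"
      then have nonneg: "0 \<le> f (x i)" "0 \<le> f' (x i)" using val f by auto
      define a c where "a = real (rounding \<eta> x f i)" and "c = real (rounding \<eta> x f' i)"
      have "real (nat \<bar>int (rounding \<eta> x f i) - int (rounding \<eta> x f' i)\<bar>) = \<bar>a - c\<bar>"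
        unfolding a_def c_def by (subst of_nat_nat) auto
      moreover have "\<eta> * (a - c) \<le> \<eta> * \<bar>a - c\<bar>" "\<eta> * (c - a) \<le> \<eta> * \<bar>a - c\<bar>"
        using \<eta> by (auto intro: mult_left_mono)
      moreover have "a * \<eta> \<le> f (x i)" "f (x i) < (a + 1) * \<eta>" "c * \<eta> \<le> f' (x i)" "f' (x i) < (c + 1) * \<eta>"
        unfolding a_def c_def
        using rounding_bounds[of \<eta> f x i, OF \<eta> nonneg(1)] rounding_bounds[of \<eta> f' x i, OF \<eta> nonneg(2)]
        by (simp_all add: algebra_simps)
      ultimately show "\<bar>f (x i) - f' (x i)\<bar>
        \<le> \<eta> * (real (nat \<bar>int (rounding \<eta> x f i) - int (rounding \<eta> x f' i)\<bar>) + 1)"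
        unfolding abs_le_iff by (simp add: algebra_simps)
    qed
    also have "\<dots> = \<eta> * (real ?S + N)"
      by (simp add: sum_distrib_left[symmetric] sum.distrib)
    finally have "\<eta> * (N * (2 * real g + 2)) < \<eta> * (real ?S + N)" by (simp add: mult_ac)
    then have "N * (2 * real g + 2) < real ?S + N" using \<eta> by (simp only: mult_less_cancel_left_pos)
    then have "real ((2 * g + 1) * N) < real ?S" by (simp add: algebra_simps)
    then show ?thesis by linarith
  qed
  then show "margin_separated g {..<N} (rounding \<eta> x ` H)"
    unfolding margin_separated_def by auto
  show "inj_on (rounding \<eta> x) H"
  proof (rule inj_onI, rule ccontr)
    fix f f' assume f: "f \<in> H" "f' \<in> H" "rounding \<eta> x f = rounding \<eta> x f'" "f \<noteq> f'"
    from big[OF f(1,2,4)] N f(3) show False by simp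
  qed
qed

lemma rounding_le:
  fixes \<eta> :: real
  assumes F: "F \<subseteq> X \<rightarrow>\<^sub>E {0..1}" and H: "H \<subseteq> F" and \<eta>: "0 < \<eta>" and x: "x \<in> {..<N} \<rightarrow> X"
  shows "\<forall>q\<in>rounding \<eta> x ` H. \<forall>i\<in>{..<N}. q i \<le> nat \<lfloor>1 / \<eta>\<rfloor>"
proof (intro ballI)
  fix q i assume "q \<in> rounding \<eta> x ` H" "i \<in> {..<N}"
  then obtain f where "f \<in> H" "q = rounding \<eta> x f" by auto
  moreover have "f (x i) \<le> 1" using \<open>f \<in> H\<close> \<open>i \<in> {..<N}\<close> F H x by (auto simp: PiE_iff Pi_iff)
  ultimately show "q i \<le> nat \<lfloor>1 / \<eta>\<rfloor>"
    using \<eta> by (auto simp: rounding_def intro!: nat_mono floor_mono divide_right_mono)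
qed

lemma fat_packing:
  fixes \<eta> \<gamma> \<alpha> :: real and g b d :: nat
  assumes F: "F \<subseteq> X \<rightarrow>\<^sub>E {0..1}" and H: "H \<subseteq> F" "finite H" and \<eta>: "0 < \<eta>" and x: "x \<in> {..<N} \<rightarrow> X"
    and N: "0 < N" and g: "(2 * real g + 2) * \<eta> \<le> \<alpha>" "\<gamma> \<le> g * \<eta>" and sep: "l1_separated N x \<alpha> H"
    and fat: "fat X F \<gamma> < \<infinity>" "the_enat (fat X F \<gamma>) = d" "0 < d" and b: "b = nat \<lfloor>1 / \<eta>\<rfloor>"
  shows "ln (card H) \<le> 21 * d * (ln (16 * b * (b + 1)))\<^sup>2"
proof (cases "2 \<le> card H")
  case True
  have card: "card (rounding \<eta> x ` H) = card H"
    by (rule card_image[OF margin_separated_rounding(2)[OF F H(1) \<eta> x N g(1) sep]])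
  have "ln (card (rounding \<eta> x ` H)) \<le> 21 * d * (ln (16 * b * (b + 1)))\<^sup>2"
  proof (rule packing_free_threshold_ln)
    show "margin_separated g {..<N} (rounding \<eta> x ` H)"
      by (rule margin_separated_rounding(1)[OF F H(1) \<eta> x N g(1) sep])
    show "\<forall>q\<in>rounding \<eta> x ` H. \<forall>i\<in>{..<N}. q i \<le> b"
      unfolding b by (rule rounding_le[OF F H(1) \<eta> x])
    show "card A \<le> d" if A: "A \<subseteq> {..<N}" "margin_shatters g s A (rounding \<eta> x ` H)" for A s
    proof -
      have fin: "finite A" using A(1) by (rule finite_subset) simp
      let ?is = "sorted_list_of_set A"
      have "fatly_shatters X F \<gamma> (map (\<lambda>i. (x i, s i * \<eta>)) ?is)"
        using A x fin by (intro margin_shatters_rounding(1)[OF F H(1) \<eta> g(2)]) auto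
      from length_le_fat[OF this fat(1)] show ?thesis using fin fat(2) by simp
    qed
  qed (use N H True card fat(3) in auto)
  then show ?thesis unfolding card .
next
  case False
  then have "card H = 0 \<or> card H = 1" by linarith
  then show ?thesis by auto
qed

lemma fatV_packing:
  fixes \<eta> \<gamma> \<alpha> :: real and g b d :: nat
  assumes F: "F \<subseteq> X \<rightarrow>\<^sub>E {0..1}" and H: "H \<subseteq> F" "finite H" and \<eta>: "0 < \<eta>" and x: "x \<in> {..<N} \<rightarrow> X"
    and N: "0 < N" and g: "(2 * real g + 2) * \<eta> \<le> \<alpha>" "\<gamma> \<le> g * \<eta>" and sep: "l1_separated N x \<alpha> H"
    and fat: "fatV X F \<gamma> < \<infinity>" "the_enat (fatV X F \<gamma>) = d" "0 < d" and b: "b = nat \<lfloor>1 / \<eta>\<rfloor>"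
  shows "ln (card H) \<le> 4 * (b + 1) * d * ln (b + 1)"
proof (cases "2 \<le> card H")
  case True
  have card: "card (rounding \<eta> x ` H) = card H"
    by (rule card_image[OF margin_separated_rounding(2)[OF F H(1) \<eta> x N g(1) sep]])
  have "ln (card (rounding \<eta> x ` H)) \<le> 4 * (b + 1) * d * ln (b + 1)"
  proof (rule packing_constant_threshold_ln)
    show "margin_separated g {..<N} (rounding \<eta> x ` H)"
      by (rule margin_separated_rounding(1)[OF F H(1) \<eta> x N g(1) sep])
    show "\<forall>q\<in>rounding \<eta> x ` H. \<forall>i\<in>{..<N}. q i \<le> b"
      unfolding b by (rule rounding_le[OF F H(1) \<eta> x])
    show "card A \<le> d" if A: "A \<subseteq> {..<N}" "margin_shatters g (\<lambda>_. k) A (rounding \<eta> x ` H)" for A k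
    \<comment> \<open>The threshold lies in \<open>{0..1}\<close> because some function reaches it
      at a member of \<open>A\<close>, so the empty set is treated apart.\<close>
    proof (cases "A = {}")
      case False
      then obtain i where i: "i \<in> A" by auto
      have fin: "finite A" using A(1) by (rule finite_subset) simp
      let ?is = "sorted_list_of_set A"
      have hyps: "x \<in> set ?is \<rightarrow> X" "distinct ?is" "margin_shatters g (\<lambda>_. k) (set ?is) (rounding \<eta> x ` H)"
        using A x fin by auto
      have "fatly_shatters X F \<gamma> (map (\<lambda>y. (y, k * \<eta>)) (map x ?is))"
        using margin_shatters_rounding(1)[OF F H(1) \<eta> g(2) hyps] by (simp add: comp_def)
      moreover have "k * \<eta> \<in> {0..1}"
        using margin_shatters_rounding(2)[OF F H(1) \<eta> g(2) hyps] i fin by auto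
      ultimately show ?thesis using length_le_fatV[OF _ _ fat(1)] fin fat(2) by fastforce
    qed simp
  qed (use N H True card fat(3) in auto)
  then show ?thesis unfolding card .
next
  case False
  then have "card H = 0 \<or> card H = 1" by linarith
  then show ?thesis by auto
qed

text \<open>A separated set of greatest size, which exists because \<open>pack\<close> bounds the
  sizes, is a cover: a function far from all its members could be added.\<close>

lemma l1_cover:
  assumes pack: "\<And>H. H \<subseteq> F \<Longrightarrow> finite H \<Longrightarrow> l1_separated N x \<alpha> H \<Longrightarrow> card H \<le> M" and \<alpha>: "0 \<le> \<alpha>"
  obtains H where "H \<subseteq> F" "finite H" "card H \<le> M"
    "\<And>f. f \<in> F \<Longrightarrow> \<exists>h\<in>H. (\<Sum>i<N. \<bar>f (x i) - h (x i)\<bar>) \<le> N * \<alpha>"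
proof -
  let ?P = "\<lambda>H. H \<subseteq> F \<and> finite H \<and> l1_separated N x \<alpha> H"
  have "?P {}" by (auto simp: l1_separated_def)
  moreover have "\<forall>H. ?P H \<longrightarrow> card H < Suc M" using pack by (simp add: less_Suc_eq_le)
  ultimately have "\<exists>H. ?P H \<and> (\<forall>H'. ?P H' \<longrightarrow> card H' \<le> card H)"
    by (rule ex_has_greatest_nat)
  then obtain H where H: "?P H" and max: "\<And>H'. ?P H' \<Longrightarrow> card H' \<le> card H" by blast
  show ?thesis
  proof (rule that)
    fix f assume f: "f \<in> F"
    show "\<exists>h\<in>H. (\<Sum>i<N. \<bar>f (x i) - h (x i)\<bar>) \<le> N * \<alpha>"
    proof (rule ccontr)
      assume "\<not> ?thesis"
      then have far: "N * \<alpha> < (\<Sum>i<N. \<bar>f (x i) - h (x i)\<bar>)" if "h \<in> H" for h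
        using that by (auto simp: not_le)
      have "f \<notin> H"
      proof
        assume "f \<in> H"
        from far[OF this] have "N * \<alpha> < 0" by simp
        then show False using \<alpha> by (simp add: mult_less_0_iff)
      qed
      have "l1_separated N x \<alpha> (insert f H)"
        unfolding l1_separated_def
      proof (intro ballI impI)
        fix h h' assume h: "h \<in> insert f H" "h' \<in> insert f H" "h \<noteq> h'"
        show "N * \<alpha> < (\<Sum>i<N. \<bar>h (x i) - h' (x i)\<bar>)"
          using h far[of h] far[of h'] H unfolding l1_separated_def
          by (cases "h = f"; cases "h' = f") (auto simp: abs_minus_commute)
      qed
      then have "card (insert f H) \<le> card H" using H f by (intro max) auto
      then show False using H \<open>f \<notin> H\<close> by simp
    qed
  qed (use H pack in auto)
qed

section \<open>The learner\<close>

text \<open>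
  Since \<open>X\<close> is countable, a class of functions on \<open>X\<close> has a countable subclass that is dense
  for pointwise convergence; restricting the learner to it settles all measurability questions.
\<close>

lemma countable_pointwise_dense:
  fixes F :: "('a \<Rightarrow> real) set" and e :: "nat \<Rightarrow> 'a"
  assumes "F \<noteq> {}"
  obtains f :: "nat \<Rightarrow> 'a \<Rightarrow> real" where "range f \<subseteq> F"
    "\<forall>h\<in>F. \<forall>n. \<exists>k. \<forall>i<n. \<bar>f k (e i) - h (e i)\<bar> \<le> 1 / Suc n"
proof -
  \<comment> \<open>The code names the grid cells of width \<open>1 / Suc n\<close> that contain the
    values at the first \<open>n\<close> points. Codes are integer lists, hence countably many, and
    one representative in \<open>F\<close> is kept for each code that occurs.\<close>
  define code where "code n h = map (\<lambda>i. \<lfloor>h (e i) * real (Suc n)\<rfloor>) [0..<n]"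
    for n and h :: "'a \<Rightarrow> real"
  define pick where "pick p = (SOME h. h \<in> F \<and> code (fst p) h = snd p)" for p
  define D where "D = pick ` {p. \<exists>h\<in>F. code (fst p) h = snd p}"
  have pick: "pick (n, code n h) \<in> F \<and> code n (pick (n, code n h)) = code n h" if "h \<in> F" for n h
    using someI[of "\<lambda>h'. h' \<in> F \<and> code n h' = code n h" h] that unfolding pick_def by simp
  have DF: "D \<subseteq> F"
    unfolding D_def using pick by auto
  have "D \<noteq> {}" using assms unfolding D_def by force
  moreover have "countable D" unfolding D_def by simp
  ultimately have range: "range (from_nat_into D) = D" by (simp add: range_from_nat_into)
  show ?thesis
  proof (rule that)
    show "range (from_nat_into D) \<subseteq> F" using range DF by simp
    show "\<forall>h\<in>F. \<forall>n. \<exists>k. \<forall>i<n. \<bar>from_nat_into D k (e i) - h (e i)\<bar> \<le> 1 / Suc n"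
    proof (intro ballI allI)
      fix h n assume h: "h \<in> F"
      define h' where "h' = pick (n, code n h)"
      have "h' \<in> D" unfolding h'_def D_def using h by (intro imageI) auto
      then obtain k where k: "from_nat_into D k = h'" using range by (metis imageE)
      have "\<bar>h' (e i) - h (e i)\<bar> \<le> 1 / Suc n" if "i < n" for i
      proof -
        have "code n h' ! i = code n h ! i" using pick[OF h, of n] unfolding h'_def by simp
        then have "\<lfloor>h' (e i) * Suc n\<rfloor> = \<lfloor>h (e i) * Suc n\<rfloor>" using that unfolding code_def by simp
        then have "\<bar>h' (e i) * Suc n - h (e i) * Suc n\<bar> \<le> 1" by linarith
        then have "\<bar>(h' (e i) - h (e i)) * Suc n\<bar> \<le> 1" by (simp only: left_diff_distrib)
        then have "\<bar>h' (e i) - h (e i)\<bar> * Suc n \<le> 1" by (simp only: abs_mult abs_of_nat)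
        then show ?thesis by (subst le_divide_eq) simp
      qed
      then show "\<exists>k. \<forall>i<n. \<bar>from_nat_into D k (e i) - h (e i)\<bar> \<le> 1 / Suc n"
        using k by auto
    qed
  qed
qed

section \<open>Losses and errors under a fixed distribution\<close>

lemma prob_dist_on_space:
  assumes "prob_dist_on X P"
  shows "space P = X \<times> {0..1}"
proof -
  have "sets P = sets (count_space X \<Otimes>\<^sub>M restrict_space borel {0..1::real})"
    using assms by (simp add: prob_dist_on_def)
  from sets_eq_imp_space_eq[OF this] show ?thesis
    by (simp add: space_pair_measure space_restrict_space)
qed

lemma loss_measurable:
  fixes f :: "'a \<Rightarrow> real"
  assumes P: "prob_dist_on X P"
  shows "(\<lambda>z. \<bar>f (fst z) - snd z\<bar>) \<in> borel_measurable P"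
proof -
  let ?N = "count_space X \<Otimes>\<^sub>M restrict_space borel {0..1::real}"
  have "(\<lambda>z. f (fst z)) \<in> borel_measurable ?N"
    by (rule measurable_compose[OF measurable_fst]) simp
  moreover have "snd \<in> borel_measurable ?N"
  proof -
    have "(\<lambda>x. x) \<in> borel_measurable (restrict_space borel {0..1::real})"
      by (rule measurable_restrict_space1) simp
    then show ?thesis using measurable_compose[OF measurable_snd] by blast
  qed
  ultimately have "(\<lambda>z. \<bar>f (fst z) - snd z\<bar>) \<in> borel_measurable ?N" by measurable
  moreover have "sets P = sets ?N" using P by (simp add: prob_dist_on_def)
  ultimately show ?thesis using measurable_cong_sets by blast
qed

lemma loss_bounds:
  assumes P: "prob_dist_on X P" and f: "f \<in> X \<rightarrow>\<^sub>E {0..1}" and z: "z \<in> space P"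
  shows "\<bar>f (fst z) - snd z\<bar> \<in> {0..1::real}"
proof -
  have "fst z \<in> X" "snd z \<in> {0..1}" using z prob_dist_on_space[OF P] by auto
  moreover from this have "f (fst z) \<in> {0..1}" using f by auto
  ultimately show ?thesis by auto
qed

lemma loss_integrable:
  assumes P: "prob_dist_on X P" and f: "f \<in> X \<rightarrow>\<^sub>E {0..1}"
  shows "integrable P (\<lambda>z. \<bar>f (fst z) - snd z\<bar> :: real)"
proof -
  interpret prob_space P using P by (simp add: prob_dist_on_def)
  show ?thesis
    using loss_bounds[OF P f] by (intro integrable_const_bound[where B = 1] loss_measurable[OF P]) auto
qed

lemma err_bounds:
  assumes P: "prob_dist_on X P" and f: "f \<in> X \<rightarrow>\<^sub>E {0..1}"
  shows "0 \<le> err P f" "err P f \<le> 1"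
proof -
  interpret prob_space P using P by (simp add: prob_dist_on_def)
  show "0 \<le> err P f" unfolding err_def by simp
  have "err P f \<le> (\<integral>z. 1 \<partial>P)"
    unfolding err_def using loss_bounds[OF P f] by (intro integral_mono loss_integrable[OF P f]) auto
  then show "err P f \<le> 1" using prob_space by simp
qed

lemma err_diff_le:
  assumes P: "prob_dist_on X P" and f: "f \<in> X \<rightarrow>\<^sub>E {0..1}" "f' \<in> X \<rightarrow>\<^sub>E {0..1}"
    and d: "\<And>x. x \<in> X \<Longrightarrow> \<bar>f x - f' x\<bar> \<le> c"
  shows "err P f \<le> err P f' + c"
proof -
  interpret prob_space P using P by (simp add: prob_dist_on_def)
  have "err P f \<le> (\<integral>z. \<bar>f' (fst z) - snd z\<bar> + c \<partial>P)"
    unfolding err_def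
  proof (rule integral_mono)
    fix z assume "z \<in> space P"
    then have "fst z \<in> X" using prob_dist_on_space[OF P] by auto
    from d[OF this] show "\<bar>f (fst z) - snd z\<bar> \<le> \<bar>f' (fst z) - snd z\<bar> + c" by linarith
  qed (use loss_integrable[OF P] f in auto)
  also have "\<dots> = err P f' + c"
    using loss_integrable[OF P f(2)] prob_space by (simp add: err_def)
  finally show ?thesis .
qed

lemma err_pointwise_limit:
  assumes P: "prob_dist_on X P" and f: "\<And>n. f n \<in> X \<rightarrow>\<^sub>E {0..1}"
    and lim: "\<And>x. x \<in> X \<Longrightarrow> (\<lambda>n. f n x) \<longlonglongrightarrow> h x"
  shows "(\<lambda>n. err P (f n)) \<longlonglongrightarrow> err P h"
proof -
  interpret prob_space P using P by (simp add: prob_dist_on_def)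
  show ?thesis
    unfolding err_def
  proof (rule integral_dominated_convergence[where w = "\<lambda>_. 1"])
    show "AE z in P. (\<lambda>n. \<bar>f n (fst z) - snd z\<bar>) \<longlonglongrightarrow> \<bar>h (fst z) - snd z\<bar>"
    proof (rule AE_I2)
      fix z assume "z \<in> space P"
      then have "fst z \<in> X" using prob_dist_on_space[OF P] by auto
      then show "(\<lambda>n. \<bar>f n (fst z) - snd z\<bar>) \<longlonglongrightarrow> \<bar>h (fst z) - snd z\<bar>"
        by (intro tendsto_intros lim)
    qed
    show "AE z in P. norm \<bar>f n (fst z) - snd z\<bar> \<le> 1" for n
      using loss_bounds[OF P f] by (intro AE_I2) auto
  qed (use loss_measurable[OF P] in auto)
qed

lemma Inf_err:
  assumes P: "prob_dist_on X P" and F: "F \<subseteq> X \<rightarrow>\<^sub>E {0..1}" "F \<noteq> {}"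
  shows "(INF f\<in>F. ereal (err P f)) = ereal (INF f\<in>F. err P f)"
    and "bdd_below (err P ` F)"
proof -
  show bdd: "bdd_below (err P ` F)"
    using err_bounds[OF P] F by (intro bdd_belowI2[of _ 0]) auto
  have "ereal (Inf (err P ` F)) = (INF y\<in>err P ` F. ereal y)"
    using F by (intro ereal_Inf' bdd) auto
  then show "(INF f\<in>F. ereal (err P f)) = ereal (INF f\<in>F. err P f)"
    by (simp add: image_image)
qed

lemma constant_learner:
  assumes h: "h \<in> X \<rightarrow>\<^sub>E {0..1}" and \<delta>: "0 < \<delta>"
    and good: "\<And>P. prob_dist_on X P \<Longrightarrow> ereal (err P h) < (INF f\<in>F. ereal (err P f)) + ereal \<epsilon>"
  shows "\<exists>A\<in>learners X. agnostic_learns X F A \<epsilon> \<delta> 0"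
proof (rule bexI)
  show "(\<lambda>_. h) \<in> learners X" using h by (auto simp: learners_def)
  show "agnostic_learns X F (\<lambda>_. h) \<epsilon> \<delta> 0"
    unfolding agnostic_learns_def
  proof (intro allI impI)
    fix P assume "prob_dist_on X P"
    from good[OF this] have "failure_event F (\<lambda>_. h) \<epsilon> 0 P = {}"
      by (auto simp: failure_event_def not_le[symmetric])
    then show "failure_event F (\<lambda>_. h) \<epsilon> 0 P \<in> sets (Pi\<^sub>M {..<0} (\<lambda>i. P)) \<and>
        measure (Pi\<^sub>M {..<0} (\<lambda>i. P)) (failure_event F (\<lambda>_. h) \<epsilon> 0 P) < \<delta>"
      using \<delta> by simp
  qed
qed

text \<open>Of the \<open>5 * s\<close>, four parts come from \<open>empirical_minimizer\<close> and
  one from comparing with a member of the dense sequence instead of the infimum over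
  \<open>F\<close>.\<close>

lemma learner_from_covers:
  fixes X :: "'a set" and F :: "('a \<Rightarrow> real) set" and s \<alpha> \<epsilon> \<delta> :: real and m M :: nat
  assumes X: "countable X" "X \<noteq> {}" and F: "F \<subseteq> X \<rightarrow>\<^sub>E {0..1}" "F \<noteq> {}"
    and m: "0 < m" and s: "0 < s" "s \<le> 1" "exp (- (2 * m * s\<^sup>2)) \<le> 1 / 2" and \<alpha>: "0 \<le> \<alpha>"
    and pack: "\<And>x H. x \<in> {..<2 * m} \<rightarrow> X \<Longrightarrow> H \<subseteq> F \<Longrightarrow> finite H \<Longrightarrow> l1_separated (2 * m) x \<alpha> H \<Longrightarrow> card H \<le> M"
    and \<epsilon>: "2 * \<alpha> + 5 * s \<le> \<epsilon>" and \<delta>: "(2 * M + 1) * exp (- (m * s\<^sup>2 / 4)) < \<delta>"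
  shows "\<exists>A\<in>learners X. agnostic_learns X F A \<epsilon> \<delta> m"
proof -
  define e where "e = from_nat_into X"
  have e: "range e = X" unfolding e_def using X by (simp add: range_from_nat_into)
  obtain f :: "nat \<Rightarrow> 'a \<Rightarrow> real" where fF: "range f \<subseteq> F"
    and dense: "\<forall>h\<in>F. \<forall>n. \<exists>k. \<forall>i<n. \<bar>f k (e i) - h (e i)\<bar> \<le> 1 / Suc n"
    by (rule countable_pointwise_dense[OF F(2), of e])
  have f: "f k \<in> X \<rightarrow>\<^sub>E {0..1}" for k using fF F by auto
  define pick :: "('a \<times> real) list \<Rightarrow> nat" where
    "pick zs = (LEAST k. \<forall>j. (\<Sum>z\<leftarrow>zs. \<bar>f k (fst z) - snd z\<bar>) \<le> (\<Sum>z\<leftarrow>zs. \<bar>f j (fst z) - snd z\<bar>) + m * s)" for zs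
  define A where "A zs = f (pick zs)" for zs
  have "A \<in> learners X" unfolding learners_def A_def using f by auto
  moreover have "agnostic_learns X F A \<epsilon> \<delta> m"
    unfolding agnostic_learns_def
  proof (intro allI impI)
    fix P assume PX: "prob_dist_on X P"
    then have P: "prob_space P" by (simp add: prob_dist_on_def)
    let ?M = "Pi\<^sub>M {..<m} (\<lambda>_. P)"
    define l where "l k z = \<bar>f k (fst z) - snd z\<bar>" for k and z :: "'a \<times> real"
    define K where "K w = (LEAST k. \<forall>j. (\<Sum>i<m. l k (w i)) \<le> (\<Sum>i<m. l j (w i)) + m * s)" for w
    have AK: "A (map w [0..<m]) = f (K w)" for w
    proof -
      have "(\<Sum>z\<leftarrow>map w [0..<m]. \<bar>f k (fst z) - snd z\<bar>) = (\<Sum>i<m. l k (w i))" for k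
        by (simp add: l_def comp_def interv_sum_list_conv_sum_set_nat lessThan_atLeast0)
      then show ?thesis unfolding A_def pick_def K_def by simp
    qed
    have l: "l k \<in> borel_measurable P" for k
      unfolding l_def by (rule loss_measurable[OF PX])
    have bd: "l k z \<in> {0..1}" if "z \<in> space P" for k z
      unfolding l_def by (rule loss_bounds[OF PX f that])
    have int: "integral\<^sup>L P (l k) = err P (f k)" for k unfolding err_def l_def ..
    have cover: "\<exists>G. finite G \<and> card G \<le> M \<and> (\<forall>k. \<exists>g\<in>G. (\<Sum>i<2 * m. \<bar>l k (w i) - l g (w i)\<bar>) \<le> 2 * m * \<alpha>)"
      if w: "w \<in> space (PiM {..<2 * m} (\<lambda>_. P))" for w
    proof -
      define x where "x i = fst (w i)" for i
      have x: "x \<in> {..<2 * m} \<rightarrow> X"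
        using w prob_dist_on_space[OF PX] by (auto simp: x_def space_PiM PiE_iff mem_Times_iff)
      obtain H where H: "H \<subseteq> range f" "finite H" "card H \<le> M"
        and near: "\<And>h'. h' \<in> range f \<Longrightarrow> \<exists>h\<in>H. (\<Sum>i<2 * m. \<bar>h' (x i) - h (x i)\<bar>) \<le> (2 * m) * \<alpha>"
      proof (rule l1_cover[of "range f" "2 * m" x \<alpha> M])
        show "card H \<le> M" if "H \<subseteq> range f" "finite H" "l1_separated (2 * m) x \<alpha> H" for H
          using pack[OF x _ that(2,3)] that(1) fF by blast
      qed (use \<alpha> in auto)
      define idx where "idx h = (SOME k. f k = h)" for h
      have idx: "f (idx h) = h" if "h \<in> H" for h
      proof -
        have "\<exists>k. f k = h" using that H(1) by auto
        then show ?thesis unfolding idx_def by (rule someI_ex)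
      qed
      show ?thesis
      proof (intro exI[of _ "idx ` H"] conjI allI)
        show "finite (idx ` H)" using H by simp
        show "card (idx ` H) \<le> M" using H card_image_le[of H idx] by linarith
        fix k
        obtain h where h: "h \<in> H" "(\<Sum>i<2 * m. \<bar>f k (x i) - h (x i)\<bar>) \<le> (2 * m) * \<alpha>"
          using near[of "f k"] by auto
        \<comment> \<open>Both losses use the same label, so a cover for the functions is one for
          the losses.\<close>
        have "(\<Sum>i<2 * m. \<bar>l k (w i) - l (idx h) (w i)\<bar>) \<le> (\<Sum>i<2 * m. \<bar>f k (x i) - h (x i)\<bar>)"
          unfolding l_def x_def idx[OF h(1)] by (intro sum_mono) linarith
        then show "\<exists>g\<in>idx ` H. (\<Sum>i<2 * m. \<bar>l k (w i) - l g (w i)\<bar>) \<le> 2 * m * \<alpha>"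
          using h by (intro bexI[of _ "idx h"]) auto
      qed
    qed
    define v where "v = (INF h\<in>F. err P h)"
    have inf: "(INF h\<in>F. ereal (err P h)) = ereal v"
      unfolding v_def by (rule Inf_err(1)[OF PX F])
    obtain k0 where k0: "err P (f k0) < v + s"
    proof -
      have "v < v + s" using s by simp
      then obtain h where h: "h \<in> F" "err P h < v + s"
        unfolding v_def using Inf_err(2)[OF PX F] F(2) by (subst (asm) cInf_less_iff) auto
      obtain c where c: "\<And>n i. i < n \<Longrightarrow> \<bar>f (c n) (e i) - h (e i)\<bar> \<le> 1 / Suc n"
        using dense[rule_format, OF h(1)] by metis
      \<comment> \<open>Closeness on the first \<open>n\<close> points up to
        \<open>1 / Suc n\<close> gives pointwise convergence on \<open>X\<close>, and since losses
        are bounded the errors converge as well.\<close>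
      have "(\<lambda>n. err P (f (c n))) \<longlonglongrightarrow> err P h"
      proof (rule err_pointwise_limit[OF PX f])
        fix y assume "y \<in> X"
        then obtain i where i: "y = e i" using e by auto
        have "(\<lambda>n. f (c n) (e i) - h (e i)) \<longlonglongrightarrow> 0"
        proof (rule Lim_null_comparison)
          show "\<forall>\<^sub>F n in sequentially. norm (f (c n) (e i) - h (e i)) \<le> 1 / Suc n"
            using eventually_gt_at_top[of i] by eventually_elim (use c in auto)
          show "(\<lambda>n. 1 / real (Suc n)) \<longlonglongrightarrow> 0"
            using LIMSEQ_Suc[OF lim_1_over_n] by simp
        qed
        then show "(\<lambda>n. f (c n) y) \<longlonglongrightarrow> h y" unfolding i by (simp add: LIM_zero_iff)
      qed
      from order_tendstoD(2)[OF this h(2)] obtain n where "err P (f (c n)) < v + s"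
        by (auto simp: eventually_sequentially)
      then show ?thesis by (rule that)
    qed
    have fail: "failure_event F A \<epsilon> m P = {w\<in>space ?M. v + \<epsilon> \<le> err P (f (K w))}"
      unfolding failure_event_def inf AK by simp
    have K: "K \<in> measurable ?M (count_space UNIV)"
      unfolding K_def by (rule empirical_minimizer(1)[OF P m l bd s cover])
    have vset: "{w\<in>space ?M. v + \<epsilon> \<le> err P (f (K w))} = K -` {k. v + \<epsilon> \<le> err P (f k)} \<inter> space ?M"
      by auto
    have meas: "failure_event F A \<epsilon> m P \<in> sets ?M"
      unfolding fail vset using K by (rule measurable_sets) simp
    interpret prob_space ?M using P by (intro prob_space_PiM)
    have Kset: "{w\<in>space ?M. err P (f k0) + 2 * \<alpha> + 4 * s \<le> err P (f (K w))}
        = K -` {k. err P (f k0) + 2 * \<alpha> + 4 * s \<le> err P (f k)} \<inter> space ?M" by auto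
    have "measure ?M (failure_event F A \<epsilon> m P)
      \<le> measure ?M {w\<in>space ?M. err P (f k0) + 2 * \<alpha> + 4 * s \<le> err P (f (K w))}"
    proof (rule finite_measure_mono)
      show "{w\<in>space ?M. err P (f k0) + 2 * \<alpha> + 4 * s \<le> err P (f (K w))} \<in> sets ?M"
        unfolding Kset using K by (rule measurable_sets) simp
    qed (use fail k0 \<epsilon> in auto)
    also have "\<dots> \<le> (2 * M + 1) * exp (- (m * s\<^sup>2 / 4))"
      using empirical_minimizer(2)[OF P m l bd s cover, of k0] unfolding K_def[symmetric] int .
    also have "\<dots> < \<delta>" by (rule \<delta>)
    finally show "failure_event F A \<epsilon> m P \<in> sets ?M \<and> measure ?M (failure_event F A \<epsilon> m P) < \<delta>"
      using meas by simp
  qed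
  ultimately show ?thesis by blast
qed

lemma learner_from_packing:
  fixes X :: "'a set" and F :: "('a \<Rightarrow> real) set" and \<kappa> \<epsilon> \<delta> B :: real
  assumes X: "countable X" "X \<noteq> {}" and F: "F \<subseteq> X \<rightarrow>\<^sub>E {0..1}" "F \<noteq> {}"
    and \<kappa>: "0 < \<kappa>" "\<kappa> < 1 / 4" and \<epsilon>: "0 < \<epsilon>" "\<epsilon> < 1" and \<delta>: "0 < \<delta>" "\<delta> < 1" and B: "0 \<le> B"
    and pack: "\<And>N x H. 0 < N \<Longrightarrow> x \<in> {..<N} \<rightarrow> X \<Longrightarrow> H \<subseteq> F \<Longrightarrow> finite H \<Longrightarrow>
      l1_separated N x ((1 / 2 - \<kappa>) * \<epsilon>) H \<Longrightarrow> ln (card H) \<le> B"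
  shows "\<exists>A\<in>learners X. \<exists>m :: nat. real m \<le> 25 / (\<kappa>\<^sup>2 * \<epsilon>\<^sup>2) * (3 + B + ln (1 / \<delta>)) \<and> agnostic_learns X F A \<epsilon> \<delta> m"
proof -
  \<comment> \<open>Solves \<open>2 * \<alpha> + 5 * s = \<epsilon>\<close> for
    \<open>\<alpha> = (1 / 2 - \<kappa>) * \<epsilon>\<close>; then \<open>4 / s\<^sup>2\<close> is
    the prefactor \<open>25 / (\<kappa>\<^sup>2 * \<epsilon>\<^sup>2)\<close>.\<close>
  define s where "s = 2 * \<kappa> * \<epsilon> / 5"
  define M where "M = nat \<lfloor>exp B\<rfloor>"
  define L where "L = ln (2 * real M + 1) + ln (1 / \<delta>)"
  define m where "m = nat \<lfloor>4 / s\<^sup>2 * L\<rfloor> + 1"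
  have ke: "\<kappa> * \<epsilon> < 1" using \<kappa> \<epsilon> mult_strict_mono[of \<kappa> 1 \<epsilon> 1] by simp
  have s: "0 < s" "s \<le> 1" unfolding s_def using \<kappa> \<epsilon> ke by auto
  have M: "1 \<le> M" "real M \<le> exp B"
  proof -
    have "1 \<le> exp B" using B by simp
    then have "1 \<le> \<lfloor>exp B\<rfloor>" by simp
    then show "1 \<le> M" unfolding M_def by linarith
    show "real M \<le> exp B" unfolding M_def by simp
  qed
  have lnd: "0 \<le> ln (1 / \<delta>)" using \<delta> by simp
  have "1 \<le> ln (2 * real M + 1)"
  proof -
    have "exp 1 \<le> 2 * real M + 1" using exp_le M(1) by linarith
    then show ?thesis using M(1) by (subst ln_ge_iff) auto
  qed
  then have L: "1 \<le> L" unfolding L_def using lnd by linarith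
  have mL: "4 / s\<^sup>2 * L < m" unfolding m_def using L s by linarith
  have msL: "L < m * s\<^sup>2 / 4" using mL s by (simp add: field_simps)
  have "\<exists>A\<in>learners X. agnostic_learns X F A \<epsilon> \<delta> m"
  proof (rule learner_from_covers[OF X F, of m s "(1 / 2 - \<kappa>) * \<epsilon>" M])
    show "0 < m" unfolding m_def by simp
    have "exp (- (2 * m * s\<^sup>2)) \<le> exp (- 1)" using msL L by simp
    also have "\<dots> \<le> (1 / 2 :: real)"
      using exp_ge_add_one_self[of 1] by (simp add: exp_minus field_simps)
    finally show "exp (- (2 * m * s\<^sup>2)) \<le> 1 / 2" .
    show "0 \<le> (1 / 2 - \<kappa>) * \<epsilon>" using \<kappa> \<epsilon> by simp
    show "2 * ((1 / 2 - \<kappa>) * \<epsilon>) + 5 * s \<le> \<epsilon>" unfolding s_def by (simp add: algebra_simps)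
    show "(2 * M + 1) * exp (- (m * s\<^sup>2 / 4)) < \<delta>"
    proof -
      have "exp (- (m * s\<^sup>2 / 4)) < exp (- L)" using msL by simp
      also have "exp (- L) = \<delta> / (2 * real M + 1)"
        unfolding L_def using \<delta> by (simp add: exp_minus exp_add exp_diff ln_div)
      finally show ?thesis by (simp add: field_simps)
    qed
    show "card H \<le> M" if H: "x \<in> {..<2 * m} \<rightarrow> X" "H \<subseteq> F" "finite H"
        "l1_separated (2 * m) x ((1 / 2 - \<kappa>) * \<epsilon>) H" for x H
    proof (cases "card H = 0")
      case False
      have "ln (card H) \<le> B" using H by (intro pack[of "2 * m"]) (auto simp: m_def)
      then have "exp (ln (card H)) \<le> exp B" by simp
      then have "real (card H) \<le> exp B" using False by simp
      then show ?thesis unfolding M_def by linarith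
    qed simp
  qed (use s in auto)
  \<comment> \<open>The 3 is made up of 2, which bounds \<open>ln 3\<close>, and 1 for rounding
    \<open>m\<close> up, as the prefactor is at least 1.\<close>
  moreover have "real m \<le> 25 / (\<kappa>\<^sup>2 * \<epsilon>\<^sup>2) * (3 + B + ln (1 / \<delta>))"
  proof -
    have c: "4 / s\<^sup>2 = 25 / (\<kappa>\<^sup>2 * \<epsilon>\<^sup>2)" unfolding s_def by (simp add: power_mult_distrib power_divide field_simps)
    have "(\<kappa> * \<epsilon>)\<^sup>2 \<le> 1" using ke \<kappa> \<epsilon> by (simp add: power_le_one)
    then have c1: "1 \<le> 4 / s\<^sup>2"
      unfolding c using \<kappa> \<epsilon> by (simp add: power_mult_distrib le_divide_eq)
    have "ln (2 * real M + 1) \<le> ln (3 * exp B)"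
      using M by (subst ln_le_cancel_iff) auto
    also have "\<dots> = ln 3 + B" by (simp add: ln_mult)
    also have "ln 3 \<le> (2 :: real)" using ln_le_minus_one[of 3] by simp
    finally have "L \<le> 2 + B + ln (1 / \<delta>)" unfolding L_def by linarith
    then have "4 / s\<^sup>2 * L \<le> 4 / s\<^sup>2 * (2 + B + ln (1 / \<delta>))"
      using s by (intro mult_left_mono) auto
    moreover have "real m \<le> 4 / s\<^sup>2 * L + 1" unfolding m_def using L s by simp
    ultimately have "real m \<le> 4 / s\<^sup>2 * (2 + B + ln (1 / \<delta>)) + 4 / s\<^sup>2 * 1" using c1 by linarith
    also have "\<dots> = 4 / s\<^sup>2 * (3 + B + ln (1 / \<delta>))" by (simp only: distrib_left[symmetric]) simp
    finally show ?thesis unfolding c .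
  qed
  ultimately show ?thesis by blast
qed

section \<open>Cases settled without samples\<close>

lemma one_point_spread:
  assumes F: "F \<subseteq> X \<rightarrow>\<^sub>E {0..1}" and f: "f \<in> F" "f' \<in> F" and x: "x \<in> X" and d: "2 * \<gamma> \<le> f x - f' x"
  shows "fatly_shatters X F \<gamma> (map (\<lambda>y. (y, (f x + f' x) / 2)) [x])" "(f x + f' x) / 2 \<in> {0..1}"
proof -
  have "f \<in> X \<rightarrow>\<^sub>E {0..1}" "f' \<in> X \<rightarrow>\<^sub>E {0..1}" using F f by blast+
  then have "f x \<in> {0..1}" "f' x \<in> {0..1}" using x by (blast intro: PiE_mem)+
  then show r: "(f x + f' x) / 2 \<in> {0..1}" by auto
  show "fatly_shatters X F \<gamma> (map (\<lambda>y. (y, (f x + f' x) / 2)) [x])"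
    unfolding fatly_shatters_def
  proof (intro conjI allI impI)
    show "set (map (\<lambda>y. (y, (f x + f' x) / 2)) [x]) \<subseteq> X \<times> {0..1}" using x r by auto
    fix b :: "bool list"
    have "f x \<ge> (f x + f' x) / 2 + \<gamma>" "f' x \<le> (f x + f' x) / 2 - \<gamma>"
      using d by (auto simp: field_simps)
    then show "\<exists>h\<in>F. \<forall>j<length (map (\<lambda>y. (y, (f x + f' x) / 2)) [x]).
           (b ! j \<longrightarrow> snd (map (\<lambda>y. (y, (f x + f' x) / 2)) [x] ! j) + \<gamma>
              \<le> h (fst (map (\<lambda>y. (y, (f x + f' x) / 2)) [x] ! j))) \<and>
           (\<not> b ! j \<longrightarrow> h (fst (map (\<lambda>y. (y, (f x + f' x) / 2)) [x] ! j))
              \<le> snd (map (\<lambda>y. (y, (f x + f' x) / 2)) [x] ! j) - \<gamma>)"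
      using f by (cases "b ! 0") (auto intro: bexI[of _ f] bexI[of _ f'])
  qed
qed

text \<open>
  Here \<open>D\<close> is either of the two dimensions at scale \<open>\<gamma>\<close>: both bound the length of shattered
  sequences with a constant threshold, and single points suffice when \<open>D = 0\<close>. For \<open>\<gamma> \<le> 0\<close>
  repeating one point shatters arbitrarily long sequences, so that case is void.
\<close>

lemma learner_without_samples:
  fixes X :: "'a set" and F :: "('a \<Rightarrow> real) set" and \<gamma> \<epsilon> \<delta> :: real and D :: enat
  assumes F: "F \<subseteq> X \<rightarrow>\<^sub>E {0..1}" and \<epsilon>: "0 < \<epsilon>" and \<delta>: "0 < \<delta>" and \<gamma>: "2 * \<gamma> < \<epsilon>"
    and len: "\<And>xs r. fatly_shatters X F \<gamma> (map (\<lambda>x. (x, r)) xs) \<Longrightarrow> r \<in> {0..1} \<Longrightarrow> length xs \<le> the_enat D"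
    and triv: "1 / 2 < \<epsilon> \<or> F = {} \<or> X = {} \<or> \<gamma> \<le> 0 \<or> the_enat D = 0"
  shows "\<exists>A\<in>learners X. agnostic_learns X F A \<epsilon> \<delta> 0"
proof -
  consider "F = {}" | "X = {}" | "F \<noteq> {}" "1 / 2 < \<epsilon>" | "F \<noteq> {}" "X \<noteq> {}" "\<gamma> \<le> 0"
    | "F \<noteq> {}" "the_enat D = 0"
    using triv by argo
  then show ?thesis
  proof cases
    case 1
    show ?thesis
    proof (rule constant_learner[OF _ \<delta>])
      show "restrict (\<lambda>_. 0 :: real) X \<in> X \<rightarrow>\<^sub>E {0..1}" by auto
    qed (simp add: 1 top_ereal_def)
  next
    case 2
    show ?thesis
    proof (rule constant_learner[OF _ \<delta>])
      show "restrict (\<lambda>_. 0 :: real) X \<in> X \<rightarrow>\<^sub>E {0..1}" by auto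
      fix P assume P: "prob_dist_on X P"
      then interpret prob_space P by (simp add: prob_dist_on_def)
      show "ereal (err P (restrict (\<lambda>_. 0) X)) < (INF f\<in>F. ereal (err P f)) + ereal \<epsilon>"
        \<comment> \<open>There is no probability distribution on an empty space.\<close>
        using not_empty prob_dist_on_space[OF P] 2 by simp
    qed
  next
    case 3
    let ?h = "restrict (\<lambda>_. 1 / 2) X :: 'a \<Rightarrow> real"
    show ?thesis
    proof (rule constant_learner[OF _ \<delta>])
      show h: "?h \<in> X \<rightarrow>\<^sub>E {0..1}" by auto
      fix P assume P: "prob_dist_on X P"
      then interpret prob_space P by (simp add: prob_dist_on_def)
      have "err P ?h \<le> (\<integral>z. 1 / 2 \<partial>P)"
        unfolding err_def
      proof (rule integral_mono)
        fix z assume "z \<in> space P"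
        then have "fst z \<in> X" "snd z \<in> {0..1}" using prob_dist_on_space[OF P] by auto
        then have "?h (fst z) = 1 / 2" "0 \<le> snd z" "snd z \<le> 1" by auto
        then show "\<bar>?h (fst z) - snd z\<bar> \<le> 1 / 2" by linarith
      qed (use loss_integrable[OF P h] in auto)
      then have "err P ?h < \<epsilon>" using prob_space 3 by simp
      moreover have "0 \<le> (INF f\<in>F. err P f)"
        using 3 F err_bounds[OF P] by (intro cINF_greatest) auto
      ultimately show "ereal (err P ?h) < (INF f\<in>F. ereal (err P f)) + ereal \<epsilon>"
        unfolding Inf_err(1)[OF P F 3(1)] by simp
    qed
  next
    case 4
    then obtain x f where xf: "x \<in> X" "f \<in> F" by blast
    have "f x \<in> {0..1}" using xf F by (blast intro: PiE_mem)
    have "fatly_shatters X F \<gamma> (map (\<lambda>x. (x, f x)) (replicate n x))" for n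
      using 4 xf \<open>f x \<in> {0..1}\<close> unfolding fatly_shatters_def by (auto intro!: bexI[of _ f])
    then have "fatly_shatters X F \<gamma> (map (\<lambda>y. (y, f x)) (replicate n x))" for n
      by (simp only: map_replicate)
    from len[OF this \<open>f x \<in> {0..1}\<close>, of "Suc (the_enat D)"] show ?thesis by simp
  next
    case 5
    then obtain h where h: "h \<in> F" by auto
    show ?thesis
    proof (rule constant_learner[OF _ \<delta>])
      show h': "h \<in> X \<rightarrow>\<^sub>E {0..1}" using h F by auto
      \<comment> \<open>In dimension 0 not even a single point is shattered with the midpoint as
        threshold, so all functions agree up to \<open>2 * \<gamma>\<close> and any fixed one of
        them will do.\<close>
      have near: "\<bar>h x - f x\<bar> \<le> 2 * \<gamma>" if "x \<in> X" "f \<in> F" for x f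
      proof (rule ccontr)
        assume "\<not> ?thesis"
        then have "2 * \<gamma> \<le> h x - f x \<or> 2 * \<gamma> \<le> f x - h x" by linarith
        then have "\<exists>r\<in>{0..1}. fatly_shatters X F \<gamma> (map (\<lambda>x. (x, r)) [x])"
          using one_point_spread[OF F h that(2,1)] one_point_spread[OF F that(2) h that(1)] by blast
        then obtain r where r: "r \<in> {0..1}" "fatly_shatters X F \<gamma> (map (\<lambda>x. (x, r)) [x])" by blast
        from len[OF r(2,1)] 5(2) show False by simp
      qed
      fix P assume P: "prob_dist_on X P"
      have "err P h - 2 * \<gamma> \<le> (INF f\<in>F. err P f)"
      proof (rule cINF_greatest[OF 5(1)])
        fix f assume f: "f \<in> F"
        then have "f \<in> X \<rightarrow>\<^sub>E {0..1}" using F by auto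
        from err_diff_le[OF P h' this near[OF _ f]] show "err P h - 2 * \<gamma> \<le> err P f" by simp
      qed
      then have "err P h < (INF f\<in>F. err P f) + \<epsilon>" using \<gamma> by linarith
      then show "ereal (err P h) < (INF f\<in>F. ereal (err P f)) + ereal \<epsilon>"
        unfolding Inf_err(1)[OF P F 5(1)] by simp
    qed
  qed
qed

section \<open>Choice of parameters and absorption of constants\<close>

lemma scale_parameters:
  fixes \<kappa> \<epsilon> :: real
  assumes \<kappa>: "0 < \<kappa>" "\<kappa> < 1 / 4" and \<epsilon>: "0 < \<epsilon>" "\<epsilon> < 1"
  defines "\<eta> \<equiv> \<kappa> * ((1 / 2 - \<kappa>) * \<epsilon>) / 2"
  defines "b \<equiv> nat \<lfloor>1 / \<eta>\<rfloor>" and "g \<equiv> nat \<lceil>(1 / 4 - \<kappa>) * \<epsilon> / \<eta>\<rceil>"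
  shows "0 < \<eta>" "(2 * real g + 2) * \<eta> \<le> (1 / 2 - \<kappa>) * \<epsilon>" "(1 / 4 - \<kappa>) * \<epsilon> \<le> g * \<eta>"
    "1 \<le> b" "real b + 1 \<le> 16 / (\<kappa> * \<epsilon>)"
proof -
  define \<alpha> where "\<alpha> = (1 / 2 - \<kappa>) * \<epsilon>"
  define \<gamma> where "\<gamma> = (1 / 4 - \<kappa>) * \<epsilon>"
  have \<alpha>: "0 < \<alpha>" "\<epsilon> / 4 \<le> \<alpha>" "\<alpha> \<le> 1" and \<gamma>: "0 < \<gamma>"
    unfolding \<alpha>_def \<gamma>_def using \<kappa> \<epsilon> mult_mono[of "1 / 2 - \<kappa>" 1 \<epsilon> 1] by (auto simp: field_simps)
  have \<eta>_eq: "\<eta> = \<kappa> * \<alpha> / 2" unfolding \<eta>_def \<alpha>_def ..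
  show \<eta>: "0 < \<eta>" unfolding \<eta>_eq using \<kappa> \<alpha> by simp
  have "real g = of_int \<lceil>\<gamma> / \<eta>\<rceil>" unfolding g_def \<gamma>_def[symmetric] using \<gamma> \<eta> by simp
  then have g: "\<gamma> / \<eta> \<le> g" "g < \<gamma> / \<eta> + 1" by linarith+
  show "(1 / 4 - \<kappa>) * \<epsilon> \<le> g * \<eta>" using g(1) \<eta> unfolding \<gamma>_def by (simp add: divide_le_eq)
  \<comment> \<open>The square of \<open>1 / 2 - \<kappa>\<close> exceeds
    \<open>1 / 4 - \<kappa>\<close> by \<open>\<kappa>\<^sup>2\<close>, so \<gamma> fits below
    \<open>(1 / 2 - \<kappa>) * \<alpha>\<close>. Doubled, this stays
    \<open>2 * \<kappa> * \<alpha> = 4 * \<eta>\<close> below \<alpha>: two \<eta> for rounding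
    \<open>g\<close> up and two for the \<open>+ 2\<close>.\<close>
  have "(1 / 2 - \<kappa>) * \<alpha> - \<gamma> = \<kappa>\<^sup>2 * \<epsilon>"
    unfolding \<alpha>_def \<gamma>_def by (simp add: field_simps power2_eq_square)
  then have "\<gamma> \<le> (1 / 2 - \<kappa>) * \<alpha>" using \<epsilon> by (smt (verit) mult_nonneg_nonneg zero_le_power2)
  moreover have "g * \<eta> < \<gamma> + \<eta>" using g(2) \<eta> by (simp add: field_simps)
  moreover have "(2 * real g + 2) * \<eta> = 2 * (g * \<eta>) + 2 * \<eta>" by (simp add: algebra_simps)
  moreover have "2 * ((1 / 2 - \<kappa>) * \<alpha>) + 4 * \<eta> = \<alpha>" unfolding \<eta>_eq by (simp add: algebra_simps)
  ultimately have "(2 * real g + 2) * \<eta> \<le> \<alpha>" by linarith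
  then show "(2 * real g + 2) * \<eta> \<le> (1 / 2 - \<kappa>) * \<epsilon>" unfolding \<alpha>_def .
  have "\<kappa> * \<alpha> \<le> 1 * 1" using \<kappa> \<alpha> by (intro mult_mono) auto
  then have e1: "1 \<le> 1 / \<eta>" using \<eta> unfolding \<eta>_eq by (simp add: field_simps)
  then have "1 \<le> \<lfloor>1 / \<eta>\<rfloor>" by simp
  then show "1 \<le> b" unfolding b_def by linarith
  have "real b \<le> 1 / \<eta>" unfolding b_def using \<eta> by (intro of_nat_floor) simp
  then have "real b + 1 \<le> 2 / \<eta>" using e1 by simp
  also have "\<dots> = 4 / (\<kappa> * \<alpha>)" unfolding \<eta>_eq by simp
  also have "\<dots> \<le> 4 / (\<kappa> * (\<epsilon> / 4))" using \<kappa> \<epsilon> \<alpha> by (intro divide_left_mono mult_left_mono) auto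
  finally show "real b + 1 \<le> 16 / (\<kappa> * \<epsilon>)" by simp
qed

text \<open>For \<open>\<epsilon> \<le> 1 / 2\<close> the factor \<open>ln (1 / \<epsilon>)\<close>
  is at least \<open>1 / 2\<close>, so additive constants and logarithms of \<kappa> can be absorbed
  into multiples of it. The number 4096 is \<open>16 ^ 3\<close>, from the 16 in the logarithm and
  two factors of at most \<open>16 / (\<kappa> * \<epsilon>)\<close>.\<close>

lemma fat_sample_bound:
  fixes \<kappa> \<epsilon> \<Lambda> :: real and b d :: nat
  assumes \<kappa>: "0 < \<kappa>" "\<kappa> < 1 / 4" and \<epsilon>: "0 < \<epsilon>" "\<epsilon> \<le> 1 / 2" and d: "1 \<le> d" and \<Lambda>: "0 \<le> \<Lambda>"
    and b: "1 \<le> b" "real b + 1 \<le> 16 / (\<kappa> * \<epsilon>)"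
  shows "25 / (\<kappa>\<^sup>2 * \<epsilon>\<^sup>2) * (3 + 21 * d * (ln (16 * b * (b + 1)))\<^sup>2 + \<Lambda>)
    \<le> 25 / \<kappa>\<^sup>2 * (13 + 21 * (2 * ln (4096 / \<kappa>\<^sup>2) + 2)\<^sup>2) * (1 / \<epsilon>\<^sup>2 * (d * (ln (1 / \<epsilon>))\<^sup>2 + \<Lambda>))"
proof -
  define L where "L = ln (1 / \<epsilon>)"
  define c where "c = 2 * ln (4096 / \<kappa>\<^sup>2) + 2"
  have L: "1 / 2 \<le> L"
  proof -
    have "ln 2 \<le> L" unfolding L_def using \<epsilon> by (subst ln_le_cancel_iff) (auto simp: field_simps)
    then show ?thesis using ln2_ge_two_thirds by linarith
  qed
  have "\<kappa>\<^sup>2 \<le> 1" using \<kappa> by (simp add: power_le_one)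
  then have lk: "0 \<le> ln (4096 / \<kappa>\<^sup>2)" using \<kappa> by (intro ln_ge_zero) (simp add: le_divide_eq)
  have "16 * real b * (real b + 1) \<le> 16 * (16 / (\<kappa> * \<epsilon>)) * (16 / (\<kappa> * \<epsilon>))"
    using b \<kappa> \<epsilon> by (intro mult_mono) auto
  also have "\<dots> = (4096 / \<kappa>\<^sup>2) * ((1 / \<epsilon>) * (1 / \<epsilon>))" using \<kappa> \<epsilon> by (simp add: power2_eq_square)
  finally have le: "16 * real b * (real b + 1) \<le> (4096 / \<kappa>\<^sup>2) * ((1 / \<epsilon>) * (1 / \<epsilon>))" .
  have one: "1 \<le> 16 * real b * (real b + 1)"
    using mult_mono[of 1 "16 * real b" 1 "real b + 1"] b(1) by simp
  have "ln (16 * real b * (real b + 1)) \<le> ln ((4096 / \<kappa>\<^sup>2) * ((1 / \<epsilon>) * (1 / \<epsilon>)))"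
    using le one \<kappa> \<epsilon> by (subst ln_le_cancel_iff) auto
  also have "\<dots> = ln (4096 / \<kappa>\<^sup>2) + 2 * L"
    unfolding L_def using \<kappa> \<epsilon> by (simp add: ln_mult ln_div)
  also have "\<dots> \<le> c * L"
  proof -
    have "ln (4096 / \<kappa>\<^sup>2) * 1 \<le> ln (4096 / \<kappa>\<^sup>2) * (2 * L)" using L lk by (intro mult_left_mono) auto
    then show ?thesis unfolding c_def by (simp add: algebra_simps)
  qed
  finally have "ln (16 * real b * (real b + 1)) \<le> c * L" .
  then have "(ln (16 * real b * (real b + 1)))\<^sup>2 \<le> (c * L)\<^sup>2"
    using one by (intro power_mono) auto
  then have "21 * real d * (ln (16 * real b * (real b + 1)))\<^sup>2 \<le> 21 * real d * (c * L)\<^sup>2"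
    by (intro mult_left_mono) auto
  moreover have "3 \<le> 12 * (d * L\<^sup>2)"
  proof -
    have "(1 / 2)\<^sup>2 \<le> L\<^sup>2" using L by (intro power_mono) auto
    then have "1 * (1 / 4) \<le> real d * L\<^sup>2" using d by (intro mult_mono) (auto simp: power2_eq_square)
    then show ?thesis by simp
  qed
  moreover have "1 * \<Lambda> \<le> (13 + 21 * c\<^sup>2) * \<Lambda>" using \<Lambda> by (intro mult_right_mono) auto
  moreover have "0 \<le> d * L\<^sup>2" by simp
  ultimately have "3 + 21 * d * (ln (16 * real b * (real b + 1)))\<^sup>2 + \<Lambda> \<le> (13 + 21 * c\<^sup>2) * (d * L\<^sup>2 + \<Lambda>)"
    by (simp add: algebra_simps power_mult_distrib)
  then have "25 / (\<kappa>\<^sup>2 * \<epsilon>\<^sup>2) * (3 + 21 * d * (ln (16 * real b * (real b + 1)))\<^sup>2 + \<Lambda>)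
      \<le> 25 / (\<kappa>\<^sup>2 * \<epsilon>\<^sup>2) * ((13 + 21 * c\<^sup>2) * (d * L\<^sup>2 + \<Lambda>))"
    by (intro mult_left_mono) auto
  then show ?thesis unfolding c_def L_def by (simp add: mult_ac add_ac)
qed

text \<open>The same absorption, where \<open>4 * (b + 1)\<close> is at most
  \<open>64 / (\<kappa> * \<epsilon>)\<close> and so supplies the additional
  \<open>1 / \<epsilon>\<close>.\<close>

lemma fatV_sample_bound:
  fixes \<kappa> \<epsilon> \<Lambda> :: real and b d :: nat
  assumes \<kappa>: "0 < \<kappa>" "\<kappa> < 1 / 4" and \<epsilon>: "0 < \<epsilon>" "\<epsilon> \<le> 1 / 2" and d: "1 \<le> d" and \<Lambda>: "0 \<le> \<Lambda>"
    and b: "real b + 1 \<le> 16 / (\<kappa> * \<epsilon>)"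
  shows "25 / (\<kappa>\<^sup>2 * \<epsilon>\<^sup>2) * (3 + 4 * (b + 1) * d * ln (b + 1) + \<Lambda>)
    \<le> 25 / \<kappa>\<^sup>2 * (7 + 64 / \<kappa> * (2 * ln (16 / \<kappa>) + 1)) * (1 / \<epsilon>\<^sup>2 * (1 / \<epsilon> * d * ln (1 / \<epsilon>) + \<Lambda>))"
proof -
  define L where "L = ln (1 / \<epsilon>)"
  define c where "c = 2 * ln (16 / \<kappa>) + 1"
  define K where "K = 64 / \<kappa> * c"
  define T where "T = 1 / \<epsilon> * (d * L)"
  have L: "1 / 2 \<le> L"
  proof -
    have "ln 2 \<le> L" unfolding L_def using \<epsilon> by (subst ln_le_cancel_iff) (auto simp: field_simps)
    then show ?thesis using ln2_ge_two_thirds by linarith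
  qed
  have lk: "0 \<le> ln (16 / \<kappa>)" using \<kappa> by (intro ln_ge_zero) (simp add: le_divide_eq)
  have "ln (real b + 1) \<le> ln ((16 / \<kappa>) * (1 / \<epsilon>))"
    using b \<kappa> \<epsilon> by (subst ln_le_cancel_iff) auto
  also have "\<dots> = ln (16 / \<kappa>) + L"
    unfolding L_def using \<kappa> \<epsilon> by (subst ln_mult) auto
  also have "\<dots> \<le> c * L"
  proof -
    have "ln (16 / \<kappa>) * 1 \<le> ln (16 / \<kappa>) * (2 * L)" using L lk by (intro mult_left_mono) auto
    then show ?thesis unfolding c_def by (simp add: algebra_simps)
  qed
  finally have "4 * (real b + 1) * d * ln (real b + 1) \<le> 4 * (16 / (\<kappa> * \<epsilon>)) * d * (c * L)"
    using b \<kappa> \<epsilon> by (intro mult_mono) auto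
  also have "\<dots> = K * T" unfolding T_def K_def by simp
  finally have "4 * (real b + 1) * d * ln (real b + 1) \<le> K * T" .
  moreover have dL: "1 / 2 \<le> d * L" using mult_mono[of 1 "real d" "1 / 2" L] d L by simp
  moreover have "3 \<le> 6 * T" and "0 \<le> T"
  proof -
    have "1 * (1 / 2) \<le> T" unfolding T_def using \<epsilon> dL by (intro mult_mono) (auto simp: le_divide_eq)
    then show "3 \<le> 6 * T" "0 \<le> T" by auto
  qed
  moreover have "0 \<le> K" unfolding K_def c_def using \<kappa> lk by simp
  then have "1 * \<Lambda> \<le> (7 + K) * \<Lambda>" using \<Lambda> by (intro mult_right_mono) auto
  moreover have "(7 + K) * (T + \<Lambda>) = 7 * T + K * T + (7 + K) * \<Lambda>"
    by (simp add: algebra_simps)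
  ultimately have "3 + 4 * (real b + 1) * d * ln (real b + 1) + \<Lambda> \<le> (7 + K) * (T + \<Lambda>)"
    by linarith
  then have "25 / (\<kappa>\<^sup>2 * \<epsilon>\<^sup>2) * (3 + 4 * (real b + 1) * d * ln (real b + 1) + \<Lambda>)
      \<le> 25 / (\<kappa>\<^sup>2 * \<epsilon>\<^sup>2) * ((7 + K) * (T + \<Lambda>))"
    by (intro mult_left_mono) auto
  then show ?thesis unfolding K_def c_def L_def T_def by (simp add: mult_ac add_ac)
qed

theorem theorem20:
  fixes \<kappa> :: real
  assumes "\<kappa> > 0"
  shows "(\<exists>C>0. \<forall>(X :: 'a set) F \<epsilon> \<delta>.
            countable X \<longrightarrow> F \<subseteq> X \<rightarrow>\<^sub>E {0..1} \<longrightarrow>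
            0 < \<epsilon> \<longrightarrow> \<epsilon> < 1 \<longrightarrow> 0 < \<delta> \<longrightarrow> \<delta> < 1 \<longrightarrow>
            (\<forall>\<epsilon>'>0. fat X F ((1/4 - \<kappa>) * \<epsilon>') < \<infinity>) \<longrightarrow>
            (\<exists>A\<in>learners X. \<exists>m :: nat.
               real m \<le> C * (1 / \<epsilon>\<^sup>2 *
                 (real (the_enat (fat X F ((1/4 - \<kappa>) * \<epsilon>))) * (ln (1 / \<epsilon>))\<^sup>2 + ln (1 / \<delta>))) \<and>
               agnostic_learns X F A \<epsilon> \<delta> m))
       \<and> (\<exists>C>0. \<forall>(X :: 'a set) F \<epsilon> \<delta>.
            countable X \<longrightarrow> F \<subseteq> X \<rightarrow>\<^sub>E {0..1} \<longrightarrow>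
            0 < \<epsilon> \<longrightarrow> \<epsilon> < 1 \<longrightarrow> 0 < \<delta> \<longrightarrow> \<delta> < 1 \<longrightarrow>
            (\<forall>\<epsilon>'>0. fatV X F ((1/4 - \<kappa>) * \<epsilon>') < \<infinity>) \<longrightarrow>
            (\<exists>A\<in>learners X. \<exists>m :: nat.
               real m \<le> C * (1 / \<epsilon>\<^sup>2 *
                 (1 / \<epsilon> * real (the_enat (fatV X F ((1/4 - \<kappa>) * \<epsilon>))) * ln (1 / \<epsilon>) + ln (1 / \<delta>))) \<and>
               agnostic_learns X F A \<epsilon> \<delta> m))"
proof (intro conjI)
  define C where "C = 25 / \<kappa>\<^sup>2 * (13 + 21 * (2 * ln (4096 / \<kappa>\<^sup>2) + 2)\<^sup>2)"
  have C: "0 < C" unfolding C_def using assms by (intro mult_pos_pos) (auto intro: add_pos_nonneg)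
  show "\<exists>C>0. \<forall>(X :: 'a set) F \<epsilon> \<delta>.
            countable X \<longrightarrow> F \<subseteq> X \<rightarrow>\<^sub>E {0..1} \<longrightarrow>
            0 < \<epsilon> \<longrightarrow> \<epsilon> < 1 \<longrightarrow> 0 < \<delta> \<longrightarrow> \<delta> < 1 \<longrightarrow>
            (\<forall>\<epsilon>'>0. fat X F ((1/4 - \<kappa>) * \<epsilon>') < \<infinity>) \<longrightarrow>
            (\<exists>A\<in>learners X. \<exists>m :: nat.
               real m \<le> C * (1 / \<epsilon>\<^sup>2 *
                 (real (the_enat (fat X F ((1/4 - \<kappa>) * \<epsilon>))) * (ln (1 / \<epsilon>))\<^sup>2 + ln (1 / \<delta>))) \<and>
               agnostic_learns X F A \<epsilon> \<delta> m)"
  proof (intro exI[of _ C] conjI C allI impI)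
    fix X :: "'a set" and F :: "('a \<Rightarrow> real) set" and \<epsilon> \<delta> :: real
    assume X: "countable X" and F: "F \<subseteq> X \<rightarrow>\<^sub>E {0..1}" and \<epsilon>: "0 < \<epsilon>" "\<epsilon> < 1" and \<delta>: "0 < \<delta>" "\<delta> < 1"
      and "\<forall>\<epsilon>'>0. fat X F ((1/4 - \<kappa>) * \<epsilon>') < \<infinity>"
    then have fin: "fat X F ((1/4 - \<kappa>) * \<epsilon>) < \<infinity>" by blast
    define d where "d = the_enat (fat X F ((1/4 - \<kappa>) * \<epsilon>))"
    have lnd: "0 \<le> ln (1 / \<delta>)" using \<delta> by simp
    have "\<exists>A\<in>learners X. \<exists>m :: nat.
        real m \<le> C * (1 / \<epsilon>\<^sup>2 * (real d * (ln (1 / \<epsilon>))\<^sup>2 + ln (1 / \<delta>))) \<and> agnostic_learns X F A \<epsilon> \<delta> m"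
    \<comment> \<open>Here \<open>m = 0\<close> respects any bound. Otherwise \<open>d\<close> is
      positive and \<open>\<epsilon> \<le> 1 / 2\<close>, which keeps the claimed bound away from 0
      and leaves room for the constants.\<close>
    proof (cases "1 / 2 < \<epsilon> \<or> F = {} \<or> X = {} \<or> (1/4 - \<kappa>) * \<epsilon> \<le> 0 \<or> d = 0")
      case True
      have "\<exists>A\<in>learners X. agnostic_learns X F A \<epsilon> \<delta> 0"
      proof (rule learner_without_samples[OF F \<epsilon>(1) \<delta>(1) _ _ True[unfolded d_def]])
        show "2 * ((1/4 - \<kappa>) * \<epsilon>) < \<epsilon>" using \<epsilon> mult_pos_pos[OF assms \<epsilon>(1)] by (simp add: algebra_simps)
        show "length xs \<le> the_enat (fat X F ((1/4 - \<kappa>) * \<epsilon>))"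
          if "fatly_shatters X F ((1/4 - \<kappa>) * \<epsilon>) (map (\<lambda>x. (x, r)) xs)" for xs r
          using length_le_fat[OF that fin] by simp
      qed
      moreover have "real 0 \<le> C * (1 / \<epsilon>\<^sup>2 * (real d * (ln (1 / \<epsilon>))\<^sup>2 + ln (1 / \<delta>)))"
        using C lnd by simp
      ultimately show ?thesis by blast
    next
      case False
      then have \<kappa>: "0 < \<kappa>" "\<kappa> < 1 / 4" and ne: "F \<noteq> {}" "X \<noteq> {}" and d: "1 \<le> d" and \<epsilon>2: "\<epsilon> \<le> 1 / 2"
        using assms \<epsilon>(1) by (auto simp: not_le zero_less_mult_iff)
      note par = scale_parameters[OF \<kappa> \<epsilon>]
      define b where "b = nat \<lfloor>1 / (\<kappa> * ((1 / 2 - \<kappa>) * \<epsilon>) / 2)\<rfloor>"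
      note bound = fat_sample_bound[OF \<kappa> \<epsilon>(1) \<epsilon>2 d lnd par(4,5), folded b_def C_def]
      have "\<exists>A\<in>learners X. \<exists>m :: nat. real m \<le> 25 / (\<kappa>\<^sup>2 * \<epsilon>\<^sup>2) * (3 + 21 * d * (ln (16 * b * (b + 1)))\<^sup>2 + ln (1 / \<delta>))
          \<and> agnostic_learns X F A \<epsilon> \<delta> m"
      proof (rule learner_from_packing[OF X ne(2) F ne(1) \<kappa> \<epsilon> \<delta>])
        show "ln (card H) \<le> 21 * d * (ln (16 * b * (b + 1)))\<^sup>2"
          if "0 < N" "x \<in> {..<N} \<rightarrow> X" "H \<subseteq> F" "finite H" "l1_separated N x ((1 / 2 - \<kappa>) * \<epsilon>) H" for N x H
          using d by (intro fat_packing[OF F that(3,4) par(1) that(2,1) par(2,3) that(5) fin d_def[symmetric] _ b_def]) simp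
      qed simp
      then show ?thesis using bound by (meson order_trans)
    qed
    then show "\<exists>A\<in>learners X. \<exists>m :: nat.
               real m \<le> C * (1 / \<epsilon>\<^sup>2 *
                 (real (the_enat (fat X F ((1/4 - \<kappa>) * \<epsilon>))) * (ln (1 / \<epsilon>))\<^sup>2 + ln (1 / \<delta>))) \<and>
               agnostic_learns X F A \<epsilon> \<delta> m"
      unfolding d_def .
  qed
next
  \<comment> \<open>For \<open>\<kappa> < 1 / 4\<close> the logarithm is nonnegative, which makes
    the formula positive. For larger \<kappa> the scale is at most 0 and only the case without
    samples occurs, so any positive constant serves.\<close>
  define C where "C = (if \<kappa> < 1 / 4 then 25 / \<kappa>\<^sup>2 * (7 + 64 / \<kappa> * (2 * ln (16 / \<kappa>) + 1)) else 1)"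
  have C: "0 < C"
  proof (cases "\<kappa> < 1 / 4")
    case True
    then have "0 \<le> ln (16 / \<kappa>)" using assms by (intro ln_ge_zero) (simp add: le_divide_eq)
    then have "0 \<le> 64 / \<kappa> * (2 * ln (16 / \<kappa>) + 1)"
      using assms by (intro mult_nonneg_nonneg) auto
    then have "0 < 25 / \<kappa>\<^sup>2 * (7 + 64 / \<kappa> * (2 * ln (16 / \<kappa>) + 1))"
      using assms by (intro mult_pos_pos) auto
    then show ?thesis using True by (simp only: C_def if_True)
  qed (simp add: C_def)
  show "\<exists>C>0. \<forall>(X :: 'a set) F \<epsilon> \<delta>.
            countable X \<longrightarrow> F \<subseteq> X \<rightarrow>\<^sub>E {0..1} \<longrightarrow>
            0 < \<epsilon> \<longrightarrow> \<epsilon> < 1 \<longrightarrow> 0 < \<delta> \<longrightarrow> \<delta> < 1 \<longrightarrow>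
            (\<forall>\<epsilon>'>0. fatV X F ((1/4 - \<kappa>) * \<epsilon>') < \<infinity>) \<longrightarrow>
            (\<exists>A\<in>learners X. \<exists>m :: nat.
               real m \<le> C * (1 / \<epsilon>\<^sup>2 *
                 (1 / \<epsilon> * real (the_enat (fatV X F ((1/4 - \<kappa>) * \<epsilon>))) * ln (1 / \<epsilon>) + ln (1 / \<delta>))) \<and>
               agnostic_learns X F A \<epsilon> \<delta> m)"
  proof (intro exI[of _ C] conjI C allI impI)
    fix X :: "'a set" and F :: "('a \<Rightarrow> real) set" and \<epsilon> \<delta> :: real
    assume X: "countable X" and F: "F \<subseteq> X \<rightarrow>\<^sub>E {0..1}" and \<epsilon>: "0 < \<epsilon>" "\<epsilon> < 1" and \<delta>: "0 < \<delta>" "\<delta> < 1"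
      and "\<forall>\<epsilon>'>0. fatV X F ((1/4 - \<kappa>) * \<epsilon>') < \<infinity>"
    then have fin: "fatV X F ((1/4 - \<kappa>) * \<epsilon>) < \<infinity>" by blast
    define d where "d = the_enat (fatV X F ((1/4 - \<kappa>) * \<epsilon>))"
    have lnd: "0 \<le> ln (1 / \<delta>)" using \<delta> by simp
    have lne: "0 \<le> ln (1 / \<epsilon>)" using \<epsilon> by simp
    have "\<exists>A\<in>learners X. \<exists>m :: nat.
        real m \<le> C * (1 / \<epsilon>\<^sup>2 * (1 / \<epsilon> * real d * ln (1 / \<epsilon>) + ln (1 / \<delta>))) \<and> agnostic_learns X F A \<epsilon> \<delta> m"
    proof (cases "1 / 2 < \<epsilon> \<or> F = {} \<or> X = {} \<or> (1/4 - \<kappa>) * \<epsilon> \<le> 0 \<or> d = 0")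
      case True
      have "\<exists>A\<in>learners X. agnostic_learns X F A \<epsilon> \<delta> 0"
      proof (rule learner_without_samples[OF F \<epsilon>(1) \<delta>(1) _ _ True[unfolded d_def]])
        show "2 * ((1/4 - \<kappa>) * \<epsilon>) < \<epsilon>" using \<epsilon> mult_pos_pos[OF assms \<epsilon>(1)] by (simp add: algebra_simps)
      qed (rule length_le_fatV[OF _ _ fin])
      moreover have "real 0 \<le> C * (1 / \<epsilon>\<^sup>2 * (1 / \<epsilon> * real d * ln (1 / \<epsilon>) + ln (1 / \<delta>)))"
        using C lnd lne \<epsilon> by simp
      ultimately show ?thesis by blast
    next
      case False
      then have \<kappa>: "0 < \<kappa>" "\<kappa> < 1 / 4" and ne: "F \<noteq> {}" "X \<noteq> {}" and d: "1 \<le> d" and \<epsilon>2: "\<epsilon> \<le> 1 / 2"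
        using assms \<epsilon>(1) by (auto simp: not_le zero_less_mult_iff)
      note par = scale_parameters[OF \<kappa> \<epsilon>]
      define b where "b = nat \<lfloor>1 / (\<kappa> * ((1 / 2 - \<kappa>) * \<epsilon>) / 2)\<rfloor>"
      have C': "C = 25 / \<kappa>\<^sup>2 * (7 + 64 / \<kappa> * (2 * ln (16 / \<kappa>) + 1))" unfolding C_def using \<kappa> by simp
      note bound = fatV_sample_bound[OF \<kappa> \<epsilon>(1) \<epsilon>2 d lnd par(5), folded b_def C']
      have "\<exists>A\<in>learners X. \<exists>m :: nat. real m \<le> 25 / (\<kappa>\<^sup>2 * \<epsilon>\<^sup>2) * (3 + 4 * (b + 1) * d * ln (b + 1) + ln (1 / \<delta>))
          \<and> agnostic_learns X F A \<epsilon> \<delta> m"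
      proof (rule learner_from_packing[OF X ne(2) F ne(1) \<kappa> \<epsilon> \<delta>])
        show "ln (card H) \<le> 4 * (b + 1) * d * ln (b + 1)"
          if "0 < N" "x \<in> {..<N} \<rightarrow> X" "H \<subseteq> F" "finite H" "l1_separated N x ((1 / 2 - \<kappa>) * \<epsilon>) H" for N x H
          using d by (intro fatV_packing[OF F that(3,4) par(1) that(2,1) par(2,3) that(5) fin d_def[symmetric] _ b_def]) simp
      qed simp
      then show ?thesis using bound by (meson order_trans)
    qed
    then show "\<exists>A\<in>learners X. \<exists>m :: nat.
               real m \<le> C * (1 / \<epsilon>\<^sup>2 *
                 (1 / \<epsilon> * real (the_enat (fatV X F ((1/4 - \<kappa>) * \<epsilon>))) * ln (1 / \<epsilon>) + ln (1 / \<delta>))) \<and>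
               agnostic_learns X F A \<epsilon> \<delta> m"
      unfolding d_def .
  qed
qed

end
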